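(* Let $d\in\mathbb{N}$ with $d\ge 2$ and let $\alpha\in\mathbb{N}$ with $\alpha\ge 5$. Let $\mathcal{S}_{\alpha d}$ be the digital sequence over $\mathbb{Z}_2$ in dimension $s=\alpha d$ whose generating matrices $C_1,\ldots,C_{s}$ are constructed as described below (a special Sobol'/Niederreiter sequence), and let $\mathcal{S}_d=\mathscr{D}_\alpha^d(\mathcal{S}_{\alpha d})$ be the sequence in $[0,1)^d$ obtained by digit interlacing of order $\alpha$. Then there is a constant $C>0$, not depending on $N$ (in the paper's notation, the bound holds up to a factor depending only on $d$), such that $$L_{2,N}^{\mathrm{per}}(\mathscr{D}_\alpha^d(\mathcal{S}_{\alpha d})) \le C\,\frac{(\log N)^{(d-1)/2}}{N}\sqrt{S(N)}\qquad\text{for all } N\ge 2.$$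
   Context: Periodic $L_2$-discrepancy: for $x,y\in[0,1]$ let $I(x,y)=[x,y)$ if $x\le y$ and $I(x,y)=[0,y)\cup[x,1)$ if $x>y$; for $\boldsymbol{x},\boldsymbol{y}\in[0,1]^d$ let $B(\boldsymbol{x},\boldsymbol{y})=\prod_{j=1}^d I(x_j,y_j)$. For $\mathcal{P}=\{\boldsymbol{x}_0,\ldots,\boldsymbol{x}_{N-1}\}\subset[0,1)^d$, $L_{2,N}^{\mathrm{per}}(\mathcal{P})=\big(\int_{[0,1]^d}\int_{[0,1]^d}|A(B(\boldsymbol{x},\boldsymbol{y}),\mathcal{P})/N-\lambda_d(B(\boldsymbol{x},\boldsymbol{y}))|^2 d\boldsymbol{x}\,d\boldsymbol{y}\big)^{1/2}$, where $A(B,\mathcal{P})$ counts indices $n$ with $\boldsymbol{x}_n\in B$; for a sequence, $L_{2,N}^{\mathrm{per}}$ is that of its first $N$ points. $S(N)$ is the number of ones in the binary expansion of $N$. Digital sequences over $\mathbb{Z}_2=\{0,1\}$ (arithmetic mod 2): given $\mathbb{N}\times\mathbb{N}$ matrices $C_1,\ldots,C_s$ over $\mathbb{Z}_2$ such that each column has only finitely many nonzero entries, for $n=n_0+n_12+\cdots+n_{m-1}2^{m-1}$ put $\vec n=(n_0,n_1,\ldots,n_{m-1},0,0,\ldots)^\top$, $(x_{j,n,1},x_{j,n,2},\ldots)^\top:=C_j\vec n$ over $\mathbb{Z}_2$, $x_{j,n}=\sum_{k\ge1}x_{j,n,k}2^{-k}$, and $\boldsymbol{x}_n=(x_{1,n},\ldots,x_{s,n})$;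 the sequence $(\boldsymbol{x}_0,\boldsymbol{x}_1,\ldots)$ is the digital sequence with generating matrices $C_1,\ldots,C_s$. The matrices: let $p_1(x)=x$ and, for $j=2,\ldots,s$, let $p_j\in\mathbb{Z}_2[x]$ be the $(j-1)$-st polynomial in a list of primitive polynomials over $\mathbb{Z}_2$ sorted by nondecreasing degree; $e_j=\deg p_j$ (so $e_1=1$). For $j\in\{1,\ldots,s\}$ and $k\in\mathbb{N}$ write $k-1=(i-1)e_j+z$ with $z\in\{0,\ldots,e_j-1\}$, expand $x^{e_j-z-1}/p_j(x)^i=\sum_{l\ge1}a_l(i,j,z)x^{-l}$ in $\mathbb{Z}_2((x^{-1}))$, and set the $(k,l)$ entry of $C_j$ to be $a_l(i,j,z)$. Digit interlacing: for $x_1,\ldots,x_\alpha\in[0,1)$ with binary expansions $x_r=\sum_{a\ge1}\xi_{r,a}2^{-a}$ (with infinitely many zero digits), $\mathscr{D}_\alpha(x_1,\ldots,x_\alpha)=\sum_{a\ge1}\sum_{r=1}^\alpha \xi_{r,a}2^{-r-(a-1)\alpha}$; for $\boldsymbol{x}\in[0,1)^{\alpha d}$, $\mathscr{D}_\alpha^d(\boldsymbol{x})=(\mathscr{D}_\alpha(x_1,\ldots,x_\alpha),\ldots,\mathscr{D}_\alpha(x_{(d-1)\alpha+1},\ldots,x_{\alpha d}))$, and for a sequence it is applied termwise.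
   Formalization: The constant C is allowed to depend on α as well as on d (not on N or the list of primitive polynomials); a factor depending only on d is impossible in general, since for large α the leading digits of the second coordinate can all coincide. *)

theory Defs
  imports
    "HOL-Analysis.Analysis"
    "HOL-Computational_Algebra.Formal_Laurent_Series"
    "HOL-Library.Z2"
begin

section \<open>Periodic \<open>L\<^sub>2\<close>-discrepancy\<close>

text \<open>
  Coordinates are numbered \<open>1, \<dots>, d\<close>. A point of \<open>d\<close>-dimensional space is a function
  \<^typ>\<open>nat \<Rightarrow> real\<close> that is \<^const>\<open>undefined\<close> outside \<open>{1..d}\<close>, as in \<^const>\<open>PiM\<close>.
\<close>

definition periodic_interval :: "real \<Rightarrow> real \<Rightarrow> real set" where
  "periodic_interval x y = (if x \<le> y then {x..<y} else {0..<y} \<union> {x..<1})"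

definition periodic_box :: "nat \<Rightarrow> (nat \<Rightarrow> real) \<Rightarrow> (nat \<Rightarrow> real) \<Rightarrow> (nat \<Rightarrow> real) set" where
  "periodic_box d x y = (\<Pi>\<^sub>E j\<in>{1..d}. periodic_interval (x j) (y j))"

definition lebesgue_d :: "nat \<Rightarrow> (nat \<Rightarrow> real) measure" where
  "lebesgue_d d = (\<Pi>\<^sub>M j\<in>{1..d}. lborel)"

definition unit_cube :: "nat \<Rightarrow> (nat \<Rightarrow> real) set" where
  "unit_cube d = (\<Pi>\<^sub>E j\<in>{1..d}. {0..1})"

definition count_points :: "nat \<Rightarrow> (nat \<Rightarrow> nat \<Rightarrow> real) \<Rightarrow> (nat \<Rightarrow> real) set \<Rightarrow> nat" where
  "count_points N X B = card {n. n < N \<and> X n \<in> B}"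

definition periodic_L2_discrepancy :: "nat \<Rightarrow> nat \<Rightarrow> (nat \<Rightarrow> nat \<Rightarrow> real) \<Rightarrow> real" where
  "periodic_L2_discrepancy d N X =
    sqrt (LINT x:unit_cube d|lebesgue_d d. LINT y:unit_cube d|lebesgue_d d.
      \<bar>real (count_points N X (periodic_box d x y)) / real N
        - measure (lebesgue_d d) (periodic_box d x y)\<bar>\<^sup>2)"

definition sum_of_binary_digits :: "nat \<Rightarrow> nat" where
  "sum_of_binary_digits N = card {r. bit N r}"

section \<open>Digital sequences\<close>

text \<open>
  A generating matrix is given by its entries \<^term>\<open>C k l\<close> with row index \<open>k \<ge> 1\<close> and column
  index \<open>l \<ge> 1\<close>. Column \<open>l\<close> is multiplied by the binary digit \<open>n\<^bsub>l-1\<^esub>\<close> of \<open>n\<close>, and since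
  \<open>n < 2 ^ n\<close> this digit is zero for \<open>l > n\<close>.
\<close>

definition digital_digit :: "(nat \<Rightarrow> nat \<Rightarrow> bit) \<Rightarrow> nat \<Rightarrow> nat \<Rightarrow> bit" where
  "digital_digit C n k = (\<Sum>l=1..n. C k l * of_bool (bit n (l - 1)))"

definition digital_sequence ::
    "nat \<Rightarrow> (nat \<Rightarrow> nat \<Rightarrow> nat \<Rightarrow> bit) \<Rightarrow> nat \<Rightarrow> nat \<Rightarrow> real" where
  "digital_sequence s C n =
    (\<lambda>j\<in>{1..s}. \<Sum>k. of_bool (digital_digit (C j) n (Suc k) = 1) / 2 ^ Suc k)"

section \<open>Generating matrices of the special Sobol'/Niederreiter sequence\<close>

text \<open>
  A primitive polynomial is the minimal polynomial of a generator of the multiplicative group of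
  a finite field: an irreducible \<open>p\<close> is the minimal polynomial of the residue class of \<open>x\<close> in the
  field of polynomials modulo \<open>p\<close>, so this class has to be nonzero and its powers have to exhaust
  the nonzero classes. (The polynomial \<open>x\<close> itself is not primitive, whereas \<open>x + 1\<close> is.)
\<close>

definition primitive_poly :: "bit poly \<Rightarrow> bool" where
  "primitive_poly p \<longleftrightarrow> irreducible p \<and> \<not> p dvd [:0, 1:] \<and>
    (\<forall>g. \<not> p dvd g \<longrightarrow> (\<exists>k::nat. p dvd [:0, 1:] ^ k - g))"

text \<open>
  Enumerations \<open>q 1, q 2, \<dots>\<close> of all primitive polynomials, without repetition and by nondecreasing
  degree; the order among polynomials of the same degree is arbitrary.
\<close>

definition sorted_primitive_list :: "(nat \<Rightarrow> bit poly) \<Rightarrow> bool" where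
  "sorted_primitive_list q \<longleftrightarrow>
    bij_betw q {1..} {p. primitive_poly p} \<and> mono_on {1..} (\<lambda>i. degree (q i))"

definition sobol_poly :: "(nat \<Rightarrow> bit poly) \<Rightarrow> nat \<Rightarrow> bit poly" where
  "sobol_poly q j = (if j = 1 then [:0, 1:] else q (j - 1))"

text \<open>
  The field of formal Laurent series in \<open>x\<^sup>-\<^sup>1\<close> is \<^typ>\<open>bit fls\<close> with its variable read as
  \<open>x\<^sup>-\<^sup>1\<close>. Hence the polynomial variable \<open>x\<close> is embedded as \<^const>\<open>fls_X_inv\<close>, and the coefficient
  of \<open>x\<^sup>-\<^sup>l\<close> is \<open>fls_nth\<close> at \<open>l\<close>.
\<close>

definition poly_to_inv_fls :: "bit poly \<Rightarrow> bit fls" where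
  "poly_to_inv_fls f = poly (map_poly fls_const f) fls_X_inv"

definition sobol_coeff :: "bit poly \<Rightarrow> nat \<Rightarrow> nat \<Rightarrow> nat \<Rightarrow> bit" where
  "sobol_coeff p i z l =
    fls_nth (poly_to_inv_fls ([:0, 1:] ^ (degree p - z - 1)) / poly_to_inv_fls p ^ i) (int l)"

definition sobol_matrix :: "(nat \<Rightarrow> bit poly) \<Rightarrow> nat \<Rightarrow> nat \<Rightarrow> nat \<Rightarrow> bit" where
  "sobol_matrix q j k l =
    (let p = sobol_poly q j; e = degree p
     in sobol_coeff p ((k - 1) div e + 1) ((k - 1) mod e) l)"

definition sobol_sequence :: "nat \<Rightarrow> (nat \<Rightarrow> bit poly) \<Rightarrow> nat \<Rightarrow> nat \<Rightarrow> real" where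
  "sobol_sequence s q = digital_sequence s (sobol_matrix q)"

section \<open>Digit interlacing\<close>

text \<open>
  For \<open>0 \<le> x < 1\<close> these digits form the binary expansion with infinitely many zeros.
\<close>

definition binary_digit :: "real \<Rightarrow> nat \<Rightarrow> nat" where
  "binary_digit x a = nat (\<lfloor>2 ^ a * x\<rfloor> mod 2)"

definition interlace :: "nat \<Rightarrow> (nat \<Rightarrow> real) \<Rightarrow> real" where
  "interlace \<alpha> x = (\<Sum>a. \<Sum>r=1..\<alpha>. real (binary_digit (x r) (Suc a)) / 2 ^ (r + a * \<alpha>))"

definition interlace_d :: "nat \<Rightarrow> nat \<Rightarrow> (nat \<Rightarrow> real) \<Rightarrow> nat \<Rightarrow> real" where
  "interlace_d \<alpha> d x = (\<lambda>j\<in>{1..d}. interlace \<alpha> (\<lambda>r. x ((j - 1) * \<alpha> + r)))"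

definition interlaced_sobol_sequence ::
    "nat \<Rightarrow> nat \<Rightarrow> (nat \<Rightarrow> bit poly) \<Rightarrow> nat \<Rightarrow> nat \<Rightarrow> real" where
  "interlaced_sobol_sequence \<alpha> d q n = interlace_d \<alpha> d (sobol_sequence (\<alpha> * d) q n)"

end

theory Submission
  imports Defs "HOL-Computational_Algebra.Polynomial_Factorial"
begin

text \<open>
  By Fubini, \<open>(N L)\<^sup>2 + N\<^sup>2 / 3\<^sup>d\<close> is the double sum over the points of the product kernel built from
  \<open>K(x, y) = 1/2 - |x - y| + (x - y)\<^sup>2\<close>. On dyadic numbers with \<open>R\<close> digits, \<open>K\<close> is a constant plus a
  finite sum over levels \<open>l < R\<close> of positive semidefinite kernels given by centred Faber hat functions
  on the dyadic intervals of length \<open>2\<^bsup>-l\<^esup>\<close>. So the discrepancy is a sum, over coordinate sets and level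
  vectors, of squared norms, each a seminorm of the point set.

  A hat function is its dyadic interval times \<open>1/4\<close> plus a combination of products of two Walsh signs,
  at positions \<open>l\<close> and \<open>l + b\<close>, with weights of order \<open>2\<^bsup>-b\<^esup>\<close>. Split the first \<open>N\<close> points into one block of
  \<open>2\<^sup>m\<close> points per binary digit of \<open>N\<close>. For such a block all sign products vanish unless the total of the
  \<open>b\<close> exceeds \<open>5 (m - L) - O(1)\<close>, \<open>L\<close> being the total level: this is the net property of the Sobol'
  matrices (uniqueness of partial fractions), amplified by interlacing. Hence the squared norm of a block
  at total level \<open>L\<close> is \<open>O(2\<^bsup>-|m-L|\<^esup>)\<close>. This decay makes blocks of different sizes almost orthogonal, so
  the squared norms add up over the binary digits of \<open>N\<close>, each digit contributing the \<open>O(m\<^bsup>d-1\<^esup>)\<close> level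
  vectors with \<open>L\<close> near \<open>m\<close>.
\<close>

section \<open>Faber expansion of the kernel\<close>

text \<open>The interlacing order decides the exponent of the logarithm. At a total level L below m
  the hat functions vary within their boxes, so exact box counts alone do not make a block small:
  what remains is a sum of weights 2^-b over the offsets b that the net cannot annihilate. If these
  offsets only had to exceed m - L, as without interlacing, the same estimate would give block
  energies without decay for L below m, and each binary digit of N would pay for about m^d level
  vectors. Offsets beyond 5 (m - L) make the energies decay geometrically, and only the m^(d-1)
  vectors with L near m count.

  All expansions are exact finite identities for points with R binary digits. The truncation shows
  only in the constant 1/3 of the kernel, which becomes 1/3 + 1/(6 * 4^R); this is harmless once N
  is at most 2^R. The constant C can be fixed before the list of polynomials because the defect of
  the net depends only on their degrees.\<close>

definition dyadic_val :: "nat \<Rightarrow> (nat \<Rightarrow> bool) \<Rightarrow> real" where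
  "dyadic_val R f = (\<Sum>p<R. of_bool (f p) / 2 ^ Suc p)"

definition tent :: "real \<Rightarrow> real" where
  "tent y = min y (1 - y)"

text \<open>A dyadic interval of length 2^-l is encoded by the positions of the ones among its first
  l digits, so that the intervals of level l are exactly the subsets of
  \<open>{..<l}\<close>.\<close>

definition digit_prefix :: "nat \<Rightarrow> (nat \<Rightarrow> bool) \<Rightarrow> nat set" where
  "digit_prefix l f = {p. p < l \<and> f p}"

definition digit_tail :: "nat \<Rightarrow> nat \<Rightarrow> (nat \<Rightarrow> bool) \<Rightarrow> real" where
  "digit_tail R l f = dyadic_val (R - l) (\<lambda>p. f (p + l))"

text \<open>The hat function on the dyadic interval \<open>a\<close>: the distance from the point to
  the nearer endpoint, and zero outside.\<close>

definition faber :: "nat \<Rightarrow> nat \<Rightarrow> nat set \<Rightarrow> (nat \<Rightarrow> bool) \<Rightarrow> real" where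
  "faber R l a f = of_bool (digit_prefix l f = a) * tent (digit_tail R l f) / 2 ^ l"

text \<open>This is 1/3 plus the Bernoulli polynomial t^2 - t + 1/6 at t = |x - y|. It arises as the
  measure of the pairs of endpoints whose periodic interval contains both x and y.\<close>

definition periodic_kernel :: "real \<Rightarrow> real \<Rightarrow> real" where
  "periodic_kernel x y = 1 / 2 - \<bar>x - y\<bar> + (x - y)\<^sup>2"

lemma dyadic_val_Suc:
  "dyadic_val (Suc R) f = (of_bool (f 0) + dyadic_val R (\<lambda>p. f (Suc p))) / 2"
  unfolding dyadic_val_def
  by (subst sum.lessThan_Suc_shift) (simp add: sum_divide_distrib add_divide_distrib mult.commute)

lemma dyadic_val_nonneg: "0 \<le> dyadic_val R f"
  unfolding dyadic_val_def by (intro sum_nonneg) auto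

lemma dyadic_val_le: "dyadic_val R f \<le> 1 - 1 / 2 ^ R"
proof (induction R arbitrary: f)
  case 0
  then show ?case by (simp add: dyadic_val_def)
next
  case (Suc R)
  have "dyadic_val (Suc R) f \<le> (1 + (1 - 1 / 2 ^ R)) / 2"
    unfolding dyadic_val_Suc using Suc[of "\<lambda>p. f (Suc p)"] by (cases "f 0") simp_all
  then show ?case by (simp add: field_simps)
qed

lemma dyadic_val_less_1: "dyadic_val R f < 1"
  using dyadic_val_le[of R f] by (smt (verit) divide_pos_pos zero_less_power)

lemma dyadic_val_le_1: "dyadic_val R f \<le> 1"
  using dyadic_val_less_1[of R f] by simp

lemma digit_tail_0: "digit_tail R 0 f = dyadic_val R f"
  by (simp add: digit_tail_def)

lemma digit_tail_Suc: "digit_tail (Suc R) (Suc l) f = digit_tail R l (\<lambda>p. f (Suc p))"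
  by (simp add: digit_tail_def)

lemma digit_prefix_0 [simp]: "digit_prefix 0 f = {}"
  by (simp add: digit_prefix_def)

lemma digit_prefix_eq_iff:
  "digit_prefix l f = digit_prefix l g \<longleftrightarrow> (\<forall>p<l. f p = g p)"
  unfolding digit_prefix_def by (auto simp: set_eq_iff)

lemma digit_prefix_in_Pow: "digit_prefix l f \<in> Pow {..<l}"
  by (auto simp: digit_prefix_def)

lemma digit_prefix_Suc_eq_iff:
  "digit_prefix (Suc l) f = digit_prefix (Suc l) g \<longleftrightarrow>
     f 0 = g 0 \<and> digit_prefix l (\<lambda>p. f (Suc p)) = digit_prefix l (\<lambda>p. g (Suc p))"
  unfolding digit_prefix_eq_iff using less_Suc_eq_0_disj by auto

text \<open>The finite Levy-Ciesielski expansion of the covariance of the Brownian bridge. The first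
  digit selects a half of the unit interval: level 0 accounts for the value at 1/2, and inside a
  common half a bridge of half the variance remains. Points in different halves share only the level
  0 term.\<close>

lemma brownian_bridge_expansion:
  "min (dyadic_val R f) (dyadic_val R g) - dyadic_val R f * dyadic_val R g =
     (\<Sum>l<R. of_bool (digit_prefix l f = digit_prefix l g) *
        tent (digit_tail R l f) * tent (digit_tail R l g) / 2 ^ l)"
proof (induction R arbitrary: f g)
  case 0
  then show ?case by (simp add: dyadic_val_def)
next
  case (Suc R)
  define f' g' where "f' = (\<lambda>p. f (Suc p))" and "g' = (\<lambda>p. g (Suc p))"
  define x y where "x = dyadic_val R f'" and "y = dyadic_val R g'"
  have xy: "0 \<le> x" "x \<le> 1" "0 \<le> y" "y \<le> 1"
    by (auto simp: x_def y_def dyadic_val_nonneg dyadic_val_le_1)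
  have vx: "dyadic_val (Suc R) f = (of_bool (f 0) + x) / 2"
    and vy: "dyadic_val (Suc R) g = (of_bool (g 0) + y) / 2"
    by (simp_all add: dyadic_val_Suc x_def y_def f'_def g'_def)
  have "(\<Sum>l<Suc R. of_bool (digit_prefix l f = digit_prefix l g) *
        tent (digit_tail (Suc R) l f) * tent (digit_tail (Suc R) l g) / 2 ^ l)
     = tent (dyadic_val (Suc R) f) * tent (dyadic_val (Suc R) g) +
      of_bool (f 0 = g 0) / 2 * (\<Sum>l<R. of_bool (digit_prefix l f' = digit_prefix l g') *
        tent (digit_tail R l f') * tent (digit_tail R l g') / 2 ^ l)"
    by (subst sum.lessThan_Suc_shift)
       (auto simp: digit_tail_0 digit_tail_Suc digit_prefix_Suc_eq_iff f'_def g'_def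
          sum_distrib_left intro!: sum.cong)
  also have "\<dots> = tent (dyadic_val (Suc R) f) * tent (dyadic_val (Suc R) g) +
      of_bool (f 0 = g 0) / 2 * (min x y - x * y)"
    unfolding Suc.IH[of f' g', symmetric] x_def y_def ..
  also have "\<dots> = min (dyadic_val (Suc R) f) (dyadic_val (Suc R) g) -
      dyadic_val (Suc R) f * dyadic_val (Suc R) g"
    unfolding vx vy tent_def using xy
    by (cases "f 0"; cases "g 0"; cases "x \<le> y") (simp_all add: min_def field_simps)
  finally show ?case by simp
qed

text \<open>The Takagi-Landsberg series with ratio 1/4, whose sum is a parabola. It is linear in the
  hats, as the cross terms of centred hats require.\<close>

lemma parabola_expansion:
  "dyadic_val R f * (1 - dyadic_val R f) = (\<Sum>l<R. tent (digit_tail R l f) / 4 ^ l) / 2"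
proof (induction R arbitrary: f)
  case 0
  then show ?case by (simp add: dyadic_val_def)
next
  case (Suc R)
  define f' where "f' = (\<lambda>p. f (Suc p))"
  define x where "x = dyadic_val R f'"
  have xy: "0 \<le> x" "x \<le> 1"
    by (auto simp: x_def dyadic_val_nonneg dyadic_val_le_1)
  have vx: "dyadic_val (Suc R) f = (of_bool (f 0) + x) / 2"
    by (simp_all add: dyadic_val_Suc x_def f'_def)
  have "(\<Sum>l<Suc R. tent (digit_tail (Suc R) l f) / 4 ^ l) / 2
     = tent (dyadic_val (Suc R) f) / 2 + (\<Sum>l<R. tent (digit_tail R l f') / 4 ^ l) / 2 / 4"
    by (subst sum.lessThan_Suc_shift)
       (simp add: digit_tail_0 digit_tail_Suc f'_def sum_divide_distrib add_divide_distrib ac_simps)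
  also have "\<dots> = tent (dyadic_val (Suc R) f) / 2 + x * (1 - x) / 4"
    unfolding Suc.IH[of f', symmetric] x_def ..
  also have "\<dots> = dyadic_val (Suc R) f * (1 - dyadic_val (Suc R) f)"
    unfolding vx tent_def using xy
    by (cases "f 0") (simp_all add: min_def field_simps)
  finally show ?case by simp
qed

lemma sum_faber:
  "(\<Sum>a\<in>Pow {..<l}. faber R l a f) = tent (digit_tail R l f) / 2 ^ l"
proof -
  have "(\<Sum>a\<in>Pow {..<l}. faber R l a f) =
      (\<Sum>a\<in>Pow {..<l}. if a = digit_prefix l f then tent (digit_tail R l f) / 2 ^ l else 0)"
    by (intro sum.cong) (auto simp: faber_def)
  also have "\<dots> = tent (digit_tail R l f) / 2 ^ l"
    using digit_prefix_in_Pow[of l f] by (subst sum.delta) auto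
  finally show ?thesis .
qed

lemma sum_faber_mult:
  "(\<Sum>a\<in>Pow {..<l}. faber R l a f * faber R l a g) =
     of_bool (digit_prefix l f = digit_prefix l g) *
        tent (digit_tail R l f) * tent (digit_tail R l g) / 4 ^ l"
proof -
  have "(\<Sum>a\<in>Pow {..<l}. faber R l a f * faber R l a g) =
      (\<Sum>a\<in>Pow {..<l}. if a = digit_prefix l f then of_bool (digit_prefix l f = digit_prefix l g) *
        tent (digit_tail R l f) * tent (digit_tail R l g) / 4 ^ l else 0)"
    by (intro sum.cong) (auto simp: faber_def simp flip: power_mult_distrib)
  also have "\<dots> = of_bool (digit_prefix l f = digit_prefix l g) *
        tent (digit_tail R l f) * tent (digit_tail R l g) / 4 ^ l"
    using digit_prefix_in_Pow[of l f] by (subst sum.delta) auto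
  finally show ?thesis .
qed

text \<open>The subtracted number is the integral of the hat over the unit interval: a triangle of
  base 2^-l and height 2^-l / 2.\<close>

definition faber0 :: "nat \<Rightarrow> nat \<Rightarrow> nat set \<Rightarrow> (nat \<Rightarrow> bool) \<Rightarrow> real" where
  "faber0 R l a f = faber R l a f - 1 / (4 * 4 ^ l)"

lemma sum_inverse_4_powers: "(\<Sum>l<R. 1 / 4 ^ l) = (4 / 3 :: real) * (1 - 1 / 4 ^ R)"
proof (induction R)
  case (Suc R)
  show ?case
    unfolding sum.lessThan_Suc Suc.IH by (simp add: field_simps)
qed simp

text \<open>The kernel equals 1/2 + 2 (min x y - x y) - x (1 - x) - y (1 - y). The bridge covariance
  supplies the quadratic terms, the two parabolas supply the linear terms that complete the square,
  and the squared means add 1/8 * 4^-l at level l. The summand \<open>1 / (6 * 4 ^ R)\<close> is the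
  total of these constants over the missing levels from R on.\<close>

lemma periodic_kernel_expansion:
  "periodic_kernel (dyadic_val R f) (dyadic_val R g) =
     1 / 3 + 1 / (6 * 4 ^ R) +
     (\<Sum>l<R. 2 * 2 ^ l * (\<Sum>a\<in>Pow {..<l}. faber0 R l a f * faber0 R l a g))"
proof -
  define x y where "x = dyadic_val R f" and "y = dyadic_val R g"
  have *: "2 * 2 ^ l * (\<Sum>a\<in>Pow {..<l}. faber0 R l a f * faber0 R l a g) =
      2 * (of_bool (digit_prefix l f = digit_prefix l g) *
        tent (digit_tail R l f) * tent (digit_tail R l g) / 2 ^ l)
      - (tent (digit_tail R l f) / 4 ^ l) / 2 - (tent (digit_tail R l g) / 4 ^ l) / 2
      + 1 / 8 * (1 / 4 ^ l)" for l
  proof -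
    define c :: real where "c = 1 / (4 * 4 ^ l)"
    have four: "(4::real) ^ l = 2 ^ l * 2 ^ l"
      by (simp flip: power_mult_distrib)
    have "(\<Sum>a\<in>Pow {..<l}. faber0 R l a f * faber0 R l a g) =
        (\<Sum>a\<in>Pow {..<l}. faber R l a f * faber R l a g - c * faber R l a f - c * faber R l a g + c * c)"
      unfolding faber0_def c_def[symmetric] by (intro sum.cong) (auto simp: algebra_simps)
    also have "\<dots> = of_bool (digit_prefix l f = digit_prefix l g) *
        tent (digit_tail R l f) * tent (digit_tail R l g) / 4 ^ l
        - c * (tent (digit_tail R l f) / 2 ^ l) - c * (tent (digit_tail R l g) / 2 ^ l) + 2 ^ l * (c * c)"
      by (simp add: sum.distrib sum_subtractf sum_faber_mult sum_faber card_Pow flip: sum_distrib_left)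
    finally show ?thesis
      unfolding c_def four by (simp only:) (simp add: field_simps)
  qed
  have "(\<Sum>l<R. 2 * 2 ^ l * (\<Sum>a\<in>Pow {..<l}. faber0 R l a f * faber0 R l a g)) =
     2 * (min x y - x * y) - x * (1 - x) - y * (1 - y) + 1 / 8 * (4 / 3 * (1 - 1 / 4 ^ R))"
    unfolding x_def y_def brownian_bridge_expansion parabola_expansion
    by (simp only: * sum.distrib sum_subtractf sum_inverse_4_powers flip: sum_distrib_left sum_divide_distrib)
  moreover have "periodic_kernel x y = 1 / 3 + 1 / (6 * 4 ^ R) +
     (2 * (min x y - x * y) - x * (1 - x) - y * (1 - y) + 1 / 8 * (4 / 3 * (1 - 1 / 4 ^ R)))"
    by (cases "x \<le> y") (simp_all add: periodic_kernel_def power2_eq_square field_simps)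
  ultimately show ?thesis
    by (simp only: x_def y_def)
qed

text \<open>The weight at \<open>b = S\<close> collects the tail of the series: digits at positions \<open>\<ge> S\<close> vanish.\<close>

definition tent_weight :: "nat \<Rightarrow> nat \<Rightarrow> real" where
  "tent_weight S b = (if b = 0 then 1 / 4 else if b < S then - 1 / 2 ^ (b + 2) else - 1 / 2 ^ Suc b)"

definition digit_sign :: "(nat \<Rightarrow> bool) \<Rightarrow> nat \<Rightarrow> real" where
  "digit_sign f p = (if f p then -1 else 1)"

lemma digit_sign_square [simp]: "digit_sign f p * digit_sign f p = 1"
  by (simp add: digit_sign_def)

lemma abs_digit_sign [simp]: "\<bar>digit_sign f p\<bar> = 1"
  by (simp add: digit_sign_def)

lemma abs_tent_weight_le: "\<bar>tent_weight S b\<bar> \<le> 1 / 2 ^ b"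
  by (auto simp: tent_weight_def field_simps)

lemma sum_powers_half: "(\<Sum>b<S. 1 / 2 ^ Suc b) = (1 - 1 / 2 ^ S :: real)"
proof (induction S)
  case (Suc S)
  show ?case
    unfolding sum.lessThan_Suc Suc.IH by (simp add: field_simps)
qed simp

text \<open>The tent folds the unit interval at 1/2, so its digits are those of the point xor-ed
  with the leading digit; each xor is a product of two signs. Complementing a finite expansion falls
  short of 1 - x by one unit 2^-S. The vanishing digit at position S lets the last summand depend on
  the leading sign alone and supply this unit.\<close>

lemma tent_walsh_expansion:
  assumes "S > 0" "\<not> f S"
  shows "tent (dyadic_val S f) = (\<Sum>b\<le>S. tent_weight S b * (digit_sign f 0 * digit_sign f b))"
proof -
  obtain S' where S: "S = Suc S'" using assms(1) by (cases S) auto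
  define h where "h = (\<lambda>b. digit_sign f 0 * digit_sign f b)"
  have xor: "h b = 1 - 2 * of_bool (f 0 \<noteq> f b)" for b
    by (auto simp: h_def digit_sign_def)
  have x: "dyadic_val S f = of_bool (f 0) / 2 + (\<Sum>b<S'. of_bool (f (Suc b)) / 2 ^ (b + 2))"
    unfolding dyadic_val_def S by (subst sum.lessThan_Suc_shift) simp
  have le: "(\<Sum>b<S'. of_bool (f (Suc b)) / 2 ^ (b + 2)) \<le> (1/2::real)"
    and ge: "(\<Sum>b<S'. of_bool (f (Suc b)) / 2 ^ (b + 2)) \<ge> (0::real)"
  proof -
    have "(\<Sum>b<S'. of_bool (f (Suc b)) / 2 ^ (b + 2)) \<le> (\<Sum>b<S'. 1 / 2 ^ Suc b / 2 :: real)"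
      by (intro sum_mono) (auto simp: field_simps)
    also have "\<dots> = (1 - 1 / 2 ^ S') / 2"
      by (simp only: sum_powers_half flip: sum_divide_distrib)
    also have "\<dots> \<le> 1 / 2" by simp
    finally show "(\<Sum>b<S'. of_bool (f (Suc b)) / 2 ^ (b + 2)) \<le> (1/2::real)" .
  qed (intro sum_nonneg, auto)
  have t: "tent (dyadic_val S f) = (if f 0 then 1/2 - (\<Sum>b<S'. of_bool (f (Suc b)) / 2 ^ (b + 2))
      else (\<Sum>b<S'. of_bool (f (Suc b)) / 2 ^ (b + 2)))"
    unfolding tent_def x using le ge by (auto simp: min_def)
  have "(\<Sum>b\<le>S. tent_weight S b * h b) =
     tent_weight S 0 * h 0 + (\<Sum>b<S'. tent_weight S (Suc b) * h (Suc b)) + tent_weight S S * h S"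
    unfolding S sum.atMost_Suc by (subst sum.atMost_shift) simp
  also have "tent_weight S 0 * h 0 = 1 / 4"
    by (simp add: tent_weight_def h_def)
  also have "tent_weight S S * h S = - 1 / 2 ^ Suc S + of_bool (f 0) / 2 ^ S"
    using assms by (simp add: tent_weight_def xor field_simps)
  also have "(\<Sum>b<S'. tent_weight S (Suc b) * h (Suc b)) =
      (\<Sum>b<S'. - (1 / 2 ^ Suc b) / 4 + of_bool (f 0 \<noteq> f (Suc b)) / 2 ^ (b + 2))"
    by (intro sum.cong) (auto simp: S tent_weight_def xor field_simps)
  also have "\<dots> = - (1 - 1 / 2 ^ S') / 4 + (\<Sum>b<S'. of_bool (f 0 \<noteq> f (Suc b)) / 2 ^ (b + 2))"
    by (simp only: sum.distrib sum_powers_half sum_negf flip: sum_divide_distrib)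
  also have "(\<Sum>b<S'. of_bool (f 0 \<noteq> f (Suc b)) / 2 ^ (b + 2)) = 
     (if f 0 then (1 - 1 / 2 ^ S') / 2 - (\<Sum>b<S'. of_bool (f (Suc b)) / 2 ^ (b + 2))
       else (\<Sum>b<S'. of_bool (f (Suc b)) / 2 ^ (b + 2)) :: real)"
  proof (cases "f 0")
    case True
    have "(\<Sum>b<S'. of_bool (f 0 \<noteq> f (Suc b)) / 2 ^ (b + 2)) = 
       (\<Sum>b<S'. 1 / 2 ^ Suc b / 2 - of_bool (f (Suc b)) / 2 ^ (b + 2) :: real)"
      using True by (intro sum.cong) (auto simp: field_simps)
    also have "\<dots> = (1 - 1 / 2 ^ S') / 2 - (\<Sum>b<S'. of_bool (f (Suc b)) / 2 ^ (b + 2))"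
      by (simp only: sum_subtractf sum_powers_half flip: sum_divide_distrib)
    finally show ?thesis using True by simp
  next
    case False
    then show ?thesis by simp
  qed
  also have "1 / 4 + (- (1 - 1 / 2 ^ S') / 4 +
       (if f 0 then (1 - 1 / 2 ^ S') / 2 - (\<Sum>b<S'. of_bool (f (Suc b)) / 2 ^ (b + 2))
        else (\<Sum>b<S'. of_bool (f (Suc b)) / 2 ^ (b + 2)))) +
       (- 1 / 2 ^ Suc S + of_bool (f 0) / 2 ^ S) = tent (dyadic_val S f)"
    unfolding t by (cases "f 0") (simp_all add: S field_simps)
  finally show ?thesis by (simp add: h_def)
qed

section \<open>Integral representation of the discrepancy\<close>

definition arc_length :: "real \<Rightarrow> real \<Rightarrow> real" where
  "arc_length x y = measure lborel (periodic_interval x y)"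

text \<open>Integrability and value are kept in one predicate, so that linear combinations and
  products over coordinates carry both along.\<close>

definition has_unit_integral :: "(real \<Rightarrow> real) \<Rightarrow> real \<Rightarrow> bool" where
  "has_unit_integral f I \<longleftrightarrow> has_bochner_integral lborel (\<lambda>v. indicator {0..1} v * f v) I"

lemma emeasure_periodic_interval:
  assumes "0 \<le> x" "x \<le> 1" "0 \<le> y" "y \<le> 1"
  shows "emeasure lborel (periodic_interval x y) = ennreal (y - x + of_bool (y < x))"
proof (cases "x \<le> y")
  case False
  have "emeasure lborel ({0..<y} \<union> {x..<1}) = emeasure lborel {0..<y} + emeasure lborel {x..<1}"
    using False by (intro plus_emeasure[symmetric]) auto
  then show ?thesis
    using False assms by (simp add: periodic_interval_def flip: ennreal_plus)
qed (simp add: periodic_interval_def)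

lemma arc_length_eq:
  assumes "0 \<le> x" "x \<le> 1" "0 \<le> y" "y \<le> 1"
  shows "arc_length x y = y - x + of_bool (y < x)"
  using emeasure_periodic_interval[OF assms] assms
  by (simp add: arc_length_def measure_def)

text \<open>Membership as a sum of steps, valid in both cases of the definition of the interval,
  turns every integrand below into a piecewise quadratic function of one endpoint.\<close>

lemma indicator_periodic_interval:
  assumes "0 \<le> p" "p < 1"
  shows "of_bool (p \<in> periodic_interval x y) =
    (of_bool (p < y) - of_bool (p < x) + of_bool (y < x) :: real)"
  using assms by (auto simp: periodic_interval_def)

lemma has_unit_integral_step:
  assumes "0 \<le> a" "a \<le> 1"
  shows "has_unit_integral (\<lambda>v. of_bool (a < v) * (c0 + c1 * v + c2 * v\<^sup>2))
    (c0 * (1 - a) + c1 * (1 - a\<^sup>2) / 2 + c2 * (1 - a ^ 3) / 3)"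
proof -
  define F where "F = (\<lambda>v. c0 * v + c1 * v\<^sup>2 / 2 + c2 * v ^ 3 / 3)"
  have "has_bochner_integral lborel (\<lambda>v. (c0 + c1 * v + c2 * v\<^sup>2) * indicator {a..1} v) (F 1 - F a)"
    using assms unfolding F_def
    by (intro has_bochner_integral_FTC_Icc_real)
       (auto intro!: derivative_eq_intros continuous_intros simp: power2_eq_square)
  also have "?this \<longleftrightarrow> has_bochner_integral lborel
      (\<lambda>v. indicator {0..1} v * (of_bool (a < v) * (c0 + c1 * v + c2 * v\<^sup>2))) (F 1 - F a)"
    using assms by (intro has_bochner_integral_discrete_difference[where X = "{a}"])
      (auto simp: indicator_def)
  finally show ?thesis
    by (simp add: has_unit_integral_def F_def algebra_simps diff_divide_distrib)
qed

text \<open>An entry (a, c0, c1, c2) switches on a quadratic to the right of a. The finite set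
  \<open>X\<close> absorbs the points where strict and weak comparisons disagree, so a concrete
  integral only needs a list, a case distinction and polynomial arithmetic.\<close>

lemma has_unit_integral_steps:
  fixes L :: "(real \<times> real \<times> real \<times> real) list"
  assumes "\<And>a c0 c1 c2. (a, c0, c1, c2) \<in> set L \<Longrightarrow> 0 \<le> a \<and> a \<le> 1" and "finite X"
    and "\<And>v. 0 \<le> v \<Longrightarrow> v \<le> 1 \<Longrightarrow> v \<notin> X \<Longrightarrow>
      f v = (\<Sum>(a, c0, c1, c2)\<leftarrow>L. of_bool (a < v) * (c0 + c1 * v + c2 * v\<^sup>2))"
    and "I = (\<Sum>(a, c0, c1, c2)\<leftarrow>L. c0 * (1 - a) + c1 * (1 - a\<^sup>2) / 2 + c2 * (1 - a ^ 3) / 3)"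
  shows "has_unit_integral f I"
proof -
  have "has_unit_integral (\<lambda>v. \<Sum>(a, c0, c1, c2)\<leftarrow>L. of_bool (a < v) * (c0 + c1 * v + c2 * v\<^sup>2)) I"
    unfolding assms(4) using assms(1)
  proof (induction L)
    case Nil
    then show ?case by (simp add: has_unit_integral_def has_bochner_integral_zero)
  next
    case (Cons x L)
    obtain a c0 c1 c2 where x: "x = (a, c0, c1, c2)" by (cases x)
    have "has_unit_integral (\<lambda>v. of_bool (a < v) * (c0 + c1 * v + c2 * v\<^sup>2))
        (c0 * (1 - a) + c1 * (1 - a\<^sup>2) / 2 + c2 * (1 - a ^ 3) / 3)"
      using Cons.prems[of a c0 c1 c2] x by (intro has_unit_integral_step) auto
    moreover have "has_unit_integral (\<lambda>v. \<Sum>(a, c0, c1, c2)\<leftarrow>L. of_bool (a < v) * (c0 + c1 * v + c2 * v\<^sup>2))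
        (\<Sum>(a, c0, c1, c2)\<leftarrow>L. c0 * (1 - a) + c1 * (1 - a\<^sup>2) / 2 + c2 * (1 - a ^ 3) / 3)"
    proof (rule Cons.IH)
      fix a c0 c1 c2 assume "(a, c0, c1, c2) \<in> set L"
      then show "0 \<le> a \<and> a \<le> 1" using Cons.prems[of a c0 c1 c2] by simp
    qed
    ultimately show ?case
      unfolding has_unit_integral_def x list.map sum_list.Cons prod.case distrib_left
      by (rule has_bochner_integral_add)
  qed
  then show ?thesis
    unfolding has_unit_integral_def
    by (subst has_bochner_integral_discrete_difference[where X = X])
       (use assms(2,3) in \<open>auto simp: indicator_def countable_finite\<close>)
qed

text \<open>For fixed u the arc length is v - u modulo 1, which is uniformly distributed on the unit
  interval. The second list entry is the jump from (v - u + 1)^2 to (v - u)^2 at v = u.\<close>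

lemma inner_integral_arc_length_square:
  assumes "0 \<le> u" "u \<le> 1"
  shows "has_unit_integral (\<lambda>v. (arc_length u v)\<^sup>2) (1 / 3)"
proof (rule has_unit_integral_steps[where X = "{0, u}" and
      L = "[(0, (1 - u)\<^sup>2, 2 * (1 - u), 1), (u, 1 - 2 * (1 - u), -2, 0)]"])
  fix v assume v: "0 \<le> v" "v \<le> 1" "v \<notin> {0, u}"
  then show "(arc_length u v)\<^sup>2 = (\<Sum>(a, c0, c1, c2)\<leftarrow>[(0, (1 - u)\<^sup>2, 2 * (1 - u), 1), (u, 1 - 2 * (1 - u), -2, 0)].
    of_bool (a < v) * (c0 + c1 * v + c2 * v\<^sup>2))"
    using assms by (cases "u < v") (auto simp: arc_length_eq power2_eq_square algebra_simps)
qed (use assms in \<open>auto simp: power2_eq_square field_simps\<close>)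

lemma inner_integral_indicator_arc_length:
  assumes "0 \<le> u" "u \<le> 1" "0 \<le> p" "p < 1"
  shows "has_unit_integral (\<lambda>v. of_bool (p \<in> periodic_interval u v) * arc_length u v)
    (1 / 2 - p\<^sup>2 / 2 + p * u - u\<^sup>2 / 2 + of_bool (p < u) * (u - p - 1 / 2))"
proof (rule has_unit_integral_steps[where X = "{0, u}" and
      L = "[(p, 1 - u, 1, 0), (max p u, -1, 0, 0),
        (0, (1 - of_bool (p < u)) * (1 - u), 1 - of_bool (p < u), 0),
        (u, of_bool (p < u) - (1 - u), -1, 0)]"])
  fix v assume v: "0 \<le> v" "v \<le> 1" "v \<notin> {0, u}"
  then show "of_bool (p \<in> periodic_interval u v) * arc_length u v =
     (\<Sum>(a, c0, c1, c2)\<leftarrow>[(p, 1 - u, 1, 0), (max p u, -1, 0, 0),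
        (0, (1 - of_bool (p < u)) * (1 - u), 1 - of_bool (p < u), 0),
        (u, of_bool (p < u) - (1 - u), -1, 0)].
    of_bool (a < v) * (c0 + c1 * v + c2 * v\<^sup>2))"
    unfolding indicator_periodic_interval[OF assms(3,4)]
    using assms by (cases "u < v"; cases "p < v"; cases "p < u")
      (auto simp: arc_length_eq power2_eq_square algebra_simps)
qed (use assms in \<open>auto simp: power2_eq_square field_simps max_def\<close>)

text \<open>By rotation invariance the mixed integral is the same for every point p, and it
  coincides with the integral of the squared arc length.\<close>

lemma outer_integral_indicator_arc_length:
  assumes "0 \<le> p" "p < 1"
  shows "has_unit_integral (\<lambda>u. 1 / 2 - p\<^sup>2 / 2 + p * u - u\<^sup>2 / 2 + of_bool (p < u) * (u - p - 1 / 2)) (1 / 3)"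
  by (rule has_unit_integral_steps[where X = "{0}" and
      L = "[(0, 1 / 2 - p\<^sup>2 / 2, p, - 1 / 2), (p, - p - 1 / 2, 1, 0)]"])
     (use assms in \<open>auto simp: power2_eq_square field_simps\<close>)

lemma inner_integral_indicators:
  assumes "0 \<le> u" "u \<le> 1" "0 \<le> p" "p < 1" "0 \<le> q" "q < 1"
  shows "has_unit_integral
    (\<lambda>v. of_bool (p \<in> periodic_interval u v) * of_bool (q \<in> periodic_interval u v))
    (1 - max p q + u + of_bool (p < u) * (q - p - 1) + of_bool (q < u) * (p - q - 1) +
      of_bool (max p q < u))"
\<comment> \<open>The list is the product of two expansions from
  \<open>indicator_periodic_interval\<close>, with the step in v < u replaced by one minus the step
  in u < v, and with products of two steps in v merged at the larger threshold.\<close>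
proof (rule has_unit_integral_steps[where X = "{0, u}" and
      L = "[(max p q, 1, 0, 0), (p, 1 - of_bool (q < u), 0, 0), (max p u, -1, 0, 0),
        (q, 1 - of_bool (p < u), 0, 0), (0, (1 - of_bool (p < u)) * (1 - of_bool (q < u)), 0, 0),
        (u, of_bool (p < u) + of_bool (q < u) - 1, 0, 0), (max q u, -1, 0, 0)]"])
  fix v assume v: "0 \<le> v" "v \<le> 1" "v \<notin> {0, u}"
  then show "of_bool (p \<in> periodic_interval u v) * of_bool (q \<in> periodic_interval u v) =
     (\<Sum>(a, c0, c1, c2)\<leftarrow>[(max p q, 1, 0, 0), (p, 1 - of_bool (q < u), 0, 0), (max p u, -1, 0, 0),
        (q, 1 - of_bool (p < u), 0, 0), (0, (1 - of_bool (p < u)) * (1 - of_bool (q < u)), 0, 0),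
        (u, of_bool (p < u) + of_bool (q < u) - 1, 0, 0), (max q u, -1, 0, 0)].
    of_bool (a < v) * (c0 + c1 * v + c2 * v\<^sup>2))"
    unfolding indicator_periodic_interval[OF assms(3,4)] indicator_periodic_interval[OF assms(5,6)]
    using assms by (cases "u < v"; cases "p < v"; cases "q < v"; cases "p < u"; cases "q < u") auto
qed (use assms in \<open>auto simp: power2_eq_square field_simps max_def\<close>)

lemma outer_integral_indicators:
  assumes "0 \<le> p" "p < 1" "0 \<le> q" "q < 1"
  shows "has_unit_integral (\<lambda>u. 1 - max p q + u + of_bool (p < u) * (q - p - 1) +
      of_bool (q < u) * (p - q - 1) + of_bool (max p q < u)) (periodic_kernel p q)"
  by (rule has_unit_integral_steps[where X = "{0}" and
      L = "[(0, 1 - max p q, 1, 0), (p, q - p - 1, 0, 0), (q, p - q - 1, 0, 0), (max p q, 1, 0, 0)]"])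
     (use assms in \<open>auto simp: periodic_kernel_def power2_eq_square field_simps max_def abs_if\<close>)

section \<open>Product integrals over the unit cube\<close>

interpretation lborel_product: product_sigma_finite "\<lambda>_ :: nat. lborel :: real measure"
  by standard

lemma indicator_unit_cube:
  assumes "x \<in> space (lebesgue_d d)"
  shows "indicator (unit_cube d) x = (\<Prod>j=1..d. indicator {0..1} (x j) :: real)"
proof -
  have "x \<in> extensional {1..d}"
    using assms by (auto simp: lebesgue_d_def space_PiM PiE_def)
  then show ?thesis
    by (auto simp: indicator_def unit_cube_def PiE_def prod_zero_iff Pi_def)
qed

lemma has_bochner_integral_unit_cube_prod:
  assumes "\<And>j. j \<in> {1..d} \<Longrightarrow> has_unit_integral (f j) (I j)"
  shows "has_bochner_integral (lebesgue_d d)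
    (\<lambda>x. indicator (unit_cube d) x *\<^sub>R (\<Prod>j=1..d. f j (x j))) (\<Prod>j=1..d. I j)"
proof -
  have int: "integrable lborel (\<lambda>v. indicator {0..1} v * f j v)"
    and eq: "(\<integral>v. indicator {0..1} v * f j v \<partial>lborel) = I j" if "j \<in> {1..d}" for j
    using assms[OF that] by (auto simp: has_unit_integral_def has_bochner_integral_iff)
  have "has_bochner_integral (lebesgue_d d)
      (\<lambda>x. \<Prod>j\<in>{1..d}. indicator {0..1} (x j) * f j (x j))
      (\<Prod>j\<in>{1..d}. \<integral>v. indicator {0..1} v * f j v \<partial>lborel)"
    unfolding has_bochner_integral_iff lebesgue_d_def
    using lborel_product.product_integrable_prod[of "{1..d}" "\<lambda>j v. indicator {0..1} v * f j v"]
      lborel_product.product_integral_prod[of "{1..d}" "\<lambda>j v. indicator {0..1} v * f j v"] int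
    by simp
  also have "(\<Prod>j\<in>{1..d}. \<integral>v. indicator {0..1} v * f j v \<partial>lborel) = (\<Prod>j=1..d. I j)"
    using eq by (intro prod.cong) auto
  also have "has_bochner_integral (lebesgue_d d)
      (\<lambda>x. \<Prod>j\<in>{1..d}. indicator {0..1} (x j) * f j (x j)) (\<Prod>j=1..d. I j) \<longleftrightarrow> ?thesis"
    by (intro has_bochner_integral_cong) (auto simp: indicator_unit_cube prod.distrib)
  finally show ?thesis .
qed

lemma measure_periodic_box:
  assumes "x \<in> unit_cube d" "y \<in> unit_cube d"
  shows "measure (lebesgue_d d) (periodic_box d x y) = (\<Prod>j=1..d. arc_length (x j) (y j))"
proof -
  have "emeasure lborel (periodic_interval (x j) (y j)) = ennreal (arc_length (x j) (y j))"
    if "j \<in> {1..d}" for j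
    using that assms by (subst emeasure_periodic_interval)
      (auto simp: unit_cube_def PiE_iff arc_length_eq)
  moreover have "periodic_interval (x j) (y j) \<in> sets lborel" for j
    by (simp add: periodic_interval_def)
  ultimately have "emeasure (lebesgue_d d) (periodic_box d x y) = (\<Prod>j=1..d. ennreal (arc_length (x j) (y j)))"
    unfolding lebesgue_d_def periodic_box_def by (subst lborel_product.emeasure_PiM) auto
  also have "\<dots> = ennreal (\<Prod>j=1..d. arc_length (x j) (y j))"
    by (intro prod_ennreal) (simp add: arc_length_def)
  finally show ?thesis
    by (simp add: measure_def prod_nonneg arc_length_def)
qed

lemma count_points_periodic_box:
  assumes "\<And>n. n < N \<Longrightarrow> X n \<in> extensional {1..d}"
  shows "real (count_points N X (periodic_box d x y)) =
    (\<Sum>n<N. \<Prod>j=1..d. of_bool (X n j \<in> periodic_interval (x j) (y j)))"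
proof -
  have "(\<Prod>j=1..d. of_bool (X n j \<in> periodic_interval (x j) (y j))) =
      (if X n \<in> periodic_box d x y then 1 else 0 :: real)" if "n < N" for n
    using assms[OF that] by (auto simp: periodic_box_def PiE_def Pi_def prod_zero_iff)
  then have "(\<Sum>n<N. \<Prod>j=1..d. of_bool (X n j \<in> periodic_interval (x j) (y j))) =
      (\<Sum>n<N. if X n \<in> periodic_box d x y then 1 else 0 :: real)"
    by (intro sum.cong) auto
  also have "\<dots> = real (count_points N X (periodic_box d x y))"
    unfolding count_points_def by (subst sum.If_cases) (auto intro!: arg_cong[of _ _ card])
  finally show ?thesis ..
qed

text \<open>A Warnock-type formula. Expanding the square gives three kinds of integrands that factor
  over the coordinates, and the inner integrals are again products. The mixed terms contribute
  -2/3^d and the squared volume 1/3^d, which together give the subtracted term.\<close>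

lemma periodic_L2_discrepancy_eq:
  assumes N: "N > 0" and ext: "\<And>n. n < N \<Longrightarrow> X n \<in> extensional {1..d}"
    and X01: "\<And>n j. n < N \<Longrightarrow> j \<in> {1..d} \<Longrightarrow> 0 \<le> X n j \<and> X n j < 1"
  shows "periodic_L2_discrepancy d N X =
    sqrt ((\<Sum>n<N. \<Sum>m<N. \<Prod>j=1..d. periodic_kernel (X n j) (X m j)) - (real N)\<^sup>2 / 3 ^ d) / real N"
proof -
  define f1 where "f1 = (\<lambda>x y :: nat \<Rightarrow> real. \<Prod>j=1..d. (arc_length (x j) (y j))\<^sup>2)"
  define f2 where "f2 = (\<lambda>n x y. \<Prod>j=1..d. of_bool (X n j \<in> periodic_interval (x j) (y j)) * arc_length (x j) (y j))"
  define f3 where "f3 = (\<lambda>n m x y. \<Prod>j=1..d.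
      of_bool (X n j \<in> periodic_interval (x j) (y j)) * of_bool (X m j \<in> periodic_interval (x j) (y j)) :: real)"
  define g2 where "g2 = (\<lambda>n x. \<Prod>j=1..d. (\<lambda>u. 1 / 2 - (X n j)\<^sup>2 / 2 + X n j * u - u\<^sup>2 / 2
      + of_bool (X n j < u) * (u - X n j - 1 / 2)) (x j))"
  define g3 where "g3 = (\<lambda>n m x. \<Prod>j=1..d. (\<lambda>u. 1 - max (X n j) (X m j) + u + of_bool (X n j < u) * (X m j - X n j - 1) +
      of_bool (X m j < u) * (X n j - X m j - 1) + of_bool (max (X n j) (X m j) < u)) (x j))"
  have integrand: "\<bar>real (count_points N X (periodic_box d x y)) / real N
        - measure (lebesgue_d d) (periodic_box d x y)\<bar>\<^sup>2 =
      1 / (real N)\<^sup>2 * (\<Sum>n<N. \<Sum>m<N. f3 n m x y) - 2 / real N * (\<Sum>n<N. f2 n x y) + f1 x y"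
    if "x \<in> unit_cube d" "y \<in> unit_cube d" for x y
  proof -
    define h where "h = (\<lambda>n. \<Prod>j=1..d. of_bool (X n j \<in> periodic_interval (x j) (y j)) :: real)"
    define a where "a = (\<Prod>j=1..d. arc_length (x j) (y j))"
    have "(\<Sum>n<N. \<Sum>m<N. f3 n m x y) = sum h {..<N} * sum h {..<N}"
      by (simp add: f3_def h_def prod.distrib sum_product)
    moreover have "(\<Sum>n<N. f2 n x y) = sum h {..<N} * a"
      by (simp add: f2_def h_def a_def prod.distrib sum_distrib_right)
    moreover have "f1 x y = a * a"
      by (simp add: f1_def a_def prod.distrib power2_eq_square)
    moreover have "real (count_points N X (periodic_box d x y)) = sum h {..<N}"
      unfolding h_def by (rule count_points_periodic_box[OF ext])
    moreover have "measure (lebesgue_d d) (periodic_box d x y) = a"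
      unfolding a_def by (rule measure_periodic_box[OF that])
    moreover have "\<bar>sum h {..<N} / real N - a\<bar>\<^sup>2 =
       1 / (real N)\<^sup>2 * (sum h {..<N} * sum h {..<N}) - 2 / real N * (sum h {..<N} * a) + a * a"
      using N by (simp add: power2_eq_square field_simps)
    ultimately show ?thesis by simp
  qed
  have inner: "(LINT y:unit_cube d|lebesgue_d d. \<bar>real (count_points N X (periodic_box d x y)) / real N
        - measure (lebesgue_d d) (periodic_box d x y)\<bar>\<^sup>2) =
      1 / (real N)\<^sup>2 * (\<Sum>n<N. \<Sum>m<N. g3 n m x) - 2 / real N * (\<Sum>n<N. g2 n x) + (\<Prod>j=1..d. 1 / 3)"
    if x: "x \<in> unit_cube d" for x
  proof -
    have x01: "0 \<le> x j" "x j \<le> 1" if "j \<in> {1..d}" for j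
      using x that by (auto simp: unit_cube_def PiE_iff)
    have "has_bochner_integral (lebesgue_d d) (\<lambda>y.
       1 / (real N)\<^sup>2 * (\<Sum>n<N. \<Sum>m<N. indicator (unit_cube d) y *\<^sub>R f3 n m x y)
       - 2 / real N * (\<Sum>n<N. indicator (unit_cube d) y *\<^sub>R f2 n x y)
       + indicator (unit_cube d) y *\<^sub>R f1 x y)
      (1 / (real N)\<^sup>2 * (\<Sum>n<N. \<Sum>m<N. g3 n m x) - 2 / real N * (\<Sum>n<N. g2 n x) + (\<Prod>j=1..d. 1 / 3))"
      unfolding f1_def f2_def f3_def g2_def g3_def
      by (intro has_bochner_integral_add has_bochner_integral_diff has_bochner_integral_mult_right
          has_bochner_integral_sum has_bochner_integral_unit_cube_prod inner_integral_indicators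
          inner_integral_indicator_arc_length inner_integral_arc_length_square)
         (use x01 X01 in auto)
    also have "(\<lambda>y. 1 / (real N)\<^sup>2 * (\<Sum>n<N. \<Sum>m<N. indicator (unit_cube d) y *\<^sub>R f3 n m x y)
       - 2 / real N * (\<Sum>n<N. indicator (unit_cube d) y *\<^sub>R f2 n x y)
       + indicator (unit_cube d) y *\<^sub>R f1 x y) = (\<lambda>y. indicator (unit_cube d) y *\<^sub>R
         \<bar>real (count_points N X (periodic_box d x y)) / real N
           - measure (lebesgue_d d) (periodic_box d x y)\<bar>\<^sup>2)"
      using integrand[OF x] by (auto simp: fun_eq_iff indicator_def)
    finally show ?thesis
      unfolding set_lebesgue_integral_def by (rule has_bochner_integral_integral_eq)
  qed
  have "has_bochner_integral (lebesgue_d d) (\<lambda>x.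
       1 / (real N)\<^sup>2 * (\<Sum>n<N. \<Sum>m<N. indicator (unit_cube d) x *\<^sub>R g3 n m x)
       - 2 / real N * (\<Sum>n<N. indicator (unit_cube d) x *\<^sub>R g2 n x)
       + indicator (unit_cube d) x *\<^sub>R (\<Prod>j=1..d. (\<lambda>_. 1 / 3) (x j)))
      (1 / (real N)\<^sup>2 * (\<Sum>n<N. \<Sum>m<N. \<Prod>j=1..d. periodic_kernel (X n j) (X m j))
       - 2 / real N * (\<Sum>n<N. \<Prod>j=1..d. 1 / 3) + (\<Prod>j=1..d. 1 / 3))"
    unfolding g2_def g3_def
    by (intro has_bochner_integral_add has_bochner_integral_diff has_bochner_integral_mult_right
        has_bochner_integral_sum has_bochner_integral_unit_cube_prod outer_integral_indicators
        outer_integral_indicator_arc_length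
        has_unit_integral_steps[where X = "{0}" and L = "[(0, 1 / 3, 0, 0)]"])
       (use X01 in auto)
  also have "(\<lambda>x. 1 / (real N)\<^sup>2 * (\<Sum>n<N. \<Sum>m<N. indicator (unit_cube d) x *\<^sub>R g3 n m x)
       - 2 / real N * (\<Sum>n<N. indicator (unit_cube d) x *\<^sub>R g2 n x)
       + indicator (unit_cube d) x *\<^sub>R (\<Prod>j=1..d. (\<lambda>_. 1 / 3) (x j))) =
     (\<lambda>x. indicator (unit_cube d) x *\<^sub>R (LINT y:unit_cube d|lebesgue_d d.
        \<bar>real (count_points N X (periodic_box d x y)) / real N
        - measure (lebesgue_d d) (periodic_box d x y)\<bar>\<^sup>2))"
    using inner by (auto simp: fun_eq_iff indicator_def)
  finally have "periodic_L2_discrepancy d N X = sqrt (1 / (real N)\<^sup>2 *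
      (\<Sum>n<N. \<Sum>m<N. \<Prod>j=1..d. periodic_kernel (X n j) (X m j))
       - 2 / real N * (\<Sum>n<N. \<Prod>j=1..d. 1 / 3) + (\<Prod>j=1..d. 1 / 3))"
    unfolding periodic_L2_discrepancy_def set_lebesgue_integral_def
    by (simp add: has_bochner_integral_integral_eq)
  also have "1 / (real N)\<^sup>2 * (\<Sum>n<N. \<Sum>m<N. \<Prod>j=1..d. periodic_kernel (X n j) (X m j))
       - 2 / real N * (\<Sum>n<N. \<Prod>j=1..d. 1 / 3) + (\<Prod>j=1..d. 1 / 3) =
     ((\<Sum>n<N. \<Sum>m<N. \<Prod>j=1..d. periodic_kernel (X n j) (X m j)) - (real N)\<^sup>2 / 3 ^ d) / (real N)\<^sup>2"
    using N by (simp add: power_one_over field_simps)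
  also have "sqrt \<dots> = sqrt ((\<Sum>n<N. \<Sum>m<N. \<Prod>j=1..d. periodic_kernel (X n j) (X m j)) - (real N)\<^sup>2 / 3 ^ d) / real N"
    by (simp add: real_sqrt_divide)
  finally show ?thesis .
qed

section \<open>Independence of the rows of the Sobol' matrices\<close>

lemma poly_to_inv_fls_0 [simp]: "poly_to_inv_fls 0 = 0"
  by (simp add: poly_to_inv_fls_def)

lemma poly_to_inv_fls_pCons:
  "poly_to_inv_fls (pCons a f) = fls_const a + fls_X_inv * poly_to_inv_fls f"
  by (simp add: poly_to_inv_fls_def map_poly_pCons)

lemma poly_to_inv_fls_nth:
  "fls_nth (poly_to_inv_fls f) n = (if n \<le> 0 then coeff f (nat (- n)) else 0)"
proof (induction f arbitrary: n)
  case 0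
  then show ?case by simp
next
  case (pCons a f)
  show ?case
    unfolding poly_to_inv_fls_pCons
    by (auto simp: fls_X_inv_times_conv_shift pCons.IH coeff_pCons nat_diff_distrib' split: nat.splits)
qed

lemma poly_to_inv_fls_1 [simp]: "poly_to_inv_fls 1 = 1"
  by (intro fls_eqI) (auto simp: poly_to_inv_fls_nth)

lemma poly_to_inv_fls_add: "poly_to_inv_fls (f + g) = poly_to_inv_fls f + poly_to_inv_fls g"
  by (intro fls_eqI) (auto simp: poly_to_inv_fls_nth)

lemma poly_to_inv_fls_smult: "poly_to_inv_fls (smult c f) = fls_const c * poly_to_inv_fls f"
  by (intro fls_eqI) (auto simp: poly_to_inv_fls_nth fls_const_mult_const)

lemma poly_to_inv_fls_mult: "poly_to_inv_fls (f * g) = poly_to_inv_fls f * poly_to_inv_fls g"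
proof (induction f)
  case (pCons a f)
  have "poly_to_inv_fls (pCons a f * g) = poly_to_inv_fls (smult a g + pCons 0 (f * g))"
    by simp
  also have "\<dots> = (fls_const a + fls_X_inv * poly_to_inv_fls f) * poly_to_inv_fls g"
    unfolding poly_to_inv_fls_add poly_to_inv_fls_smult poly_to_inv_fls_pCons pCons.IH
    by (simp add: algebra_simps)
  finally show ?case
    by (simp only: poly_to_inv_fls_pCons)
qed simp

lemma poly_to_inv_fls_power: "poly_to_inv_fls (f ^ n) = poly_to_inv_fls f ^ n"
  by (induction n) (simp_all add: poly_to_inv_fls_mult)

lemma poly_to_inv_fls_sum: "poly_to_inv_fls (sum f A) = (\<Sum>x\<in>A. poly_to_inv_fls (f x))"
  by (induction A rule: infinite_finite_induct) (simp_all add: poly_to_inv_fls_add)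

lemma poly_to_inv_fls_eq_0_iff [simp]: "poly_to_inv_fls f = 0 \<longleftrightarrow> f = 0"
proof
  assume "poly_to_inv_fls f = 0"
  then have "coeff f n = 0" for n
    using poly_to_inv_fls_nth[of f "- int n"] by simp
  then show "f = 0" by (simp add: poly_eq_iff)
qed simp

lemma poly_to_inv_fls_subdegree:
  "f \<noteq> 0 \<Longrightarrow> fls_subdegree (poly_to_inv_fls f) = - int (degree f)"
  by (rule fls_subdegree_eqI) (auto simp: poly_to_inv_fls_nth intro!: coeff_eq_0)

text \<open>As a series in 1/x this quotient starts exactly at exponent (i - 1) e + z + 1, where e
  is the degree of p. This is the row index k, so the generating matrices are upper
  triangular.\<close>

lemma sobol_coeff_eq_0:
  assumes "z < degree p" "l < (int i - 1) * int (degree p) + int z + 1"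
  shows "fls_nth (poly_to_inv_fls ([:0, 1:] ^ (degree p - z - 1)) / poly_to_inv_fls p ^ i) l = 0"
proof (rule fls_eq0_below_subdegree)
  have "p \<noteq> 0" using assms(1) by auto
  then have "fls_subdegree (poly_to_inv_fls ([:0, 1:] ^ (degree p - z - 1)) / poly_to_inv_fls p ^ i)
     = - int (degree p - z - 1) + int i * int (degree p)"
    by (simp add: fls_divide_subdegree poly_to_inv_fls_subdegree fls_subdegree_pow degree_power_eq)
  then show "l < fls_subdegree (poly_to_inv_fls ([:0, 1:] ^ (degree p - z - 1)) / poly_to_inv_fls p ^ i)"
    using assms by (simp add: algebra_simps of_nat_diff)
qed

lemma bit_sum_monomials:
  assumes "finite Z" "Z \<noteq> {}" "\<And>z. z \<in> Z \<Longrightarrow> z < e"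
  shows "(\<Sum>z\<in>Z. [:0, 1 :: bit:] ^ (e - z - 1)) \<noteq> 0 \<and>
    degree (\<Sum>z\<in>Z. [:0, 1 :: bit:] ^ (e - z - 1)) < e"
proof
  have mono: "[:0, 1 :: bit:] ^ n = monom 1 n" for n
    by (simp add: monom_altdef)
  obtain z0 where z0: "z0 \<in> Z" using assms by auto
  have "coeff (\<Sum>z\<in>Z. [:0, 1 :: bit:] ^ (e - z - 1)) (e - z0 - 1) =
      (\<Sum>z\<in>Z. of_bool (e - z - 1 = e - z0 - 1))"
    by (simp add: coeff_sum mono of_bool_def)
  also have "\<dots> = (\<Sum>z\<in>Z. if z = z0 then 1 else 0)"
  proof (intro sum.cong refl)
    fix z assume "z \<in> Z"
    then show "of_bool (e - z - 1 = e - z0 - 1) = (if z = z0 then 1 else (0::bit))"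
      using assms(3)[of z] assms(3)[OF z0] by auto
  qed
  also have "\<dots> = 1" using assms z0 by simp
  finally show "(\<Sum>z\<in>Z. [:0, 1 :: bit:] ^ (e - z - 1)) \<noteq> 0" by auto
  show "degree (\<Sum>z\<in>Z. [:0, 1 :: bit:] ^ (e - z - 1)) < e"
  proof (rule degree_sum_less)
    show "0 < e" using assms(3)[OF z0] by simp
    show "degree ([:0, 1 :: bit:] ^ (e - z - 1)) < e" if "z \<in> Z" for z
      using assms(3)[OF that] by (simp add: degree_power_eq)
  qed
qed


text \<open>The exponents \<iota> stay free because two choices are needed: one for a degree bound,
  and one that has the exact pole order at a chosen polynomial.\<close>

lemma sobol_rows_clear_denominators:
  fixes p :: "nat \<Rightarrow> bit poly" and \<iota> :: "nat \<Rightarrow> nat"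
  assumes "finite J" "finite E" "\<And>j. j \<in> J \<Longrightarrow> p j \<noteq> 0"
    and "\<And>j k. (j, k) \<in> E \<Longrightarrow> j \<in> J \<and> (k - 1) div degree (p j) + 1 \<le> \<iota> j"
  shows "(\<Sum>(j, k)\<in>E. poly_to_inv_fls ([:0, 1:] ^ (degree (p j) - (k - 1) mod degree (p j) - 1)) /
        poly_to_inv_fls (p j) ^ ((k - 1) div degree (p j) + 1)) * poly_to_inv_fls (\<Prod>j\<in>J. p j ^ \<iota> j) =
      poly_to_inv_fls (\<Sum>(j, k)\<in>E. [:0, 1:] ^ (degree (p j) - (k - 1) mod degree (p j) - 1) *
        p j ^ (\<iota> j - ((k - 1) div degree (p j) + 1)) * (\<Prod>j'\<in>J - {j}. p j' ^ \<iota> j'))"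
  unfolding poly_to_inv_fls_sum sum_distrib_right
proof (intro sum.cong refl, clarify)
  fix j k assume jk: "(j, k) \<in> E"
  define i where "i = (k - 1) div degree (p j) + 1"
  define X :: "bit poly" where "X = [:0, 1:] ^ (degree (p j) - (k - 1) mod degree (p j) - 1)"
  define Q where "Q = (\<Prod>j'\<in>J - {j}. p j' ^ \<iota> j')"
  have j: "j \<in> J" and i: "i \<le> \<iota> j" using assms(4)[OF jk] by (auto simp: i_def)
  have "(\<Prod>j\<in>J. p j ^ \<iota> j) = p j ^ \<iota> j * Q"
    unfolding Q_def using assms(1) j by (simp add: prod.remove)
  also have "p j ^ \<iota> j = p j ^ i * p j ^ (\<iota> j - i)"
    using i by (simp flip: power_add)
  finally show "poly_to_inv_fls X / poly_to_inv_fls (p j) ^ i * poly_to_inv_fls (\<Prod>j\<in>J. p j ^ \<iota> j) =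
     poly_to_inv_fls (X * p j ^ (\<iota> j - i) * Q)"
    using assms(3)[OF j] by (simp add: poly_to_inv_fls_mult poly_to_inv_fls_power)
qed

lemma prime_elem_dvd_prodE:
  assumes "prime_elem p" "p dvd prod f A"
  obtains x where "x \<in> A" "p dvd f x"
proof -
  have "\<exists>x\<in>A. p dvd f x"
    using assms(2)
  proof (induction A rule: infinite_finite_induct)
    case (insert x A)
    then show ?case using assms(1) by (auto simp: prime_elem_dvd_mult_iff)
  qed (use assms(1) in \<open>auto simp: prime_elem_def\<close>)
  then show ?thesis using that by blast
qed

text \<open>If all these sums vanished, the sum F of the underlying rational functions would vanish
  to order beyond m at infinity. The common denominator is too small for that unless F = 0, and F =
  0 contradicts the uniqueness of partial fractions. The term degree (p j) - 1 pays for rounding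
  \<delta> j up to a full power of p j.\<close>

lemma sobol_rows_independent:
  fixes p :: "nat \<Rightarrow> bit poly"
  assumes J: "finite J" and E: "finite E" "E \<noteq> {}"
    and EJ: "\<And>j k. (j, k) \<in> E \<Longrightarrow> j \<in> J \<and> 1 \<le> k \<and> k \<le> \<delta> j"
    and irr: "\<And>j. j \<in> J \<Longrightarrow> irreducible (p j)"
    and ndvd: "\<And>j j'. j \<in> J \<Longrightarrow> j' \<in> J \<Longrightarrow> j \<noteq> j' \<Longrightarrow> \<not> p j dvd p j'"
    and m: "(\<Sum>j\<in>J. \<delta> j + degree (p j) - 1) \<le> m"
  shows "\<exists>l\<in>{1..m}. (\<Sum>(j, k)\<in>E. sobol_coeff (p j) ((k - 1) div degree (p j) + 1)
    ((k - 1) mod degree (p j)) l) \<noteq> 0"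
proof (rule ccontr)
  assume contra: "\<not> ?thesis"
  define e where "e = (\<lambda>j. degree (p j))"
  define trm where "trm = (\<lambda>(j, k). poly_to_inv_fls ([:0, 1:] ^ (degree (p j) - (k - 1) mod degree (p j) - 1)) /
        poly_to_inv_fls (p j) ^ ((k - 1) div degree (p j) + 1))"
  define F where "F = sum trm E"
  have nz: "p j \<noteq> 0" if "j \<in> J" for j
    using irr[OF that] by auto
  have e: "e j > 0" if "j \<in> J" for j
  proof (rule ccontr)
    assume "\<not> e j > 0"
    then have "is_unit (p j)"
      using nz[OF that] by (simp add: e_def is_unit_iff_degree)
    then show False using irr[OF that] by (simp add: irreducible_def)
  qed
  have F0: "fls_nth F l = 0" if "l \<le> int m" for l
  proof (cases "l \<ge> 1")
    case True
    then have "nat l \<in> {1..m}" using that by auto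
    with contra have "(\<Sum>(j, k)\<in>E. sobol_coeff (p j) ((k - 1) div degree (p j) + 1)
      ((k - 1) mod degree (p j)) (nat l)) = 0" by blast
    then show ?thesis
      using True by (simp add: F_def trm_def sobol_coeff_def fls_nth_sum case_prod_unfold)
  next
    case False
    have "fls_nth (trm x) l = 0" if "x \<in> E" for x
    proof -
      obtain j k where x: "x = (j, k)" by fastforce
      have "e j > 0" using EJ e that x by blast
      then show ?thesis
        unfolding trm_def x prod.case using False
        by (intro sobol_coeff_eq_0) (auto simp: e_def intro: order_trans[of l 0])
    qed
    then show ?thesis by (simp add: F_def fls_nth_sum)
  qed
  define num where "num = (\<lambda>\<iota>. \<Sum>(j, k)\<in>E. [:0, 1:] ^ (degree (p j) - (k - 1) mod degree (p j) - 1) *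
        p j ^ (\<iota> j - ((k - 1) div degree (p j) + 1)) * (\<Prod>j'\<in>J - {j}. p j' ^ \<iota> j'))"
  have clear: "F * poly_to_inv_fls (\<Prod>j\<in>J. p j ^ \<iota> j) = poly_to_inv_fls (num \<iota>)"
    if "\<And>j k. (j, k) \<in> E \<Longrightarrow> (k - 1) div e j + 1 \<le> \<iota> j" for \<iota> :: "nat \<Rightarrow> nat"
    unfolding F_def trm_def num_def
    by (rule sobol_rows_clear_denominators) (use J E nz EJ that in \<open>auto simp: e_def\<close>)
  \<comment> \<open>The quotient \<delta> j / e j rounded up, which bounds the pole order at p
    j.\<close>
  define \<iota> where "\<iota> = (\<lambda>j. (\<delta> j + e j - 1) div e j)"
  have \<iota>: "(k - 1) div e j + 1 \<le> \<iota> j" if "(j, k) \<in> E" for j k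
  proof -
    have "e j > 0" "1 \<le> k" "k \<le> \<delta> j" using EJ[OF that] e by auto
    then have "(k - 1) div e j + 1 = (k - 1 + e j) div e j"
      by (subst div_add_self2) auto
    also have "\<dots> \<le> \<iota> j" unfolding \<iota>_def using \<open>k \<le> \<delta> j\<close> \<open>1 \<le> k\<close> by (intro div_le_mono) auto
    finally show ?thesis .
  qed
  \<comment> \<open>F has order at least m + 1 in 1/x and the denominator has degree at most m, so
    their product would be a nonzero polynomial in x with only negative exponents.\<close>
  have F_eq_0: "F = 0"
  proof (rule ccontr)
    assume "F \<noteq> 0"
    define D where "D = (\<Prod>j\<in>J. p j ^ \<iota> j)"
    have D: "D \<noteq> 0" unfolding D_def using J nz by (auto simp: prod_zero_iff)
    have "degree D = (\<Sum>j\<in>J. degree (p j ^ \<iota> j))"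
      unfolding D_def using nz by (intro degree_prod_eq_sum_degree) auto
    also have "\<dots> = (\<Sum>j\<in>J. \<iota> j * e j)"
      using nz by (simp add: e_def degree_power_eq)
    also have "\<dots> \<le> (\<Sum>j\<in>J. \<delta> j + degree (p j) - 1)"
      by (intro sum_mono) (simp add: \<iota>_def e_def div_times_less_eq_dividend)
    finally have degD: "degree D \<le> m" using m by simp
    have "fls_subdegree F \<ge> int m + 1"
      using F0 \<open>F \<noteq> 0\<close> by (intro fls_subdegree_geI) auto
    then have "fls_subdegree (F * poly_to_inv_fls D) \<ge> 1"
      using D \<open>F \<noteq> 0\<close> degD by (simp add: poly_to_inv_fls_subdegree)
    moreover have "F * poly_to_inv_fls D = poly_to_inv_fls (num \<iota>)"
      unfolding D_def by (rule clear[OF \<iota>])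
    moreover have "num \<iota> \<noteq> 0"
      using calculation D \<open>F \<noteq> 0\<close> by auto
    ultimately show False
      by (simp add: poly_to_inv_fls_subdegree)
  qed
  obtain j0 k0 where jk0: "(j0, k0) \<in> E" using E by auto
  \<comment> \<open>The exact highest power of p j0 among the denominators. After clearing with this
    exponent at j0, every term has a factor p j0 except those of pole order I; these are collected
    in \<open>E1\<close> below.\<close>
  define I where "I = Max ((\<lambda>k. (k - 1) div e j0 + 1) ` {k. (j0, k) \<in> E})"
  have fin: "finite {k. (j0, k) \<in> E}"
  proof (rule finite_subset)
    show "{k. (j0, k) \<in> E} \<subseteq> snd ` E" by force
  qed (use E in simp)
  have I_max: "(k - 1) div e j0 + 1 \<le> I" if "(j0, k) \<in> E" for k
    unfolding I_def using that fin by (intro Max_ge) auto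
  have "I \<in> (\<lambda>k. (k - 1) div e j0 + 1) ` {k. (j0, k) \<in> E}"
    unfolding I_def using fin jk0 by (intro Max_in) auto
  then obtain k1 where k1: "(j0, k1) \<in> E" "(k1 - 1) div e j0 + 1 = I" by auto
  have j0: "j0 \<in> J" using EJ jk0 by blast
  define \<kappa> where "\<kappa> = \<iota>(j0 := I)"
  have "(k - 1) div e j + 1 \<le> \<kappa> j" if "(j, k) \<in> E" for j k
    using \<iota>[OF that] I_max[of k] that by (cases "j = j0") (auto simp: \<kappa>_def)
  then have "num \<kappa> = 0"
    using clear[of \<kappa>] F_eq_0 by simp
  define E1 where "E1 = {(j, k). (j, k) \<in> E \<and> j = j0 \<and> (k - 1) div e j0 + 1 = I}"
  define Z where "Z = (\<lambda>k. (k - 1) mod e j0) ` {k. (j0, k) \<in> E1}"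
  define G :: "bit poly" where "G = (\<Sum>z\<in>Z. [:0, 1:] ^ (e j0 - z - 1))"
  define Q where "Q = (\<Prod>j'\<in>J - {j0}. p j' ^ \<iota> j')"
  define summand where "summand = (\<lambda>(j, k). [:0, 1:] ^ (degree (p j) - (k - 1) mod degree (p j) - 1) *
        p j ^ (\<kappa> j - ((k - 1) div degree (p j) + 1)) * (\<Prod>j'\<in>J - {j}. p j' ^ \<kappa> j'))"
  have E1: "E1 \<subseteq> E" by (auto simp: E1_def)
  have "num \<kappa> = sum summand E1 + sum summand (E - E1)"
    unfolding num_def summand_def[symmetric] using E E1 by (simp add: sum.subset_diff[OF E1])
  moreover have "p j0 dvd sum summand (E - E1)"
  proof (intro dvd_sum, clarify)
    fix j k assume jk: "(j, k) \<in> E" "(j, k) \<notin> E1"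
    show "p j0 dvd summand (j, k)"
    proof (cases "j = j0")
      case True
      have "(k - 1) div e j0 + 1 < I"
        using jk I_max[of k] True by (auto simp: E1_def)
      then have "p j0 dvd p j ^ (\<kappa> j - ((k - 1) div degree (p j) + 1))"
        using True by (auto simp: \<kappa>_def e_def intro!: dvd_power)
      then show ?thesis unfolding summand_def prod.case by (intro dvd_mult2 dvd_mult)
    next
      case False
      have "\<kappa> j0 > 0" using k1 by (auto simp: \<kappa>_def)
      then have "p j0 dvd p j0 ^ \<kappa> j0" by (intro dvd_power) auto
      also have "\<dots> dvd (\<Prod>j'\<in>J - {j}. p j' ^ \<kappa> j')"
        using False j0 J by (intro dvd_prodI) auto
      finally show ?thesis unfolding summand_def prod.case by (intro dvd_mult)
    qed
  qed
  moreover have "sum summand E1 = G * Q"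
  proof -
    \<comment> \<open>Two rows with the same pole order and the same remainder coincide. Without
      this, equal monomials could cancel modulo 2 and the numerator G could vanish.\<close>
    have inj: "inj_on (\<lambda>k. (k - 1) mod e j0) {k. (j0, k) \<in> E1}"
    proof (rule inj_onI)
      fix k k' assume "k \<in> {k. (j0, k) \<in> E1}" "k' \<in> {k. (j0, k) \<in> E1}"
        and eq: "(k - 1) mod e j0 = (k' - 1) mod e j0"
      then have "(j0, k) \<in> E" "(j0, k') \<in> E" "(k - 1) div e j0 = (k' - 1) div e j0"
        by (auto simp: E1_def)
      then have "k - 1 = k' - 1" "k \<ge> 1" "k' \<ge> 1"
        using eq EJ by (metis div_mult_mod_eq, auto)
      then show "k = k'" by simp
    qed
    have "sum summand E1 = (\<Sum>k\<in>{k. (j0, k) \<in> E1}. summand (j0, k))"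
      by (rule sum.reindex_bij_witness[of _ "\<lambda>k. (j0, k)" snd]) (auto simp: E1_def)
    also have "\<dots> = (\<Sum>k\<in>{k. (j0, k) \<in> E1}. [:0, 1:] ^ (e j0 - (k - 1) mod e j0 - 1) * Q)"
    proof (intro sum.cong refl)
      fix k assume "k \<in> {k. (j0, k) \<in> E1}"
      then have "(k - 1) div e j0 + 1 = I" by (auto simp: E1_def)
      moreover have "(\<Prod>j'\<in>J - {j0}. p j' ^ \<kappa> j') = Q"
        unfolding Q_def by (intro prod.cong) (auto simp: \<kappa>_def)
      ultimately show "summand (j0, k) = [:0, 1:] ^ (e j0 - (k - 1) mod e j0 - 1) * Q"
        unfolding summand_def prod.case by (simp add: \<kappa>_def e_def)
    qed
    also have "\<dots> = G * Q"
      unfolding G_def Z_def by (subst sum.reindex[OF inj]) (simp add: sum_distrib_right)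
    finally show ?thesis .
  qed
  ultimately have "p j0 dvd G * Q"
    using \<open>num \<kappa> = 0\<close> by (metis dvd_0_right dvd_add_left_iff)
  have "prime_elem (p j0)"
    using irr[OF j0] by (rule field_poly_irreducible_imp_prime)
  have "\<not> p j0 dvd Q"
  proof
    assume "p j0 dvd Q"
    obtain j' where "j' \<in> J - {j0}" "p j0 dvd p j' ^ \<iota> j'"
      by (rule prime_elem_dvd_prodE[OF \<open>prime_elem (p j0)\<close> \<open>p j0 dvd Q\<close>[unfolded Q_def]])
    then show False
      using ndvd[OF j0, of j'] \<open>prime_elem (p j0)\<close> prime_elem_dvd_power by blast
  qed
  then have "p j0 dvd G"
    using \<open>prime_elem (p j0)\<close> \<open>p j0 dvd G * Q\<close> by (simp add: prime_elem_dvd_mult_iff)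
  moreover have "finite Z" "Z \<noteq> {}" "\<And>z. z \<in> Z \<Longrightarrow> z < e j0"
  proof -
    show "finite Z" unfolding Z_def
      using finite_subset[OF _ fin, of "{k. (j0, k) \<in> E1}"] by (auto simp: E1_def)
    show "Z \<noteq> {}" unfolding Z_def E1_def using k1 by auto
    show "z < e j0" if "z \<in> Z" for z using that e[OF j0] by (auto simp: Z_def)
  qed
  then have "G \<noteq> 0" "degree G < e j0"
    using bit_sum_monomials[of Z "e j0"] unfolding G_def by blast+
  ultimately show False
    using dvd_imp_degree_le[of "p j0" G] by (simp add: e_def)
qed


section \<open>Characters of digital sequences over dyadic blocks\<close>

lemma bit_nat_imp_power_le: "bit (n :: nat) i \<Longrightarrow> 2 ^ i \<le> n"
  by (rule ccontr) (simp add: bit_iff_odd not_le)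

text \<open>The summation range of the definition depends on n. Summing over the set of nonzero bits
  makes the effect of flipping one bit visible.\<close>

lemma digital_digit_eq_sum_bits:
  "digital_digit C n k = sum (C k) {l. 1 \<le> l \<and> bit n (l - 1)}"
proof -
  have "{l. 1 \<le> l \<and> bit n (l - 1)} \<subseteq> {1..n}"
  proof clarsimp
    fix l assume l: "Suc 0 \<le> l" "bit n (l - Suc 0)"
    then have "2 ^ (l - 1) \<le> n" by (simp add: bit_nat_imp_power_le)
    moreover have "l - 1 < 2 ^ (l - 1)" by simp
    ultimately show "l \<le> n" by linarith
  qed
  then have "sum (C k) {l. 1 \<le> l \<and> bit n (l - 1)} =
      (\<Sum>l=1..n. if l \<in> {l. 1 \<le> l \<and> bit n (l - 1)} then C k l else 0)"
    by (subst sum.inter_restrict[symmetric]) (auto simp: Int_absorb1)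
  also have "\<dots> = digital_digit C n k"
    unfolding digital_digit_def by (intro sum.cong) auto
  finally show ?thesis ..
qed

lemma finite_binary_positions: "finite {l. 1 \<le> l \<and> bit (n :: nat) (l - 1)}"
proof -
  have "{l. 1 \<le> l \<and> bit n (l - 1)} \<subseteq> {..n + 1}"
  proof clarsimp
    fix l assume "Suc 0 \<le> l" "bit n (l - Suc 0)"
    then have "2 ^ (l - 1) \<le> n" by (simp add: bit_nat_imp_power_le)
    moreover have "l - 1 < 2 ^ (l - 1)" by simp
    ultimately show "l \<le> Suc n" by linarith
  qed
  then show ?thesis by (rule finite_subset) simp
qed

lemma digital_digit_flip_bit:
  "digital_digit C (flip_bit r n) k = digital_digit C n k + C k (Suc r)"
proof -
  define A where "A = {l. 1 \<le> l \<and> bit n (l - 1)}"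
  have fin: "finite A" unfolding A_def by (rule finite_binary_positions)
  have flip: "{l. 1 \<le> l \<and> bit (flip_bit r n) (l - 1)} =
      (if Suc r \<in> A then A - {Suc r} else insert (Suc r) A)"
    by (auto simp: A_def bit_flip_bit_iff)
  show ?thesis
  proof (cases "Suc r \<in> A")
    case True
    have "digital_digit C n k = C k (Suc r) + sum (C k) (A - {Suc r})"
      unfolding digital_digit_eq_sum_bits A_def[symmetric] using True fin by (rule sum.remove[rotated])
    then show ?thesis
      unfolding digital_digit_eq_sum_bits flip using True
      by (cases "C k (Suc r)"; cases "sum (C k) (A - {Suc r})") auto
  next
    case False
    then show ?thesis
      unfolding digital_digit_eq_sum_bits flip A_def[symmetric] using fin
      by (simp add: add.commute del: add_bit_eq_xor)
  qed
qed

definition bit_sign :: "bit \<Rightarrow> real" where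
  "bit_sign x = (if x = 1 then -1 else 1)"

lemma bit_sign_add: "bit_sign (x + y) = bit_sign x * bit_sign y"
  by (cases x; cases y) (auto simp: bit_sign_def)

lemma prod_bit_sign: "(\<Prod>x\<in>A. bit_sign (f x)) = bit_sign (sum f A)"
proof (induction A rule: infinite_finite_induct)
  case (insert x A)
  then show ?case by (simp add: bit_sign_add del: add_bit_eq_xor)
qed (simp_all add: bit_sign_def)

lemma flip_bit_div_power:
  "r < m \<Longrightarrow> flip_bit r n div 2 ^ m = n div (2 ^ m :: nat)"
  unfolding drop_bit_eq_div[symmetric]
  by (rule bit_eqI) (auto simp: bit_drop_bit_eq bit_flip_bit_iff)

lemma flip_bit_involution: "flip_bit r (flip_bit r n) = (n :: nat)"
  by (rule bit_eqI) (auto simp: bit_flip_bit_iff)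

lemma mem_dyadic_block_iff: "n \<in> {b * 2 ^ m..<Suc b * 2 ^ m} \<longleftrightarrow> n div 2 ^ m = (b :: nat)"
proof -
  have "n div 2 ^ m = b \<longleftrightarrow> n div 2 ^ m < Suc b \<and> \<not> n div 2 ^ m < b" by auto
  then show ?thesis
    by (simp only: div_less_iff_less_mult zero_less_power zero_less_numeral atLeastLessThan_iff not_less) auto
qed

text \<open>Flipping bit l - 1 is an involution of the block that negates the character, because the
  selected entries of column l have odd sum. It leaves the bits from m on alone, so the argument
  works for every aligned block and not only for the first one.\<close>

lemma digital_character_sum_eq_0:
  assumes "l \<in> {1..m}" "(\<Sum>(j, k)\<in>E. C j k l) \<noteq> 0"
  shows "(\<Sum>n\<in>{b * 2 ^ m..<Suc b * 2 ^ m}. \<Prod>(j, k)\<in>E. bit_sign (digital_digit (C j) n k)) = 0"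
proof -
  define g where "g = (\<lambda>n. \<Prod>(j, k)\<in>E. bit_sign (digital_digit (C j) n k))"
  define B :: "nat set" where "B = {b * 2 ^ m..<Suc b * 2 ^ m}"
  have l: "Suc (l - 1) = l" "l - 1 < m" using assms(1) by auto
  have "g (flip_bit (l - 1) n) = - g n" for n
  proof -
    have "g (flip_bit (l - 1) n) =
        bit_sign (\<Sum>(j, k)\<in>E. digital_digit (C j) n k + C j k l)"
      unfolding g_def case_prod_unfold prod_bit_sign digital_digit_flip_bit l ..
    also have "\<dots> = g n * bit_sign (\<Sum>(j, k)\<in>E. C j k l)"
      unfolding g_def case_prod_unfold prod_bit_sign sum.distrib bit_sign_add ..
    also have "bit_sign (\<Sum>(j, k)\<in>E. C j k l) = -1"
      using assms(2) by (simp add: bit_sign_def)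
    finally show ?thesis by simp
  qed
  then have "sum g B = (\<Sum>n\<in>B. - g (flip_bit (l - 1) n))" by simp
  also have "\<dots> = (\<Sum>n\<in>B. - g n)"
    by (rule sum.reindex_bij_witness[of _ "flip_bit (l - 1)" "flip_bit (l - 1)"])
       (use l in \<open>auto simp only: B_def mem_dyadic_block_iff flip_bit_div_power flip_bit_involution\<close>)
  finally show ?thesis
    unfolding g_def B_def by (simp add: sum_negf)
qed

section \<open>Digits of the interlaced sequence\<close>

lemma bit_poly_is_unit_iff: "is_unit (u :: bit poly) \<longleftrightarrow> u = 1"
proof
  assume "is_unit u"
  then obtain c where "u = [:c:]" "c \<noteq> 0"
    by (auto simp: is_unit_poly_iff)
  then show "u = 1" by (simp add: one_pCons)
qed simp

lemma bit_poly_irreducible_dvd_imp_eq: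
  assumes "irreducible (p :: bit poly)" "irreducible p'" "p dvd p'"
  shows "p = p'"
proof -
  obtain u where u: "p' = p * u" using assms(3) by (elim dvdE)
  then have "is_unit p \<or> is_unit u" using assms(2) by (auto simp: irreducible_def)
  moreover have "\<not> is_unit p" using assms(1) by (auto simp: irreducible_def)
  ultimately show ?thesis using u by (simp add: bit_poly_is_unit_iff)
qed

lemma irreducible_sobol_poly:
  assumes "sorted_primitive_list q" "j \<ge> 1"
  shows "irreducible (sobol_poly q j)"
proof (cases "j = 1")
  case True
  then show ?thesis by (simp add: sobol_poly_def irreducible_linear_field_poly)
next
  case False
  then have "q (j - 1) \<in> {p. primitive_poly p}"
    using assms by (intro bij_betwE[THEN bspec, of q "{1..}"]) (auto simp: sorted_primitive_list_def)
  then show ?thesis using False by (simp add: sobol_poly_def primitive_poly_def)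
qed

lemma degree_sobol_poly_pos:
  assumes "sorted_primitive_list q" "j \<ge> 1"
  shows "degree (sobol_poly q j) > 0"
proof (rule ccontr)
  assume "\<not> degree (sobol_poly q j) > 0"
  moreover have "irreducible (sobol_poly q j)"
    using assms by (rule irreducible_sobol_poly)
  ultimately show False
    by (auto simp: irreducible_def is_unit_iff_degree)
qed

text \<open>The only unit over the field with two elements is 1, so divisibility between irreducible
  polynomials is equality. The polynomial x does not recur in the list because primitive polynomials
  do not divide x.\<close>

lemma sobol_poly_not_dvd:
  assumes "sorted_primitive_list q" "j \<ge> 1" "j' \<ge> 1" "j \<noteq> j'"
  shows "\<not> sobol_poly q j dvd sobol_poly q j'"
proof
  assume "sobol_poly q j dvd sobol_poly q j'"
  then have eq: "sobol_poly q j = sobol_poly q j'"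
    using assms by (intro bit_poly_irreducible_dvd_imp_eq irreducible_sobol_poly)
  have bij: "bij_betw q {1..} {p. primitive_poly p}"
    using assms(1) by (simp add: sorted_primitive_list_def)
  have x: "q k \<noteq> [:0, 1:]" if "k \<ge> 1" for k
  proof
    assume "q k = [:0, 1:]"
    moreover have "primitive_poly (q k)" using bij that by (auto dest: bij_betwE)
    ultimately show False by (simp add: primitive_poly_def)
  qed
  show False
  proof (cases "j = 1 \<or> j' = 1")
    case True
    then consider "j = 1" "1 \<le> j' - 1" "j' \<noteq> 1" | "j' = 1" "1 \<le> j - 1" "j \<noteq> 1"
      using assms by linarith
    then show False
      using eq by cases (use x[of "j - 1"] x[of "j' - 1"] in \<open>auto simp: sobol_poly_def\<close>)
  next
    case False
    then have "q (j - 1) = q (j' - 1)" using eq by (simp add: sobol_poly_def)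
    then have "j - 1 = j' - 1"
      using bij False assms by (auto simp: bij_betw_def dest!: inj_onD)
    then show False using assms by simp
  qed
qed

text \<open>The first i entries of q' occupy i places in q, so one of them stands at place i or
  later and has degree at least that of q i. By symmetry the degree sequence does not depend on how
  ties are ordered, which makes the final constant uniform in q.\<close>

lemma sorted_primitive_list_degree_le:
  assumes "sorted_primitive_list q" "sorted_primitive_list q'" "i \<ge> 1"
  shows "degree (q i) \<le> degree (q' i)"
proof -
  have bij: "bij_betw q {1..} {p. primitive_poly p}" and bij': "bij_betw q' {1..} {p. primitive_poly p}"
    and mono: "mono_on {1..} (\<lambda>i. degree (q i))" and mono': "mono_on {1..} (\<lambda>i. degree (q' i))"
    using assms by (auto simp: sorted_primitive_list_def)
  define A where "A = inv_into {1..} q ` q' ` {1..i}"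
  have sub: "q' ` {1..i} \<subseteq> q ` {1..}"
    using bij bij' by (auto simp: bij_betw_def)
  have "card A = card (q' ` {1..i})"
    unfolding A_def using sub by (intro card_image inj_on_inv_into)
  also have "\<dots> = i"
    using bij' by (subst card_image) (auto simp: bij_betw_def intro: inj_on_subset)
  finally have card: "card A = i" .
  have A: "A \<subseteq> {1..}"
    unfolding A_def using sub inv_into_into[of _ q "{1..}"] by blast
  have "\<not> A \<subseteq> {1..<i}"
  proof
    assume "A \<subseteq> {1..<i}"
    then have "card A \<le> card {1..<i}" by (intro card_mono) auto
    then show False using card assms(3) by simp
  qed
  then obtain k where k: "k \<in> A" "i \<le> k" using A by force
  then obtain i' where i': "i' \<in> {1..i}" "k = inv_into {1..} q (q' i')" by (auto simp: A_def)
  then have "q k = q' i'" using sub by (metis f_inv_into_f image_eqI subsetD)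
  then have "degree (q i) \<le> degree (q' i')"
    using mono_onD[OF mono, of i k] assms(3) k by auto
  also have "\<dots> \<le> degree (q' i)"
    using mono_onD[OF mono', of i' i] i' by auto
  finally show ?thesis .
qed

lemma degree_sobol_poly_cong:
  assumes "sorted_primitive_list q" "sorted_primitive_list q'" "j \<ge> 1"
  shows "degree (sobol_poly q j) = degree (sobol_poly q' j)"
proof (cases "j = 1")
  case False
  then have "1 \<le> j - 1" using assms(3) by simp
  then show ?thesis
    using sorted_primitive_list_degree_le[OF assms(1,2)] sorted_primitive_list_degree_le[OF assms(2,1)]
    by (auto simp: sobol_poly_def intro: antisym)
qed (simp add: sobol_poly_def)

text \<open>Upper triangularity: row k sees only bits of n from position k - 1 on. Hence every
  coordinate is a dyadic rational with at most M digits.\<close>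

lemma sobol_digit_eq_0:
  assumes "degree (sobol_poly q j) > 0" "n < 2 ^ M" "k > M"
  shows "digital_digit (sobol_matrix q j) n k = 0"
  unfolding digital_digit_eq_sum_bits
proof (intro sum.neutral ballI)
  define e where "e = degree (sobol_poly q j)"
  fix l assume "l \<in> {l. 1 \<le> l \<and> bit n (l - 1)}"
  then have "1 \<le> l" "2 ^ (l - 1) \<le> n" by (auto intro: bit_nat_imp_power_le)
  then have "2 ^ (l - 1) < (2 :: nat) ^ M" using assms(2) by linarith
  then have "l - 1 < M" by simp
  then have "l < k" using assms(3) \<open>1 \<le> l\<close> by simp
  moreover have "int ((k - 1) div e) * int e + int ((k - 1) mod e) = int (k - 1)"
    by (metis div_mult_mod_eq of_nat_add of_nat_mult)
  ultimately have "int l < (int ((k - 1) div e + 1) - 1) * int e + int ((k - 1) mod e) + 1"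
    by simp
  then show "sobol_matrix q j k l = 0"
    using assms(1) unfolding sobol_matrix_def Let_def sobol_coeff_def e_def
    by (intro sobol_coeff_eq_0) auto
qed

section \<open>Finite binary expansions and interlacing\<close>

lemma dyadic_val_extend:
  assumes "R \<le> R'" "\<And>p. p \<ge> R \<Longrightarrow> \<not> f p"
  shows "dyadic_val R' f = dyadic_val R f"
  unfolding dyadic_val_def using assms by (intro sum.mono_neutral_right) auto

lemma binary_digit_dyadic_val:
  assumes "\<And>a. a \<ge> M \<Longrightarrow> \<not> f a"
  shows "binary_digit (dyadic_val M f) (Suc a) = of_bool (f a)"
  using assms
proof (induction a arbitrary: f M)
  case 0
  have "dyadic_val M f = dyadic_val (Suc M) f"
    using 0 by (intro dyadic_val_extend[symmetric]) auto
  then have "2 * dyadic_val M f = of_bool (f 0) + dyadic_val M (\<lambda>p. f (Suc p))"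
    by (simp add: dyadic_val_Suc)
  moreover have "\<lfloor>dyadic_val M (\<lambda>p. f (Suc p))\<rfloor> = 0"
    by (simp add: floor_eq_iff dyadic_val_nonneg dyadic_val_less_1)
  ultimately show ?case by (cases "f 0") (simp_all add: binary_digit_def)
next
  case (Suc a)
  have "dyadic_val M f = dyadic_val (Suc M) f"
    using Suc.prems by (intro dyadic_val_extend[symmetric]) auto
  then have half: "dyadic_val M f = (of_bool (f 0) + dyadic_val M (\<lambda>p. f (Suc p))) / 2"
    by (simp add: dyadic_val_Suc)
  have "2 ^ Suc (Suc a) * dyadic_val M f =
      of_int (2 * (2 ^ a * of_bool (f 0))) + 2 ^ Suc a * dyadic_val M (\<lambda>p. f (Suc p))"
    unfolding half by (simp add: algebra_simps)
  then have "\<lfloor>2 ^ Suc (Suc a) * dyadic_val M f\<rfloor> =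
      2 * (2 ^ a * of_bool (f 0)) + \<lfloor>2 ^ Suc a * dyadic_val M (\<lambda>p. f (Suc p))\<rfloor>"
    by (simp only: floor_add_int[symmetric] add.commute[of "of_int _"])
  then have "binary_digit (dyadic_val M f) (Suc (Suc a)) =
      binary_digit (dyadic_val M (\<lambda>p. f (Suc p))) (Suc a)"
    unfolding binary_digit_def by (simp only: mod_mult_self4)
  also have "\<dots> = of_bool (f (Suc a))"
    using Suc.prems by (intro Suc.IH) auto
  finally show ?case .
qed

text \<open>Positions count from zero: the weight 2^-(r + (a - 1) \<alpha>) belongs to the position
  p with p mod \<alpha> = r - 1 and p div \<alpha> = a - 1.\<close>

definition interlaced_digit :: "nat \<Rightarrow> (nat \<Rightarrow> bit poly) \<Rightarrow> nat \<Rightarrow> nat \<Rightarrow> nat \<Rightarrow> bool" where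
  "interlaced_digit \<alpha> q n i p \<longleftrightarrow>
     digital_digit (sobol_matrix q ((i - 1) * \<alpha> + p mod \<alpha> + 1)) n (p div \<alpha> + 1) = 1"

lemma sobol_sequence_eq_dyadic_val:
  assumes "sorted_primitive_list q" "j \<in> {1..s}" "n < 2 ^ M"
  shows "sobol_sequence s q n j = dyadic_val M (\<lambda>k. digital_digit (sobol_matrix q j) n (Suc k) = 1)"
proof -
  have "digital_digit (sobol_matrix q j) n (Suc k) = 0" if "k \<ge> M" for k
    using assms that by (intro sobol_digit_eq_0[of _ _ _ M] degree_sobol_poly_pos) auto
  then have "(\<Sum>k. of_bool (digital_digit (sobol_matrix q j) n (Suc k) = 1) / 2 ^ Suc k) =
      (\<Sum>k<M. of_bool (digital_digit (sobol_matrix q j) n (Suc k) = 1) / 2 ^ Suc k :: real)"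
    by (intro suminf_finite) auto
  then show ?thesis
    using assms(2) by (simp add: sobol_sequence_def digital_sequence_def dyadic_val_def)
qed

lemma interlace_eq_dyadic_val:
  assumes "\<And>r a. r \<in> {1..\<alpha>} \<Longrightarrow> binary_digit (x r) (Suc a) = of_bool (f r a)"
    and "\<And>r a. r \<in> {1..\<alpha>} \<Longrightarrow> a \<ge> M \<Longrightarrow> \<not> f r a" and "\<alpha> > 0"
  shows "interlace \<alpha> x = dyadic_val (M * \<alpha>) (\<lambda>p. f (p mod \<alpha> + 1) (p div \<alpha>))"
proof -
  have "interlace \<alpha> x = (\<Sum>a. \<Sum>r=1..\<alpha>. of_bool (f r a) / 2 ^ (r + a * \<alpha>))"
    unfolding interlace_def using assms(1) by simp
  also have "\<dots> = (\<Sum>a<M. \<Sum>r=1..\<alpha>. of_bool (f r a) / 2 ^ (r + a * \<alpha>))"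
    using assms(2) by (intro suminf_finite sum.neutral ballI) auto
  also have "\<dots> = (\<Sum>a<M. \<Sum>p\<in>{a * \<alpha>..<a * \<alpha> + \<alpha>}. of_bool (f (p mod \<alpha> + 1) (p div \<alpha>)) / 2 ^ Suc p)"
  proof (rule sum.cong[OF refl])
    fix a
    show "(\<Sum>r=1..\<alpha>. of_bool (f r a) / 2 ^ (r + a * \<alpha>)) =
      (\<Sum>p\<in>{a * \<alpha>..<a * \<alpha> + \<alpha>}. of_bool (f (p mod \<alpha> + 1) (p div \<alpha>)) / 2 ^ Suc p :: real)"
    proof (rule sum.reindex_bij_witness[of _ "\<lambda>p. p - a * \<alpha> + 1" "\<lambda>r. a * \<alpha> + (r - 1)"])
      fix r assume r: "r \<in> {1..\<alpha>}"
      then obtain r' where "r = Suc r'" "r' < \<alpha>" by (cases r) auto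
      then have "(a * \<alpha> + (r - 1)) mod \<alpha> + 1 = r" "(a * \<alpha> + (r - 1)) div \<alpha> = a"
        "Suc (a * \<alpha> + (r - 1)) = r + a * \<alpha>"
        by auto
      then show "of_bool (f ((a * \<alpha> + (r - 1)) mod \<alpha> + 1) ((a * \<alpha> + (r - 1)) div \<alpha>)) / 2 ^ Suc (a * \<alpha> + (r - 1)) =
         (of_bool (f r a) / 2 ^ (r + a * \<alpha>) :: real)"
        by simp
    qed auto
  qed
  also have "\<dots> = dyadic_val (M * \<alpha>) (\<lambda>p. f (p mod \<alpha> + 1) (p div \<alpha>))"
    unfolding dyadic_val_def by (rule sum.nat_group)
  finally show ?thesis .
qed

lemma interlaced_digit_eq_False:
  assumes "sorted_primitive_list q" "\<alpha> > 0" "n < 2 ^ M" "p \<ge> M * \<alpha>"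
  shows "\<not> interlaced_digit \<alpha> q n i p"
proof -
  have "M \<le> p div \<alpha>" using assms(2,4) by (simp add: less_eq_div_iff_mult_less_eq)
  then show ?thesis
    unfolding interlaced_digit_def
    using assms by (subst sobol_digit_eq_0[of _ _ _ M]) (auto intro!: degree_sobol_poly_pos)
qed

lemma interlaced_sobol_sequence_eq_dyadic_val:
  assumes "sorted_primitive_list q" "\<alpha> > 0" "n < 2 ^ M" "i \<in> {1..d}" "R \<ge> M * \<alpha>"
  shows "interlaced_sobol_sequence \<alpha> d q n i = dyadic_val R (interlaced_digit \<alpha> q n i)"
proof -
  define f where "f = (\<lambda>r k. digital_digit (sobol_matrix q ((i - 1) * \<alpha> + r)) n (Suc k) = 1)"
  have f0: "\<not> f r a" if "r \<in> {1..\<alpha>}" "a \<ge> M" for r a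
    unfolding f_def using assms that
    by (subst sobol_digit_eq_0[of _ _ _ M]) (auto intro!: degree_sobol_poly_pos)
  have "(i - 1) * \<alpha> + \<alpha> \<le> \<alpha> * d"
    using assms(4) 
    using mult_le_mono1[of i d \<alpha>] by (cases i) (auto simp: mult.commute add.commute)
  then have "binary_digit (sobol_sequence (\<alpha> * d) q n ((i - 1) * \<alpha> + r)) (Suc a) = of_bool (f r a)"
    if r: "r \<in> {1..\<alpha>}" for r a
  proof -
    have "sobol_sequence (\<alpha> * d) q n ((i - 1) * \<alpha> + r) = dyadic_val M (f r)"
      unfolding f_def using r assms \<open>(i - 1) * \<alpha> + \<alpha> \<le> \<alpha> * d\<close>
      by (intro sobol_sequence_eq_dyadic_val) auto
    then show ?thesis
      using f0[OF r] by (simp add: binary_digit_dyadic_val)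
  qed
  then have "interlace \<alpha> (\<lambda>r. sobol_sequence (\<alpha> * d) q n ((i - 1) * \<alpha> + r)) =
      dyadic_val (M * \<alpha>) (\<lambda>p. f (p mod \<alpha> + 1) (p div \<alpha>))"
    using f0 assms(2) by (intro interlace_eq_dyadic_val) auto
  also have "(\<lambda>p. f (p mod \<alpha> + 1) (p div \<alpha>)) = interlaced_digit \<alpha> q n i"
    by (simp add: fun_eq_iff f_def interlaced_digit_def)
  also have "dyadic_val (M * \<alpha>) \<dots> = dyadic_val R \<dots>"
    using assms interlaced_digit_eq_False by (intro dyadic_val_extend[symmetric]) auto
  finally show ?thesis
    using assms(4) by (simp add: interlaced_sobol_sequence_def interlace_d_def)
qed

text \<open>The prefix of length l i is shared evenly by \<alpha> components and costs about l i
  rows in total, whereas a single distant position costs only about \<beta> i / \<alpha> rows. This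
  is the gain from interlacing, used with 1/\<alpha> \<le> 1/5. The condition is multiplied by 5 to
  stay within natural numbers; its constant covers the roundings to full powers and full
  rows.\<close>

lemma interlaced_character_sum_eq_0:
  fixes l \<beta> :: "nat \<Rightarrow> nat"
  assumes q: "sorted_primitive_list q" and \<alpha>: "\<alpha> \<ge> 5"
    and E: "finite E" "E \<noteq> {}" and v: "v \<subseteq> {1..d}"
    and El: "\<And>i p. (i, p) \<in> E \<Longrightarrow> i \<in> v \<and> (p \<le> l i \<or> p = l i + \<beta> i)"
    and m: "5 * (\<Sum>i\<in>v. l i) + (\<Sum>i\<in>v. \<beta> i) +
      5 * ((\<Sum>j=1..\<alpha> * d. degree (sobol_poly q j)) + d * (\<alpha> + 1)) \<le> 5 * m"
  shows "(\<Sum>n\<in>{b * 2 ^ m..<Suc b * 2 ^ m}. \<Prod>(i, p)\<in>E. digit_sign (interlaced_digit \<alpha> q n i) p) = 0"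
proof -
  define \<phi> where "\<phi> = (\<lambda>(i, p). ((i - 1) * \<alpha> + p mod \<alpha> + 1, p div \<alpha> + 1))"
  (* A row of a component is reached either through a position up to l i, hence by row l i div \<alpha> + 1,
     or through the single position l i + \<beta> i, which lies in only one of the \<alpha> components. *)
  define \<delta> where "\<delta> = (\<lambda>j. let i = (j - 1) div \<alpha> + 1 in if i \<in> v then
     l i div \<alpha> + 1 + (if (j - 1) mod \<alpha> = (l i + \<beta> i) mod \<alpha> then \<beta> i div \<alpha> + 1 else 0) else 0)"
  have inj: "inj_on \<phi> E"
  proof (rule inj_onI, clarify)
    fix i p i' p' assume E': "(i, p) \<in> E" "(i', p') \<in> E" and eq: "\<phi> (i, p) = \<phi> (i', p')"
    have mods: "(i - 1) * \<alpha> + p mod \<alpha> = (i' - 1) * \<alpha> + p' mod \<alpha>" and div: "p div \<alpha> = p' div \<alpha>"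
      using eq by (auto simp: \<phi>_def)
    have "p mod \<alpha> = ((i - 1) * \<alpha> + p mod \<alpha>) mod \<alpha>" by simp
    also have "\<dots> = p' mod \<alpha>" unfolding mods by simp
    finally have mod: "p mod \<alpha> = p' mod \<alpha>" .
    then have "p = p'" using div by (metis div_mult_mod_eq)
    have "(i - 1) * \<alpha> = (i' - 1) * \<alpha>" using mods mod by simp
    then have "i - 1 = i' - 1" using \<alpha> by simp
    moreover have "i \<ge> 1" "i' \<ge> 1" using El v E' by (meson atLeastAtMost_iff subsetD)+
    ultimately show "i = i' \<and> p = p'" using \<open>p = p'\<close> by simp
  qed
  have "\<exists>k\<in>{1..m}. (\<Sum>(j, k')\<in>\<phi> ` E. sobol_coeff (sobol_poly q j) ((k' - 1) div degree (sobol_poly q j) + 1)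
    ((k' - 1) mod degree (sobol_poly q j)) k) \<noteq> 0"
  proof (rule sobol_rows_independent[where J = "{1..\<alpha> * d}" and \<delta> = \<delta>])
    show "finite (\<phi> ` E)" "\<phi> ` E \<noteq> {}" using E by auto
    show "j \<in> {1..\<alpha> * d} \<and> 1 \<le> k \<and> k \<le> \<delta> j" if "(j, k) \<in> \<phi> ` E" for j k
    proof -
      obtain i p where ip: "(i, p) \<in> E" "j = (i - 1) * \<alpha> + p mod \<alpha> + 1" "k = p div \<alpha> + 1"
        using \<open>(j, k) \<in> \<phi> ` E\<close> by (auto simp: \<phi>_def)
      have i: "i \<in> v" "1 \<le> i" "i \<le> d" and p: "p \<le> l i \<or> p = l i + \<beta> i" using El[OF ip(1)] v by auto
      have pm: "p mod \<alpha> < \<alpha>" using \<alpha> by simp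
      have "j \<le> (i - 1) * \<alpha> + \<alpha>" using ip(2) pm by simp
      also have "\<dots> = i * \<alpha>" using i by (cases i) auto
      also have "\<dots> \<le> \<alpha> * d" using i by (simp add: mult.commute)
      finally have "j \<in> {1..\<alpha> * d}" using ip(2) by simp
      moreover have "(j - 1) div \<alpha> = i - 1" "(j - 1) mod \<alpha> = p mod \<alpha>"
        using ip(2) pm by auto
      moreover have "p div \<alpha> \<le> l i div \<alpha> + (if p mod \<alpha> = (l i + \<beta> i) mod \<alpha> then \<beta> i div \<alpha> + 1 else 0)"
      proof (cases "p \<le> l i")
        case True
        then have "p div \<alpha> \<le> l i div \<alpha>" by (rule div_le_mono)
        then show ?thesis by simp
      next
        case False
        then have "p = l i + \<beta> i" using p by simp
        moreover have "(l i + \<beta> i) div \<alpha> \<le> l i div \<alpha> + \<beta> i div \<alpha> + 1"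
        proof -
          have "l i mod \<alpha> < \<alpha>" "\<beta> i mod \<alpha> < \<alpha>" using \<alpha> by simp_all
          then have "l i mod \<alpha> + \<beta> i mod \<alpha> < 2 * \<alpha>" by linarith
          then have "(l i mod \<alpha> + \<beta> i mod \<alpha>) div \<alpha> < 2"
            by (rule less_mult_imp_div_less)
          then show ?thesis unfolding div_add1_eq[of "l i" "\<beta> i"] by linarith
        qed
        ultimately show ?thesis by simp
      qed
      ultimately show ?thesis using ip(3) i by (auto simp: \<delta>_def Let_def split: if_splits)
    qed
    show "irreducible (sobol_poly q j)" if "j \<in> {1..\<alpha> * d}" for j
      using q that by (intro irreducible_sobol_poly) auto
    show "\<not> sobol_poly q j dvd sobol_poly q j'" if "j \<in> {1..\<alpha> * d}" "j' \<in> {1..\<alpha> * d}" "j \<noteq> j'" for j j'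
      using q that by (intro sobol_poly_not_dvd) auto
    have "(\<Sum>j\<in>{1..\<alpha> * d}. \<delta> j) = (\<Sum>j<d * \<alpha>. \<delta> (Suc j))"
      by (rule sum.reindex_bij_witness[of _ Suc "\<lambda>j. j - 1"]) (auto simp: mult.commute)
    also have "\<dots> = (\<Sum>i<d. \<Sum>j\<in>{i * \<alpha>..<i * \<alpha> + \<alpha>}. \<delta> (Suc j))"
      by (rule sum.nat_group[symmetric])
    also have "\<dots> = (\<Sum>i<d. \<Sum>r<\<alpha>. \<delta> (Suc (i * \<alpha> + r)))"
    proof (rule sum.cong[OF refl])
      fix i
      show "(\<Sum>j\<in>{i * \<alpha>..<i * \<alpha> + \<alpha>}. \<delta> (Suc j)) = (\<Sum>r<\<alpha>. \<delta> (Suc (i * \<alpha> + r)))"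
        by (rule sum.reindex_bij_witness[of _ "\<lambda>r. i * \<alpha> + r" "\<lambda>j. j - i * \<alpha>"]) auto
    qed
    also have "\<dots> \<le> (\<Sum>i<d. if Suc i \<in> v then l (Suc i) + \<beta> (Suc i) div 5 + (\<alpha> + 1) else 0)"
    proof (intro sum_mono)
      fix i
      define l' \<beta>' where "l' = l (Suc i)" and "\<beta>' = \<beta> (Suc i)"
      show "(\<Sum>r<\<alpha>. \<delta> (Suc (i * \<alpha> + r))) \<le> (if Suc i \<in> v then l (Suc i) + \<beta> (Suc i) div 5 + (\<alpha> + 1) else 0)"
      proof (cases "Suc i \<in> v")
        case True
        then have "(\<Sum>r<\<alpha>. \<delta> (Suc (i * \<alpha> + r))) =
          (\<Sum>r<\<alpha>. l' div \<alpha> + 1 + (if r = (l' + \<beta>') mod \<alpha> then \<beta>' div \<alpha> + 1 else 0))"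
          by (intro sum.cong refl) (simp add: \<delta>_def Let_def l'_def \<beta>'_def)
        also have "\<dots> = \<alpha> * (l' div \<alpha> + 1) + (\<beta>' div \<alpha> + 1)"
          unfolding sum.distrib using \<alpha> by simp
        also have "\<dots> \<le> l' + \<alpha> + (\<beta>' div 5 + 1)"
          using \<alpha> by (intro add_mono) (simp_all add: div_le_mono2)
        finally show ?thesis using True by (simp add: l'_def \<beta>'_def)
      next
        case False
        then show ?thesis by (simp add: \<delta>_def Let_def)
      qed
    qed
    also have "\<dots> = (\<Sum>i\<in>{1..d}. if i \<in> v then l i + \<beta> i div 5 + (\<alpha> + 1) else 0)"
      by (rule sum.reindex_bij_witness[of _ "\<lambda>j. j - 1" Suc]) auto
    also have "\<dots> = (\<Sum>i\<in>v. l i + \<beta> i div 5 + (\<alpha> + 1))"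
      using v by (subst sum.inter_restrict[symmetric]) (auto simp: Int_absorb1)
    also have "\<dots> \<le> (\<Sum>i\<in>v. l i) + (\<Sum>i\<in>v. \<beta> i div 5) + d * (\<alpha> + 1)"
    proof -
      have "card v \<le> d" using card_mono[OF _ v] by simp
      then have "card v * (\<alpha> + 1) \<le> d * (\<alpha> + 1)" by (rule mult_le_mono1)
      then show ?thesis unfolding sum.distrib by simp
    qed
    finally have "(\<Sum>j\<in>{1..\<alpha> * d}. \<delta> j) \<le> (\<Sum>i\<in>v. l i) + (\<Sum>i\<in>v. \<beta> i div 5) + d * (\<alpha> + 1)" .
    moreover have "5 * (\<Sum>i\<in>v. \<beta> i div 5) \<le> (\<Sum>i\<in>v. \<beta> i)"
      unfolding sum_distrib_left by (intro sum_mono) simp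
    moreover have "a + g \<le> m" if "a \<le> L + B + D" "5 * B \<le> S" "5 * L + S + 5 * (g + D) \<le> 5 * m"
      for a L B D S g :: nat
      using that by simp
    ultimately have "(\<Sum>j\<in>{1..\<alpha> * d}. \<delta> j) + (\<Sum>j=1..\<alpha> * d. degree (sobol_poly q j)) \<le> m"
      using m by blast
    moreover have "(\<Sum>j\<in>{1..\<alpha> * d}. \<delta> j + degree (sobol_poly q j) - 1) \<le>
       (\<Sum>j\<in>{1..\<alpha> * d}. \<delta> j + degree (sobol_poly q j))"
      by (intro sum_mono) simp
    ultimately show "(\<Sum>j\<in>{1..\<alpha> * d}. \<delta> j + degree (sobol_poly q j) - 1) \<le> m"
      by (simp add: sum.distrib)
  qed simp
  then obtain k where k: "k \<in> {1..m}" "(\<Sum>(j, k')\<in>\<phi> ` E. sobol_matrix q j k' k) \<noteq> 0"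
    by (auto simp: sobol_matrix_def Let_def)
  have "(\<Sum>n\<in>{b * 2 ^ m..<Suc b * 2 ^ m}. \<Prod>(i, p)\<in>E. digit_sign (interlaced_digit \<alpha> q n i) p) =
    (\<Sum>n\<in>{b * 2 ^ m..<Suc b * 2 ^ m}. \<Prod>(j, k)\<in>\<phi> ` E. bit_sign (digital_digit (sobol_matrix q j) n k))"
    unfolding prod.reindex[OF inj]
    by (intro sum.cong prod.cong refl)
       (auto simp: \<phi>_def digit_sign_def bit_sign_def interlaced_digit_def)
  also have "\<dots> = 0"
    using k by (rule digital_character_sum_eq_0)
  finally show ?thesis .
qed

section \<open>Faber energies of blocks\<close>

text \<open>The indicator is the product over p < l of (1 + product of two signs) / 2, multiplied
  out over subsets.\<close>

lemma prefix_indicator_walsh: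
  assumes "a \<subseteq> {..<l}"
  shows "of_bool (digit_prefix l f = a) =
    (\<Sum>e\<in>Pow {..<l}. (\<Prod>p\<in>e. digit_sign (\<lambda>p. p \<in> a) p) * (\<Prod>p\<in>e. digit_sign f p)) / 2 ^ l"
proof -
  have "(\<Sum>e\<in>Pow {..<l}. (\<Prod>p\<in>e. digit_sign (\<lambda>p. p \<in> a) p) * (\<Prod>p\<in>e. digit_sign f p)) =
     (\<Prod>p<l. digit_sign (\<lambda>p. p \<in> a) p * digit_sign f p + 1)"
    by (subst prod_add) (simp_all add: prod.distrib)
  also have "\<dots> = (\<Prod>p<l. if f p = (p \<in> a) then 2 else 0)"
    by (intro prod.cong) (auto simp: digit_sign_def)
  also have "\<dots> = of_bool (\<forall>p<l. f p = (p \<in> a)) * 2 ^ l"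
    by (auto simp: prod_zero_iff)
  also have "(\<forall>p<l. f p = (p \<in> a)) \<longleftrightarrow> digit_prefix l f = a"
    using assms by (auto simp: digit_prefix_def)
  finally show ?thesis by simp
qed

lemma faber_walsh:
  assumes "l < R" "\<not> f R"
  shows "faber R l a f = (\<Sum>b\<le>R - l. tent_weight (R - l) b / 2 ^ l *
    (of_bool (digit_prefix l f = a) * (digit_sign f l * digit_sign f (l + b))))"
proof -
  have "tent (digit_tail R l f) = (\<Sum>b\<le>R - l. tent_weight (R - l) b * (digit_sign f l * digit_sign f (l + b)))"
    unfolding digit_tail_def using assms
    by (subst tent_walsh_expansion) (auto simp: digit_sign_def add.commute)
  then show ?thesis
    by (simp add: faber_def sum_distrib_left sum_divide_distrib algebra_simps)
qed

lemma tent_bounds: "0 \<le> tent (digit_tail R l f)" "tent (digit_tail R l f) \<le> 1"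
  using dyadic_val_nonneg[of "R - l" "\<lambda>p. f (p + l)"] dyadic_val_le_1[of "R - l" "\<lambda>p. f (p + l)"]
  by (auto simp: digit_tail_def tent_def min_def)

lemma abs_faber0_le:
  "\<bar>faber0 R l a f\<bar> \<le> (of_bool (digit_prefix l f = a) + 1 / 2 ^ l) / 2 ^ l"
proof -
  have "0 \<le> faber R l a f" "faber R l a f \<le> of_bool (digit_prefix l f = a) / 2 ^ l"
    unfolding faber_def using tent_bounds[of R l f] by (auto intro: divide_right_mono)
  moreover have "1 / (4 * 4 ^ l) \<le> (1 / 2 ^ l / 2 ^ l :: real)"
    by (simp add: field_simps flip: power_mult_distrib)
  moreover have "0 \<le> (1 / (4 * 4 ^ l) :: real)" "0 \<le> (1 / 2 ^ l / 2 ^ l :: real)" by simp_all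
  ultimately show ?thesis
    unfolding faber0_def add_divide_distrib by linarith
qed

text \<open>Used to enlarge a box that is too fine until the net property applies to it.\<close>

lemma sum_smaller_exists:
  fixes f :: "'a \<Rightarrow> nat"
  assumes "finite A" "k \<le> sum f A"
  shows "\<exists>g. (\<forall>x\<in>A. g x \<le> f x) \<and> sum g A = k"
  using assms
proof (induction A arbitrary: k)
  case (insert x A)
  define y where "y = min k (f x)"
  have "k - y \<le> sum f A" using insert by (auto simp: y_def)
  then obtain g where g: "\<forall>x\<in>A. g x \<le> f x" "sum g A = k - y" using insert.IH by blast
  have "sum (g(x := y)) A = sum g A" using insert by (intro sum.cong) auto
  then show ?case using insert g by (intro exI[of _ "g(x := y)"]) (auto simp: y_def)
qed auto

lemma geometric_sum_three_quarters: "(\<Sum>b\<le>S. (3 / 4 :: real) ^ b) \<le> 4"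
proof -
  have "(\<Sum>b\<le>S. (3 / 4 :: real) ^ b) = 4 - 3 * (3 / 4) ^ S"
    by (induction S) (auto simp: field_simps)
  then show ?thesis by simp
qed

text \<open>All later estimates use only these two properties. \<open>D n i p\<close> is digit p of
  coordinate i of point n, and \<open>c\<close> is the defect of the net: the slack between the
  total level and the block exponent m.\<close>

locale digital_net_blocks =
  fixes d c R N :: nat and D :: "nat \<Rightarrow> nat \<Rightarrow> nat \<Rightarrow> bool"
  assumes character_sum_eq_0: "\<And>m b E v l \<beta>. finite E \<Longrightarrow> E \<noteq> {} \<Longrightarrow> v \<subseteq> {1..d} \<Longrightarrow>
      (\<And>i p. (i, p) \<in> E \<Longrightarrow> i \<in> v \<and> (p \<le> l i \<or> p = l i + \<beta> i)) \<Longrightarrow>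
      5 * (\<Sum>i\<in>v. l i) + (\<Sum>i\<in>v. \<beta> i) + 5 * c \<le> 5 * m \<Longrightarrow>
      (\<Sum>n\<in>{b * 2 ^ m..<Suc b * 2 ^ m}. \<Prod>(i, p)\<in>E. digit_sign (D n i) p) = 0"
    and digit_R: "\<And>n i. n < N \<Longrightarrow> \<not> D n i R"
begin

text \<open>Prefix positions lie below l i and the two further signs sit at l i and beyond, so every
  term of the expansion is one character on a disjoint union of positions. Only the empty character
  survives summation over the block.\<close>

lemma box_walsh_sum:
  assumes v: "v \<subseteq> {1..d}" and a: "\<And>i. i \<in> v \<Longrightarrow> a i \<subseteq> {..<l i}"
    and m: "5 * (\<Sum>i\<in>v. l i) + (\<Sum>i\<in>v. \<beta> i) + 5 * c \<le> 5 * m"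
  shows "(\<Sum>n\<in>{b * 2 ^ m..<Suc b * 2 ^ m}. \<Prod>i\<in>v. of_bool (digit_prefix (l i) (D n i) = a i) *
      (digit_sign (D n i) (l i) * digit_sign (D n i) (l i + \<beta> i))) =
    (if \<forall>i\<in>v. \<beta> i = 0 then 2 ^ m / 2 ^ (\<Sum>i\<in>v. l i) else 0)"
proof -
  \<comment> \<open>For \<beta> i = 0 the two signs multiply to 1, hence the empty set and not the
    singleton of l i.\<close>
  define B where "B = (\<lambda>i. if \<beta> i = 0 then {} else {l i, l i + \<beta> i})"
  define A where "A = (\<lambda>e. \<Prod>i\<in>v. (\<Prod>p\<in>e i. digit_sign (\<lambda>p. p \<in> a i) p))"
  define S where "S = (\<lambda>e n. \<Prod>(i, p)\<in>(SIGMA i:v. e i \<union> B i). digit_sign (D n i) p)"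
  have fv: "finite v" using v finite_subset by auto
  have "(\<Prod>i\<in>v. of_bool (digit_prefix (l i) (D n i) = a i) *
      (digit_sign (D n i) (l i) * digit_sign (D n i) (l i + \<beta> i))) =
     (\<Sum>e\<in>PiE v (\<lambda>i. Pow {..<l i}). A e * S e n) / 2 ^ (\<Sum>i\<in>v. l i)" for n
  proof -
    have "(\<Prod>i\<in>v. of_bool (digit_prefix (l i) (D n i) = a i) *
        (digit_sign (D n i) (l i) * digit_sign (D n i) (l i + \<beta> i))) =
      (\<Prod>i\<in>v. (\<Sum>e\<in>Pow {..<l i}. (\<Prod>p\<in>e. digit_sign (\<lambda>p. p \<in> a i) p) *
         (\<Prod>p\<in>e \<union> B i. digit_sign (D n i) p)) / 2 ^ l i)"
    proof (intro prod.cong refl)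
      fix i assume i: "i \<in> v"
      have ss: "digit_sign (D n i) (l i) * digit_sign (D n i) (l i + \<beta> i) = (\<Prod>p\<in>B i. digit_sign (D n i) p)"
        by (auto simp: B_def)
      have un: "(\<Prod>p\<in>e \<union> B i. digit_sign (D n i) p) =
          (\<Prod>p\<in>e. digit_sign (D n i) p) * (\<Prod>p\<in>B i. digit_sign (D n i) p)"
        if "e \<in> Pow {..<l i}" for e
        using that by (intro prod.union_disjoint) (auto simp: B_def finite_subset[of e "{..<l i}"])
      show "of_bool (digit_prefix (l i) (D n i) = a i) *
        (digit_sign (D n i) (l i) * digit_sign (D n i) (l i + \<beta> i)) =
        (\<Sum>e\<in>Pow {..<l i}. (\<Prod>p\<in>e. digit_sign (\<lambda>p. p \<in> a i) p) *
         (\<Prod>p\<in>e \<union> B i. digit_sign (D n i) p)) / 2 ^ l i"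
        unfolding prefix_indicator_walsh[OF a[OF i]] ss
        by (simp add: sum_distrib_right mult.assoc) (intro sum.cong refl, simp only: un)
    qed
    also have "\<dots> = (\<Sum>e\<in>PiE v (\<lambda>i. Pow {..<l i}). \<Prod>i\<in>v. (\<Prod>p\<in>e i. digit_sign (\<lambda>p. p \<in> a i) p) *
         (\<Prod>p\<in>e i \<union> B i. digit_sign (D n i) p)) / 2 ^ (\<Sum>i\<in>v. l i)"
      unfolding prod_dividef power_sum[symmetric] using fv by (subst prod_sum_PiE) auto
    also have "\<dots> = (\<Sum>e\<in>PiE v (\<lambda>i. Pow {..<l i}). A e * S e n) / 2 ^ (\<Sum>i\<in>v. l i)"
    proof (intro arg_cong[where f = "\<lambda>x. x / 2 ^ (\<Sum>i\<in>v. l i)"] sum.cong refl)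
      fix e assume e: "e \<in> PiE v (\<lambda>i. Pow {..<l i})"
      have "finite (e i)" if "i \<in> v" for i
        using e that finite_subset[of "e i" "{..<l i}"] by (auto simp: PiE_iff)
      then have "S e n = (\<Prod>i\<in>v. \<Prod>p\<in>e i \<union> B i. digit_sign (D n i) p)"
        unfolding S_def using fv by (subst prod.Sigma) (auto simp: B_def)
      then show "(\<Prod>i\<in>v. (\<Prod>p\<in>e i. digit_sign (\<lambda>p. p \<in> a i) p) *
         (\<Prod>p\<in>e i \<union> B i. digit_sign (D n i) p)) = A e * S e n"
        by (simp add: A_def prod.distrib)
    qed
    finally show ?thesis .
  qed
  then have "(\<Sum>n\<in>{b * 2 ^ m..<Suc b * 2 ^ m}. \<Prod>i\<in>v. of_bool (digit_prefix (l i) (D n i) = a i) *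
      (digit_sign (D n i) (l i) * digit_sign (D n i) (l i + \<beta> i))) =
    (\<Sum>n\<in>{b * 2 ^ m..<Suc b * 2 ^ m}. \<Sum>e\<in>PiE v (\<lambda>i. Pow {..<l i}). A e * S e n) / 2 ^ (\<Sum>i\<in>v. l i)"
    by (simp add: sum_divide_distrib)
  also have "(\<Sum>n\<in>{b * 2 ^ m..<Suc b * 2 ^ m}. \<Sum>e\<in>PiE v (\<lambda>i. Pow {..<l i}). A e * S e n) =
      (\<Sum>e\<in>PiE v (\<lambda>i. Pow {..<l i}). A e * (\<Sum>n\<in>{b * 2 ^ m..<Suc b * 2 ^ m}. S e n))"
    by (subst sum.swap) (simp add: sum_distrib_left)
  also have "\<dots> = (\<Sum>e\<in>PiE v (\<lambda>i. Pow {..<l i}).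
      if e = (\<lambda>i\<in>v. {}) then (if \<forall>i\<in>v. \<beta> i = 0 then 2 ^ m else 0) else 0)"
  proof (intro sum.cong refl)
    fix e assume e: "e \<in> PiE v (\<lambda>i. Pow {..<l i})"
    have fin: "finite (e i)" if "i \<in> v" for i
      using e that finite_subset[of "e i" "{..<l i}"] by (auto simp: PiE_iff)
    show "A e * (\<Sum>n\<in>{b * 2 ^ m..<Suc b * 2 ^ m}. S e n) =
      (if e = (\<lambda>i\<in>v. {}) then (if \<forall>i\<in>v. \<beta> i = 0 then 2 ^ m else 0) else 0)"
    proof (cases "(SIGMA i:v. e i \<union> B i) = {}")
      case True
      then have emp: "e i = {}" "B i = {}" if "i \<in> v" for i using that by auto
      then have "e = (\<lambda>i\<in>v. {})" using e by (auto simp: PiE_iff extensional_def fun_eq_iff)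
      moreover have "\<forall>i\<in>v. \<beta> i = 0" using emp(2) unfolding B_def by (metis insert_not_empty)
      moreover have "A e = 1" unfolding A_def using emp(1) by simp
      moreover have "S e n = 1" for n unfolding S_def True by simp
      ultimately show ?thesis by simp
    next
      case False
      have "(\<Sum>n\<in>{b * 2 ^ m..<Suc b * 2 ^ m}. S e n) = 0"
        unfolding S_def
      proof (rule character_sum_eq_0[OF _ False v _ m])
        show "finite (SIGMA i:v. e i \<union> B i)" using fv fin by (auto simp: B_def)
        show "i \<in> v \<and> (p \<le> l i \<or> p = l i + \<beta> i)" if "(i, p) \<in> (SIGMA i:v. e i \<union> B i)" for i p
        proof -
          from that have "i \<in> v" "p \<in> e i \<or> p \<in> B i" by auto
          moreover have "e i \<subseteq> {..<l i}" using e \<open>i \<in> v\<close> by (auto simp: PiE_iff)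
          ultimately show ?thesis by (auto simp: B_def split: if_splits)
        qed
      qed
      moreover have "\<not> (e = (\<lambda>i\<in>v. {}) \<and> (\<forall>i\<in>v. \<beta> i = 0))"
        using False by (auto simp: B_def)
      ultimately show ?thesis by auto
    qed
  qed
  also have "\<dots> = (if \<forall>i\<in>v. \<beta> i = 0 then 2 ^ m else 0)"
    using fv by (subst sum.delta) (auto intro!: finite_PiE)
  finally show ?thesis by simp
qed

lemma box_count:
  assumes "v \<subseteq> {1..d}" "\<And>i. i \<in> v \<Longrightarrow> a i \<subseteq> {..<l i}" "(\<Sum>i\<in>v. l i) + c \<le> m"
  shows "(\<Sum>n\<in>{b * 2 ^ m..<Suc b * 2 ^ m}. \<Prod>i\<in>v. of_bool (digit_prefix (l i) (D n i) = a i) :: real) =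
    2 ^ m / 2 ^ (\<Sum>i\<in>v. l i)"
  using box_walsh_sum[of v a l "\<lambda>_. 0" m b] assms by simp

text \<open>For coarse boxes the count is exact. For m < c the whole block has at most 2^c points.
  Otherwise the box lies in a larger one of total level m - c, which contains exactly 2^c points of
  the block.\<close>

lemma box_count_le:
  assumes v: "v \<subseteq> {1..d}" and a: "\<And>i. i \<in> v \<Longrightarrow> a i \<subseteq> {..<l i}"
  shows "(\<Sum>n\<in>{b * 2 ^ m..<Suc b * 2 ^ m}. \<Prod>i\<in>v. of_bool (digit_prefix (l i) (D n i) = a i) :: real) \<le>
    2 ^ c * (1 + 2 ^ m / 2 ^ (\<Sum>i\<in>v. l i))"
proof -
  consider "(\<Sum>i\<in>v. l i) + c \<le> m" | "m < c" | "c \<le> m" "m - c \<le> (\<Sum>i\<in>v. l i)" by linarith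
  then show ?thesis
  proof cases
    case 1
    have "2 ^ m / 2 ^ (\<Sum>i\<in>v. l i) \<le> (2 ^ c * (1 + 2 ^ m / 2 ^ (\<Sum>i\<in>v. l i)) :: real)"
      using mult_mono[of 1 "2 ^ c :: real" "2 ^ m / 2 ^ (\<Sum>i\<in>v. l i)" "1 + 2 ^ m / 2 ^ (\<Sum>i\<in>v. l i)"] by simp
    then show ?thesis using box_count[of v a l m b] 1 v a by simp
  next
    case 2
    have "(\<Sum>n\<in>{b * 2 ^ m..<Suc b * 2 ^ m}. \<Prod>i\<in>v. of_bool (digit_prefix (l i) (D n i) = a i) :: real) \<le>
       (\<Sum>n\<in>{b * 2 ^ m..<Suc b * 2 ^ m}. 1)"
      by (intro sum_mono prod_le_1) auto
    also have "\<dots> = 2 ^ m" by simp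
    also have "\<dots> \<le> 2 ^ c" using 2 by (intro power_increasing) auto
    also have "\<dots> \<le> 2 ^ c * (1 + 2 ^ m / 2 ^ (\<Sum>i\<in>v. l i))" by simp
    finally show ?thesis .
  next
    case 3
    have "finite v" using v finite_subset by auto
    then obtain g where g: "\<And>i. i \<in> v \<Longrightarrow> g i \<le> l i" "sum g v = m - c"
      using sum_smaller_exists[OF _ 3(2)] by metis
    have "(\<Sum>n\<in>{b * 2 ^ m..<Suc b * 2 ^ m}. \<Prod>i\<in>v. of_bool (digit_prefix (l i) (D n i) = a i) :: real) \<le>
        (\<Sum>n\<in>{b * 2 ^ m..<Suc b * 2 ^ m}. \<Prod>i\<in>v. of_bool (digit_prefix (g i) (D n i) = a i \<inter> {..<g i}))"
    proof (intro sum_mono prod_mono conjI)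
      fix n i assume "i \<in> v"
      then show "(of_bool (digit_prefix (l i) (D n i) = a i) :: real) \<le>
          of_bool (digit_prefix (g i) (D n i) = a i \<inter> {..<g i})"
      proof (cases "digit_prefix (l i) (D n i) = a i")
        case True
        have "digit_prefix (g i) (D n i) = a i \<inter> {..<g i}"
          unfolding True[symmetric] using g(1)[OF \<open>i \<in> v\<close>] by (auto simp: digit_prefix_def)
        then show ?thesis by simp
      qed simp
    qed simp
    also have "\<dots> = 2 ^ m / 2 ^ (m - c)"
      using box_count[of v "\<lambda>i. a i \<inter> {..<g i}" g m b] v g 3 by auto
    also have "\<dots> = 2 ^ c"
      using 3 by (simp add: power_diff)
    also have "\<dots> \<le> 2 ^ c * (1 + 2 ^ m / 2 ^ (\<Sum>i\<in>v. l i))" by simp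
    finally show ?thesis .
  qed
qed

text \<open>
  Sign sums that may be nonzero are bounded with the factor \<open>(3/2)\<^bsup>b\<^esup> / 4\<^bsup>m - L - c\<^esup>\<close>, where \<open>b\<close> is the
  total of the second offsets; it is at least 1 for them because \<open>(3/2)\<^sup>5 > 4\<close>. The bound then
  factors over the coordinates, and no power of \<open>m - L\<close> appears.
\<close>

lemma faber_product_sum:
  assumes v: "v \<subseteq> {1..d}" and a: "\<And>i. i \<in> v \<Longrightarrow> a i \<subseteq> {..<l i}"
    and l: "\<And>i. i \<in> v \<Longrightarrow> l i < R" and m: "(\<Sum>i\<in>v. l i) + c \<le> m" and N: "Suc b * 2 ^ m \<le> N"
  shows "\<bar>(\<Sum>n\<in>{b * 2 ^ m..<Suc b * 2 ^ m}. \<Prod>i\<in>v. faber R (l i) (a i) (D n i)) -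
    2 ^ m * (\<Prod>i\<in>v. 1 / (4 * 4 ^ l i))\<bar> \<le> 4 ^ (d + c) / 2 ^ m"
proof -
  define L where "L = (\<Sum>i\<in>v. l i)"
  define B where "B = PiE v (\<lambda>i. {..R - l i})"
  define w where "w = (\<lambda>\<beta>. \<Prod>i\<in>v. tent_weight (R - l i) (\<beta> i))"
  define S where "S = (\<lambda>\<beta>. \<Sum>n\<in>{b * 2 ^ m..<Suc b * 2 ^ m}. \<Prod>i\<in>v. of_bool (digit_prefix (l i) (D n i) = a i) *
      (digit_sign (D n i) (l i) * digit_sign (D n i) (l i + \<beta> i)))"
  define \<beta>0 where "\<beta>0 = (\<lambda>i\<in>v. 0 :: nat)"
  have fv: "finite v" using v finite_subset by auto
  have finB: "finite B" unfolding B_def using fv by (intro finite_PiE) auto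
  have \<beta>0: "\<beta>0 \<in> B" by (auto simp: B_def \<beta>0_def)
  have "(\<Sum>n\<in>{b * 2 ^ m..<Suc b * 2 ^ m}. \<Prod>i\<in>v. faber R (l i) (a i) (D n i)) =
     (\<Sum>n\<in>{b * 2 ^ m..<Suc b * 2 ^ m}. \<Sum>\<beta>\<in>B. w \<beta> / 2 ^ L *
       (\<Prod>i\<in>v. of_bool (digit_prefix (l i) (D n i) = a i) *
      (digit_sign (D n i) (l i) * digit_sign (D n i) (l i + \<beta> i))))"
  proof (rule sum.cong[OF refl])
    fix n assume "n \<in> {b * 2 ^ m..<Suc b * 2 ^ m}"
    then have "n < N" using N by auto
    have "(\<Prod>i\<in>v. faber R (l i) (a i) (D n i)) = (\<Prod>i\<in>v. \<Sum>b\<le>R - l i. tent_weight (R - l i) b / 2 ^ l i *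
      (of_bool (digit_prefix (l i) (D n i) = a i) * (digit_sign (D n i) (l i) * digit_sign (D n i) (l i + b))))"
      using l digit_R[OF \<open>n < N\<close>] by (intro prod.cong refl faber_walsh) auto
    also have "\<dots> = (\<Sum>\<beta>\<in>B. \<Prod>i\<in>v. tent_weight (R - l i) (\<beta> i) / 2 ^ l i *
      (of_bool (digit_prefix (l i) (D n i) = a i) * (digit_sign (D n i) (l i) * digit_sign (D n i) (l i + \<beta> i))))"
      unfolding B_def using fv by (intro prod_sum_PiE) auto
    also have "\<dots> = (\<Sum>\<beta>\<in>B. w \<beta> / 2 ^ L * (\<Prod>i\<in>v. of_bool (digit_prefix (l i) (D n i) = a i) *
      (digit_sign (D n i) (l i) * digit_sign (D n i) (l i + \<beta> i))))"
      by (simp only: prod.distrib prod_dividef w_def L_def power_sum)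
    finally show "(\<Prod>i\<in>v. faber R (l i) (a i) (D n i)) = \<dots>" .
  qed
  also have "\<dots> = (\<Sum>\<beta>\<in>B. w \<beta> / 2 ^ L * S \<beta>)"
    unfolding S_def by (subst sum.swap) (simp only: sum_distrib_left)
  also have "\<dots> = w \<beta>0 / 2 ^ L * S \<beta>0 + (\<Sum>\<beta>\<in>B - {\<beta>0}. w \<beta> / 2 ^ L * S \<beta>)"
    using finB \<beta>0 by (rule sum.remove)
  \<comment> \<open>Without offsets the signs cancel and the box count remains. The weight 1/4 per
    coordinate turns it into the number of points times the integrals of the hats.\<close>
  also have "w \<beta>0 / 2 ^ L * S \<beta>0 = 2 ^ m * (\<Prod>i\<in>v. 1 / (4 * 4 ^ l i))"
  proof -
    have "S \<beta>0 = (\<Sum>n\<in>{b * 2 ^ m..<Suc b * 2 ^ m}. \<Prod>i\<in>v. of_bool (digit_prefix (l i) (D n i) = a i))"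
      unfolding S_def \<beta>0_def by (intro sum.cong prod.cong) auto
    also have "\<dots> = 2 ^ m / 2 ^ L"
      unfolding L_def by (rule box_count) (use v a m in auto)
    finally have "w \<beta>0 / 2 ^ L * S \<beta>0 = 2 ^ m * (w \<beta>0 / (2 ^ L * 2 ^ L))" by simp
    also have "(2 ^ L * 2 ^ L :: real) = (\<Prod>i\<in>v. 4 ^ l i)"
      by (simp add: L_def power_sum flip: prod.distrib power_mult_distrib)
    also have "w \<beta>0 / (\<Prod>i\<in>v. 4 ^ l i) = (\<Prod>i\<in>v. 1 / (4 * 4 ^ l i))"
      by (simp add: w_def \<beta>0_def tent_weight_def prod_dividef prod.distrib power_one_over)
    finally show ?thesis .
  qed
  finally have "\<bar>(\<Sum>n\<in>{b * 2 ^ m..<Suc b * 2 ^ m}. \<Prod>i\<in>v. faber R (l i) (a i) (D n i)) -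
    2 ^ m * (\<Prod>i\<in>v. 1 / (4 * 4 ^ l i))\<bar> = \<bar>\<Sum>\<beta>\<in>B - {\<beta>0}. w \<beta> / 2 ^ L * S \<beta>\<bar>" by simp
  also have "\<dots> \<le> (\<Sum>\<beta>\<in>B - {\<beta>0}. \<bar>w \<beta> / 2 ^ L * S \<beta>\<bar>)" by (rule sum_abs)
  also have "\<dots> \<le> (\<Sum>\<beta>\<in>B - {\<beta>0}. 2 ^ m / (2 ^ L * 2 ^ L) / 4 ^ (m - L - c) * (\<Prod>i\<in>v. (3 / 4) ^ \<beta> i))"
  proof (intro sum_mono)
    fix \<beta> assume \<beta>: "\<beta> \<in> B - {\<beta>0}"
    have w: "\<bar>w \<beta>\<bar> \<le> 1 / 2 ^ (\<Sum>i\<in>v. \<beta> i)"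
    proof -
      have "\<bar>w \<beta>\<bar> \<le> (\<Prod>i\<in>v. 1 / 2 ^ \<beta> i)"
        unfolding w_def abs_prod by (intro prod_mono conjI abs_ge_zero abs_tent_weight_le)
      then show ?thesis by (simp add: prod_dividef power_sum)
    qed
    have "\<bar>S \<beta>\<bar> \<le> 2 ^ m / 2 ^ L * ((3 / 2) ^ (\<Sum>i\<in>v. \<beta> i) / 4 ^ (m - L - c))"
    proof (cases "5 * (\<Sum>i\<in>v. l i) + (\<Sum>i\<in>v. \<beta> i) + 5 * c \<le> 5 * m")
      case True
      have "\<beta> = \<beta>0" if "\<forall>i\<in>v. \<beta> i = 0"
        using \<beta> that by (auto simp: B_def \<beta>0_def PiE_iff extensional_def fun_eq_iff)
      then have "\<not> (\<forall>i\<in>v. \<beta> i = 0)" using \<beta> by auto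
      then have "S \<beta> = 0"
        unfolding S_def using box_walsh_sum[OF v, of a l \<beta> m b] a True by simp
      then show ?thesis by simp
    next
      case False
      then have "5 * (m - L - c) \<le> (\<Sum>i\<in>v. \<beta> i)" using m by (simp add: L_def)
      then have "(3 / 2 :: real) ^ (5 * (m - L - c)) \<le> (3 / 2) ^ (\<Sum>i\<in>v. \<beta> i)"
        by (intro power_increasing) auto
      moreover have "(4 :: real) ^ (m - L - c) \<le> (3 / 2) ^ (5 * (m - L - c))"
        unfolding power_mult by (intro power_mono) (auto simp: power_divide)
      ultimately have "(4 :: real) ^ (m - L - c) \<le> (3 / 2) ^ (\<Sum>i\<in>v. \<beta> i)"
        by (rule order_trans[rotated])
      then have one: "1 \<le> (3 / 2 :: real) ^ (\<Sum>i\<in>v. \<beta> i) / 4 ^ (m - L - c)"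
        by simp
      have "\<bar>S \<beta>\<bar> \<le> (\<Sum>n\<in>{b * 2 ^ m..<Suc b * 2 ^ m}. \<Prod>i\<in>v. of_bool (digit_prefix (l i) (D n i) = a i))"
        unfolding S_def by (rule order_trans[OF sum_abs]) (simp add: abs_prod abs_mult)
      also have "\<dots> = 2 ^ m / 2 ^ L"
        unfolding L_def by (rule box_count) (use v a m in auto)
      also have "\<dots> \<le> 2 ^ m / 2 ^ L * ((3 / 2) ^ (\<Sum>i\<in>v. \<beta> i) / 4 ^ (m - L - c))"
        using mult_left_mono[OF one, of "2 ^ m / 2 ^ L"] by simp
      finally show ?thesis .
    qed
    with w have "\<bar>w \<beta>\<bar> * \<bar>S \<beta>\<bar> \<le> 1 / 2 ^ (\<Sum>i\<in>v. \<beta> i) *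
        (2 ^ m / 2 ^ L * ((3 / 2) ^ (\<Sum>i\<in>v. \<beta> i) / 4 ^ (m - L - c)))"
      by (intro mult_mono) auto
    also have "\<dots> = 2 ^ m / 2 ^ L / 4 ^ (m - L - c) * ((3 / 2) ^ (\<Sum>i\<in>v. \<beta> i) / 2 ^ (\<Sum>i\<in>v. \<beta> i))"
      by simp
    \<comment> \<open>The weight 2^-b against the factor (3/2)^b leaves (3/4)^b, a geometric series
      in each coordinate.\<close>
    also have "(3 / 2 :: real) ^ (\<Sum>i\<in>v. \<beta> i) / 2 ^ (\<Sum>i\<in>v. \<beta> i) = (\<Prod>i\<in>v. (3 / 4) ^ \<beta> i)"
      by (simp add: power_sum flip: power_divide prod_dividef)
    finally have "\<bar>w \<beta>\<bar> * \<bar>S \<beta>\<bar> / 2 ^ L \<le>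
        2 ^ m / 2 ^ L / 4 ^ (m - L - c) * (\<Prod>i\<in>v. (3 / 4) ^ \<beta> i) / 2 ^ L"
      by (rule divide_right_mono) simp
    then show "\<bar>w \<beta> / 2 ^ L * S \<beta>\<bar> \<le> 2 ^ m / (2 ^ L * 2 ^ L) / 4 ^ (m - L - c) * (\<Prod>i\<in>v. (3 / 4) ^ \<beta> i)"
      by (simp add: abs_mult mult.commute mult.left_commute)
  qed
  also have "\<dots> \<le> (\<Sum>\<beta>\<in>B. 2 ^ m / (2 ^ L * 2 ^ L) / 4 ^ (m - L - c) * (\<Prod>i\<in>v. (3 / 4) ^ \<beta> i))"
    using finB by (intro sum_mono2) (auto intro!: prod_nonneg divide_nonneg_nonneg mult_nonneg_nonneg)
  also have "\<dots> = 2 ^ m / (2 ^ L * 2 ^ L) / 4 ^ (m - L - c) * (\<Prod>i\<in>v. \<Sum>b\<le>R - l i. (3 / 4) ^ b)"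
    unfolding B_def sum_distrib_left[symmetric] using fv by (subst prod_sum_PiE) auto
  also have "\<dots> \<le> 2 ^ m / (2 ^ L * 2 ^ L) / 4 ^ (m - L - c) * 4 ^ d"
  proof (rule mult_left_mono)
    have "(\<Prod>i\<in>v. \<Sum>b\<le>R - l i. (3 / 4 :: real) ^ b) \<le> (\<Prod>i\<in>v. 4)"
      by (intro prod_mono conjI geometric_sum_three_quarters sum_nonneg) auto
    also have "\<dots> \<le> 4 ^ d"
      using card_mono[OF _ v] by (simp add: power_increasing)
    finally show "(\<Prod>i\<in>v. \<Sum>b\<le>R - l i. (3 / 4 :: real) ^ b) \<le> 4 ^ d" .
  qed simp
  \<comment> \<open>The level cancels: 2^m / 4^L / 4^(m - L - c) = 4^c / 2^m.\<close>
  also have "\<dots> = 4 ^ (d + c) / 2 ^ m"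
  proof -
    have "(2 ^ m * 2 ^ m :: real) = 4 ^ m" "(2 ^ L * 2 ^ L :: real) = 4 ^ L"
      by (simp_all flip: power_mult_distrib)
    moreover have "(4 :: real) ^ m = 4 ^ L * 4 ^ (m - L - c) * 4 ^ c"
      using m by (simp add: L_def flip: power_add)
    ultimately show ?thesis by (simp add: power_add field_simps)
  qed
  finally show ?thesis .
qed

text \<open>Expanding the centred product over subsets, the main terms of
  \<open>faber_product_sum\<close> recombine to a product of factors k i - k i, which vanishes for
  nonempty u. Only the at most 2^d error terms remain.\<close>

lemma faber0_product_sum:
  assumes u: "u \<subseteq> {1..d}" "u \<noteq> {}" and a: "\<And>i. i \<in> u \<Longrightarrow> a i \<subseteq> {..<l i}"
    and l: "\<And>i. i \<in> u \<Longrightarrow> l i < R" and m: "(\<Sum>i\<in>u. l i) + c \<le> m" and N: "Suc b * 2 ^ m \<le> N"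
  shows "\<bar>\<Sum>n\<in>{b * 2 ^ m..<Suc b * 2 ^ m}. \<Prod>i\<in>u. faber0 R (l i) (a i) (D n i)\<bar> \<le>
    2 ^ d * 4 ^ (d + c) / 2 ^ m"
proof -
  define k where "k = (\<lambda>i. 1 / (4 * 4 ^ l i) :: real)"
  define F where "F = (\<lambda>X. \<Sum>n\<in>{b * 2 ^ m..<Suc b * 2 ^ m}. \<Prod>i\<in>X. faber R (l i) (a i) (D n i))"
  have fu: "finite u" using u finite_subset by auto
  have k: "0 \<le> k i" "k i \<le> 1" for i
    using one_le_power[of "4 :: real" "l i"] by (simp_all add: k_def field_simps del: one_le_power)
  have "(\<Prod>i\<in>u. faber0 R (l i) (a i) (D n i)) =
      (\<Sum>X\<in>Pow u. (\<Prod>i\<in>X. faber R (l i) (a i) (D n i)) * (\<Prod>i\<in>u - X. - k i))" for n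
    unfolding prod_add[OF fu, symmetric] by (simp add: faber0_def k_def)
  then have "(\<Sum>n\<in>{b * 2 ^ m..<Suc b * 2 ^ m}. \<Prod>i\<in>u. faber0 R (l i) (a i) (D n i)) =
      (\<Sum>X\<in>Pow u. F X * (\<Prod>i\<in>u - X. - k i))"
    unfolding F_def by (simp only: sum_distrib_right) (rule sum.swap)
  also have "\<dots> = (\<Sum>X\<in>Pow u. (F X - 2 ^ m * prod k X) * (\<Prod>i\<in>u - X. - k i)) +
      2 ^ m * (\<Sum>X\<in>Pow u. prod k X * (\<Prod>i\<in>u - X. - k i))"
    by (simp add: sum_distrib_left algebra_simps flip: sum.distrib)
  also have "(\<Sum>X\<in>Pow u. prod k X * (\<Prod>i\<in>u - X. - k i)) = 0"
    unfolding prod_add[OF fu, symmetric] using u fu by (auto simp: card_gt_0_iff)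
  finally have "\<bar>\<Sum>n\<in>{b * 2 ^ m..<Suc b * 2 ^ m}. \<Prod>i\<in>u. faber0 R (l i) (a i) (D n i)\<bar> =
      \<bar>\<Sum>X\<in>Pow u. (F X - 2 ^ m * prod k X) * (\<Prod>i\<in>u - X. - k i)\<bar>" by simp
  also have "\<dots> \<le> (\<Sum>X\<in>Pow u. \<bar>(F X - 2 ^ m * prod k X) * (\<Prod>i\<in>u - X. - k i)\<bar>)" by (rule sum_abs)
  also have "\<dots> \<le> (\<Sum>X\<in>Pow u. 4 ^ (d + c) / 2 ^ m)"
  proof (intro sum_mono)
    fix X assume "X \<in> Pow u"
    then have X: "X \<subseteq> u" by simp
    have "(\<Sum>i\<in>X. l i) \<le> (\<Sum>i\<in>u. l i)" using X fu by (intro sum_mono2) auto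
    then have "\<bar>F X - 2 ^ m * prod k X\<bar> \<le> 4 ^ (d + c) / 2 ^ m"
      unfolding F_def k_def by (intro faber_product_sum) (use X u a l m N in auto)
    moreover have "\<bar>\<Prod>i\<in>u - X. - k i\<bar> \<le> 1"
      unfolding abs_prod using k by (intro prod_le_1) auto
    ultimately have "\<bar>F X - 2 ^ m * prod k X\<bar> * \<bar>\<Prod>i\<in>u - X. - k i\<bar> \<le> 4 ^ (d + c) / 2 ^ m * 1"
      by (intro mult_mono) auto
    then show "\<bar>(F X - 2 ^ m * prod k X) * (\<Prod>i\<in>u - X. - k i)\<bar> \<le> 4 ^ (d + c) / 2 ^ m"
      by (simp add: abs_mult)
  qed
  also have "\<dots> = 2 ^ card u * (4 ^ (d + c) / 2 ^ m)"
    using fu by (simp add: card_Pow)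
  also have "\<dots> \<le> 2 ^ d * (4 ^ (d + c) / 2 ^ m)"
    using card_mono[OF _ u(1)] by (intro mult_right_mono power_increasing) auto
  finally show ?thesis by simp
qed

text \<open>The power of 2 is the level weight of the kernel expansion, without its factor 2 per
  coordinate. The root of the energy is a seminorm of the point set; for empty u the energy is the
  squared number of points.\<close>

definition faber_energy :: "nat set \<Rightarrow> (nat \<Rightarrow> nat) \<Rightarrow> nat set \<Rightarrow> real" where
  "faber_energy u l B = 2 ^ (\<Sum>i\<in>u. l i) *
    (\<Sum>a\<in>PiE u (\<lambda>i. Pow {..<l i}). (\<Sum>n\<in>B. \<Prod>i\<in>u. faber0 R (l i) (a i) (D n i))\<^sup>2)"

text \<open>Each of the 2^L boxes contributes the square of a bound of order 2^-m, and the
  normalisation is another factor 2^L.\<close>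

lemma faber_energy_coarse:
  assumes u: "u \<subseteq> {1..d}" "u \<noteq> {}"
    and l: "\<And>i. i \<in> u \<Longrightarrow> l i < R" and m: "(\<Sum>i\<in>u. l i) + c \<le> m" and N: "Suc b * 2 ^ m \<le> N"
  shows "faber_energy u l {b * 2 ^ m..<Suc b * 2 ^ m} \<le> 2 ^ (6 * d + 4 * c) / 4 ^ (m - (\<Sum>i\<in>u. l i))"
proof -
  define L where "L = (\<Sum>i\<in>u. l i)"
  have fu: "finite u" using u finite_subset by auto
  have "(\<Sum>a\<in>PiE u (\<lambda>i. Pow {..<l i}). (\<Sum>n\<in>{b * 2 ^ m..<Suc b * 2 ^ m}. \<Prod>i\<in>u. faber0 R (l i) (a i) (D n i))\<^sup>2)
     \<le> (\<Sum>a\<in>PiE u (\<lambda>i. Pow {..<l i}). (2 ^ d * 4 ^ (d + c) / 2 ^ m)\<^sup>2)"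
  proof (intro sum_mono)
    fix a assume "a \<in> PiE u (\<lambda>i. Pow {..<l i})"
    then have "\<bar>\<Sum>n\<in>{b * 2 ^ m..<Suc b * 2 ^ m}. \<Prod>i\<in>u. faber0 R (l i) (a i) (D n i)\<bar> \<le>
        \<bar>2 ^ d * 4 ^ (d + c) / 2 ^ m\<bar>"
      using faber0_product_sum[of u a l m b] assms by (auto simp: PiE_iff)
    then show "(\<Sum>n\<in>{b * 2 ^ m..<Suc b * 2 ^ m}. \<Prod>i\<in>u. faber0 R (l i) (a i) (D n i))\<^sup>2 \<le>
        (2 ^ d * 4 ^ (d + c) / 2 ^ m)\<^sup>2"
      by (simp only: abs_le_square_iff)
  qed
  also have "\<dots> = 2 ^ L * (2 ^ d * 4 ^ (d + c) / 2 ^ m)\<^sup>2"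
    using fu by (simp add: card_PiE card_Pow L_def power_sum)
  finally have "faber_energy u l {b * 2 ^ m..<Suc b * 2 ^ m} \<le> 2 ^ L * (2 ^ L * (2 ^ d * 4 ^ (d + c) / 2 ^ m)\<^sup>2)"
    unfolding faber_energy_def L_def by (rule mult_left_mono) simp
  also have "\<dots> = 2 ^ (6 * d + 4 * c) / 4 ^ (m - L)"
  proof -
    have "(4 :: real) ^ m = 4 ^ (m - L) * 4 ^ L"
      using m by (simp add: L_def flip: power_add)
    moreover have "(4 :: real) ^ k = 2 ^ k * 2 ^ k" for k
      by (simp flip: power_mult_distrib)
    moreover have "(2 :: real) ^ (6 * d + 4 * c) = (2 ^ d * 4 ^ (d + c))\<^sup>2"
    proof -
      have "(4 :: real) ^ (d + c) = 2 ^ (2 * (d + c))" by (simp only: power_mult) simp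
      then show ?thesis by (simp flip: power_add power_mult add: algebra_simps)
    qed
    ultimately show ?thesis by (simp add: power2_eq_square field_simps)
  qed
  finally show ?thesis by (simp add: L_def)
qed

text \<open>No cancellation is available here, but boxes contain boundedly many points. The sum of
  squares is at most supremum times sum, where the supremum is of order 2^-L and the sum of order
  2^m / 2^L.\<close>

lemma faber_energy_fine:
  assumes u: "u \<subseteq> {1..d}" and m: "(\<Sum>i\<in>u. l i) + c > m"
  shows "faber_energy u l {b * 2 ^ m..<Suc b * 2 ^ m} \<le> 2 ^ (2 * d + 2 * c + 1) * 2 ^ m / 2 ^ (\<Sum>i\<in>u. l i)"
proof -
  define L where "L = (\<Sum>i\<in>u. l i)"
  define B where "B = {b * 2 ^ m..<Suc b * 2 ^ m}"
  define A where "A = PiE u (\<lambda>i. Pow {..<l i})"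
  define U where "U = (\<lambda>a. \<Sum>n\<in>B. \<Prod>i\<in>u. (of_bool (digit_prefix (l i) (D n i) = a i) + 1 / 2 ^ l i) / 2 ^ l i :: real)"
  have fu: "finite u" using u finite_subset by auto
  have card_u: "card u \<le> d" using card_mono[OF _ u] by simp
  have U_nonneg: "0 \<le> U a" for a
    unfolding U_def by (intro sum_nonneg prod_nonneg) auto
  have V_le: "\<bar>\<Sum>n\<in>B. \<Prod>i\<in>u. faber0 R (l i) (a i) (D n i)\<bar> \<le> U a" for a
    unfolding U_def by (rule order_trans[OF sum_abs])
      (auto simp: abs_prod intro!: sum_mono prod_mono abs_faber0_le)
  have U_le: "U a \<le> 2 ^ (d + 2 * c + 1) / 2 ^ L" if a: "a \<in> A" for a
  proof -
    have "U a = (\<Sum>n\<in>B. \<Sum>X\<in>Pow u. (\<Prod>i\<in>X. of_bool (digit_prefix (l i) (D n i) = a i)) * (\<Prod>i\<in>u - X. 1 / 2 ^ l i)) / 2 ^ L"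
      unfolding U_def prod_dividef prod_add[OF fu] L_def power_sum sum_divide_distrib[symmetric] ..
    also have "(\<Sum>n\<in>B. \<Sum>X\<in>Pow u. (\<Prod>i\<in>X. of_bool (digit_prefix (l i) (D n i) = a i)) * (\<Prod>i\<in>u - X. 1 / 2 ^ l i)) =
       (\<Sum>X\<in>Pow u. (\<Sum>n\<in>B. \<Prod>i\<in>X. of_bool (digit_prefix (l i) (D n i) = a i)) * (\<Prod>i\<in>u - X. 1 / 2 ^ l i :: real))"
      unfolding sum_distrib_right by (rule sum.swap)
    also have "\<dots> \<le> (\<Sum>X\<in>Pow u. 2 ^ (2 * c + 1))"
    proof (intro sum_mono)
      fix X assume "X \<in> Pow u"
      then have X: "X \<subseteq> u" by simp
      define P where "P = (\<Prod>i\<in>u - X. 1 / 2 ^ l i :: real)"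
      have P: "0 \<le> P" "P \<le> 1"
        unfolding P_def by (auto intro!: prod_nonneg prod_le_1)
      have "(\<Sum>n\<in>B. \<Prod>i\<in>X. of_bool (digit_prefix (l i) (D n i) = a i)) * P \<le>
          2 ^ c * (1 + 2 ^ m / 2 ^ (\<Sum>i\<in>X. l i)) * P"
        unfolding B_def by (intro mult_right_mono box_count_le) (use X u a P in \<open>auto simp: A_def PiE_iff\<close>)
      also have "\<dots> = 2 ^ c * (P + 2 ^ m * (P / 2 ^ (\<Sum>i\<in>X. l i)))"
        by (simp add: algebra_simps)
      also have "P / 2 ^ (\<Sum>i\<in>X. l i) = 1 / 2 ^ L"
      proof -
        have "(2 :: real) ^ L = (\<Prod>i\<in>u - X. 2 ^ l i) * 2 ^ (\<Sum>i\<in>X. l i)"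
          unfolding L_def power_sum using X fu by (simp add: prod.subset_diff)
        then show ?thesis by (simp add: P_def prod_dividef)
      qed
      also have "2 ^ c * (P + 2 ^ m * (1 / 2 ^ L)) \<le> 2 ^ c * (2 ^ c + 2 ^ c)"
      proof -
        have "(2 :: real) ^ m \<le> 2 ^ (L + c)" using m by (intro power_increasing) (auto simp: L_def)
        then have "2 ^ m * (1 / 2 ^ L) \<le> (2 :: real) ^ c" by (simp add: power_add field_simps)
        moreover have "P \<le> 2 ^ c" using P by (meson one_le_numeral one_le_power order_trans)
        ultimately show ?thesis by (intro mult_left_mono add_mono) auto
      qed
      also have "\<dots> = 2 ^ (2 * c + 1)" unfolding mult_2[of c] power_add by simp
      finally show "(\<Sum>n\<in>B. \<Prod>i\<in>X. of_bool (digit_prefix (l i) (D n i) = a i)) * (\<Prod>i\<in>u - X. 1 / 2 ^ l i) \<le> (2 :: real) ^ (2 * c + 1)"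
        by (simp add: P_def)
    qed
    also have "\<dots> = 2 ^ card u * 2 ^ (2 * c + 1)" using fu by (simp add: card_Pow)
    also have "\<dots> \<le> 2 ^ d * 2 ^ (2 * c + 1)"
      using card_u by (intro mult_right_mono power_increasing) auto
    finally show ?thesis by (simp add: power_add divide_right_mono ac_simps)
  qed
  \<comment> \<open>Summed over all prefixes, the indicator gives 1 and the centring term 2^l * 2^-l
    = 1, so the total of the majorant is exact.\<close>
  have "(\<Sum>a\<in>A. U a) = (\<Sum>n\<in>B. \<Prod>i\<in>u. \<Sum>a\<in>Pow {..<l i}. (of_bool (digit_prefix (l i) (D n i) = a) + 1 / 2 ^ l i) / 2 ^ l i)"
    unfolding U_def A_def by (subst sum.swap) (use fu in \<open>simp add: prod_sum_PiE\<close>)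
  also have "\<dots> = (\<Sum>n\<in>B. \<Prod>i\<in>u. 2 / 2 ^ l i)"
  proof (intro sum.cong prod.cong refl)
    fix n i
    have "(\<Sum>a\<in>Pow {..<l i}. of_bool (digit_prefix (l i) (D n i) = a) :: real) =
        (\<Sum>a\<in>Pow {..<l i}. if a = digit_prefix (l i) (D n i) then 1 else 0)"
      by (intro sum.cong) auto
    also have "\<dots> = 1"
      using digit_prefix_in_Pow[of "l i" "D n i"] by (subst sum.delta) auto
    finally show "(\<Sum>a\<in>Pow {..<l i}. (of_bool (digit_prefix (l i) (D n i) = a) + 1 / 2 ^ l i) / 2 ^ l i) = (2 / 2 ^ l i :: real)"
      by (simp add: sum.distrib card_Pow flip: sum_divide_distrib)
  qed
  also have "\<dots> = 2 ^ m * (2 ^ card u / 2 ^ L)"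
    by (simp add: B_def L_def prod_dividef power_sum)
  also have "\<dots> \<le> 2 ^ m * (2 ^ d / 2 ^ L)"
    using card_u by (intro mult_left_mono divide_right_mono power_increasing) auto
  finally have sum_U: "(\<Sum>a\<in>A. U a) \<le> 2 ^ m * (2 ^ d / 2 ^ L)" .
  have "(\<Sum>a\<in>A. (\<Sum>n\<in>B. \<Prod>i\<in>u. faber0 R (l i) (a i) (D n i))\<^sup>2) \<le> (\<Sum>a\<in>A. 2 ^ (d + 2 * c + 1) / 2 ^ L * U a)"
  proof (intro sum_mono)
    fix a assume "a \<in> A"
    have "(\<Sum>n\<in>B. \<Prod>i\<in>u. faber0 R (l i) (a i) (D n i))\<^sup>2 \<le> (U a)\<^sup>2"
      using V_le[of a] U_nonneg[of a] by (subst abs_le_square_iff[symmetric]) auto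
    also have "\<dots> \<le> 2 ^ (d + 2 * c + 1) / 2 ^ L * U a"
      unfolding power2_eq_square by (intro mult_right_mono U_le \<open>a \<in> A\<close> U_nonneg)
    finally show "(\<Sum>n\<in>B. \<Prod>i\<in>u. faber0 R (l i) (a i) (D n i))\<^sup>2 \<le> 2 ^ (d + 2 * c + 1) / 2 ^ L * U a" .
  qed
  also have "\<dots> \<le> 2 ^ (d + 2 * c + 1) / 2 ^ L * (2 ^ m * (2 ^ d / 2 ^ L))"
    unfolding sum_distrib_left[symmetric] using sum_U by (intro mult_left_mono) auto
  finally have "faber_energy u l B \<le> 2 ^ L * (2 ^ (d + 2 * c + 1) / 2 ^ L * (2 ^ m * (2 ^ d / 2 ^ L)))"
    unfolding faber_energy_def A_def L_def by (rule mult_left_mono) simp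
  also have "\<dots> = 2 ^ (d + (d + 2 * c + 1)) * 2 ^ m / 2 ^ L"
    unfolding power_add[of 2 d] by simp
  also have "d + (d + 2 * c + 1) = 2 * d + 2 * c + 1" by simp
  finally show ?thesis by (simp add: B_def L_def)
qed

text \<open>With truncated subtraction the exponent is |m - L|. The window L < m < L + c, where
  neither decay is available, is absorbed into the factor 2^(2 c).\<close>

lemma faber_energy_block:
  assumes u: "u \<subseteq> {1..d}" "u \<noteq> {}" and l: "\<And>i. i \<in> u \<Longrightarrow> l i < R" and N: "Suc b * 2 ^ m \<le> N"
  shows "faber_energy u l {b * 2 ^ m..<Suc b * 2 ^ m} \<le>
    2 ^ (6 * d + 4 * c + 1) * (1 / 2) ^ ((m - (\<Sum>i\<in>u. l i)) + ((\<Sum>i\<in>u. l i) - m))"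
proof -
  define L where "L = (\<Sum>i\<in>u. l i)"
  show ?thesis
  proof (cases "L + c \<le> m")
    case True
    then have "faber_energy u l {b * 2 ^ m..<Suc b * 2 ^ m} \<le> 2 ^ (6 * d + 4 * c) / 4 ^ (m - L)"
      unfolding L_def by (intro faber_energy_coarse) (use assms in auto)
    also have "\<dots> \<le> 2 ^ (6 * d + 4 * c + 1) / 2 ^ (m - L)"
      by (intro frac_le power_increasing power_mono) auto
    finally show ?thesis using True by (simp add: L_def power_one_over divide_simps)
  next
    case False
    have "(2 :: real) ^ m / 2 ^ L \<le> 2 ^ (2 * c) * (1 / 2) ^ ((m - L) + (L - m))"
    proof (cases "m \<le> L")
      case True
      then have "(2 :: real) ^ m / 2 ^ L = (1 / 2) ^ (L - m)"
        by (simp add: power_diff power_one_over field_simps)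
      then show ?thesis using True by simp
    next
      case False': False
      then have "m + (m - L) \<le> 2 * c + L" using False by simp
      then have "(2 :: real) ^ (m + (m - L)) \<le> 2 ^ (2 * c + L)" by (intro power_increasing) auto
      then have "(2 :: real) ^ m * 2 ^ (m - L) \<le> 2 ^ (2 * c) * 2 ^ L" by (simp only: power_add)
      then have "(2 :: real) ^ m / 2 ^ L \<le> 2 ^ (2 * c) / 2 ^ (m - L)" by (simp add: divide_simps)
      then show ?thesis using False' by (simp add: power_one_over)
    qed
    then have "2 ^ (2 * d + 2 * c + 1) * (2 ^ m / 2 ^ L) \<le>
        2 ^ (2 * d + 2 * c + 1) * (2 ^ (2 * c) * (1 / 2 :: real) ^ ((m - L) + (L - m)))"
      by (rule mult_left_mono) simp
    also have "\<dots> = 2 ^ (2 * d + 4 * c + 1) * (1 / 2) ^ ((m - L) + (L - m))"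
      by (simp flip: power_add mult.assoc)
    also have "\<dots> \<le> 2 ^ (6 * d + 4 * c + 1) * (1 / 2) ^ ((m - L) + (L - m))"
      by (intro mult_right_mono power_increasing) auto
    finally show ?thesis
      using faber_energy_fine[OF u(1), of m l b] False by (simp add: L_def)
  qed
qed

end

section \<open>Summation over blocks and levels\<close>

text \<open>The block of digit r starts at N with the digits at positions up to r cleared, so it is
  aligned to a multiple of 2^r as the character sums require.\<close>

lemma sum_binary_blocks_upto:
  fixes f :: "nat \<Rightarrow> 'a :: comm_monoid_add"
  shows "sum f {..<N} = sum f {..<N div 2 ^ k * 2 ^ k} +
    (\<Sum>r\<in>{r. r < k \<and> bit N r}. sum f {2 * (N div 2 ^ Suc r) * 2 ^ r..<Suc (2 * (N div 2 ^ Suc r)) * 2 ^ r})"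
proof (induction k)
  case (Suc k)
  define b where "b = 2 * (N div 2 ^ Suc k)"
  have div: "N div 2 ^ k = b + of_bool (bit N k)"
  proof -
    have "N div 2 ^ k = 2 * (N div 2 ^ k div 2) + N div 2 ^ k mod 2" by simp
    also have "N div 2 ^ k div 2 = N div 2 ^ Suc k" by (simp only: div_mult2_eq[symmetric] power_Suc2)
    finally show ?thesis by (simp add: b_def bit_iff_odd odd_iff_mod_2_eq_one)
  qed
  have b: "N div 2 ^ Suc k * 2 ^ Suc k = b * 2 ^ k" by (simp add: b_def)
  show ?case
  proof (cases "bit N k")
    case True
    then have "{r. r < Suc k \<and> bit N r} = insert k {r. r < k \<and> bit N r}"
      by (auto simp: less_Suc_eq)
    moreover have "{..<N div 2 ^ k * 2 ^ k} = {..<b * 2 ^ k} \<union> {b * 2 ^ k..<Suc b * 2 ^ k}"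
      using True by (auto simp: div)
    moreover have "sum f ({..<b * 2 ^ k} \<union> {b * 2 ^ k..<Suc b * 2 ^ k}) =
        sum f {..<b * 2 ^ k} + sum f {b * 2 ^ k..<Suc b * 2 ^ k}"
      by (intro sum.union_disjoint) auto
    ultimately show ?thesis
      using Suc.IH by (simp only: b b_def[symmetric]) (simp add: b_def add.assoc)
  next
    case False
    then have "{r. r < Suc k \<and> bit N r} = {r. r < k \<and> bit N r}"
      by (auto simp: less_Suc_eq)
    then show ?thesis using Suc.IH False div by (simp only: b) simp
  qed
qed simp

lemma bit_nat_imp_less: "bit (n :: nat) r \<Longrightarrow> r < n"
  using bit_nat_imp_power_le[of n r] less_exp[of r] by linarith

lemma finite_bits_nat: "finite {r. bit (n :: nat) r}"
  by (rule finite_subset[of _ "{..<n}"]) (auto intro: bit_nat_imp_less)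

lemma sum_binary_blocks:
  fixes f :: "nat \<Rightarrow> 'a :: comm_monoid_add"
  shows "sum f {..<N} =
    (\<Sum>r\<in>{r. bit N r}. sum f {2 * (N div 2 ^ Suc r) * 2 ^ r..<Suc (2 * (N div 2 ^ Suc r)) * 2 ^ r})"
proof -
  have "{r. r < N \<and> bit N r} = {r. bit N r}" by (auto intro: bit_nat_imp_less)
  then show ?thesis
    using sum_binary_blocks_upto[of f N N] by (simp add: less_exp)
qed

lemma binary_block_le:
  assumes "bit N r"
  shows "Suc (2 * (N div 2 ^ Suc r)) * 2 ^ r \<le> N"
proof -
  have "Suc (2 * (N div 2 ^ Suc r)) = N div 2 ^ r"
  proof -
    have "N div 2 ^ r = 2 * (N div 2 ^ r div 2) + N div 2 ^ r mod 2" by simp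
    also have "N div 2 ^ r div 2 = N div 2 ^ Suc r" by (simp only: div_mult2_eq[symmetric] power_Suc2)
    finally show ?thesis using assms by (simp add: bit_iff_odd odd_iff_mod_2_eq_one)
  qed
  then show ?thesis by simp
qed

text \<open>Each distance from L is attained at most twice, once on either side.\<close>

lemma sum_distance_le:
  fixes g :: "nat \<Rightarrow> real"
  assumes "summable g" "\<And>k. g k \<ge> 0" "finite A"
  shows "(\<Sum>r\<in>A. g ((r - L) + (L - r))) \<le> 2 * suminf g"
proof -
  have *: "(\<Sum>r\<in>B. g ((r - L) + (L - r))) \<le> suminf g"
    if "finite B" "inj_on (\<lambda>r. (r - L) + (L - r)) B" for B
  proof -
    have "(\<Sum>r\<in>B. g ((r - L) + (L - r))) = sum g ((\<lambda>r. (r - L) + (L - r)) ` B)"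
      using that by (simp add: sum.reindex)
    also have "\<dots> \<le> suminf g"
      using assms that by (intro sum_le_suminf) auto
    finally show ?thesis .
  qed
  have "A = {r\<in>A. r < L} \<union> {r\<in>A. L \<le> r}" by auto
  then have "(\<Sum>r\<in>A. g ((r - L) + (L - r))) =
      (\<Sum>r\<in>{r\<in>A. r < L} \<union> {r\<in>A. L \<le> r}. g ((r - L) + (L - r)))" by simp
  also have "\<dots> = (\<Sum>r\<in>{r\<in>A. r < L}. g ((r - L) + (L - r))) + (\<Sum>r\<in>{r\<in>A. L \<le> r}. g ((r - L) + (L - r)))"
    using assms(3) by (intro sum.union_disjoint) auto
  also have "\<dots> \<le> suminf g + suminf g"
    using assms(3) by (intro add_mono *) (auto simp: inj_on_def)
  finally show ?thesis by simp
qed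

lemma weighted_Cauchy_Schwarz:
  fixes V :: "'a \<Rightarrow> real"
  assumes "\<And>r. r \<in> B \<Longrightarrow> w r > 0"
  shows "(\<Sum>r\<in>B. V r)\<^sup>2 \<le> (\<Sum>r\<in>B. w r) * (\<Sum>r\<in>B. (V r)\<^sup>2 / w r)"
proof -
  have "(\<Sum>r\<in>B. V r) = (\<Sum>r\<in>B. sqrt (w r) * (V r / sqrt (w r)))"
    using assms by (intro sum.cong) force+
  also have "\<dots>\<^sup>2 \<le> (\<Sum>r\<in>B. (sqrt (w r))\<^sup>2) * (\<Sum>r\<in>B. (V r / sqrt (w r))\<^sup>2)"
    by (rule Cauchy_Schwarz_ineq_sum)
  also have "\<dots> = (\<Sum>r\<in>B. w r) * (\<Sum>r\<in>B. (V r)\<^sup>2 / w r)"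
    using assms by (simp add: power_divide less_imp_le)
  finally show ?thesis .
qed

text \<open>Once the total is fixed, one level is determined by the others, and those are at most L.
  This is where the exponent d - 1 originates.\<close>

lemma card_compositions_le:
  assumes "finite u" "u \<noteq> {}"
  shows "card {l \<in> PiE u (\<lambda>_. {..<R}). sum l u = L} \<le> (L + 1) ^ (card u - 1)"
proof -
  obtain i where i: "i \<in> u" using assms by auto
  define S where "S = {l \<in> PiE u (\<lambda>_. {..<R}). sum l u = L}"
  have sum_u: "sum l u = l i + sum l (u - {i})" for l :: "_ \<Rightarrow> nat"
    using assms i by (simp add: sum.remove)
  have "inj_on (\<lambda>l. restrict l (u - {i})) S"
  proof (rule inj_onI)
    fix l l' assume l: "l \<in> S" "l' \<in> S" and eq: "restrict l (u - {i}) = restrict l' (u - {i})"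
    then have same: "l j = l' j" if "j \<in> u - {i}" for j using that by (metis restrict_apply')
    then have "sum l (u - {i}) = sum l' (u - {i})" by (intro sum.cong) auto
    then have "l i = l' i" using l sum_u[of l] sum_u[of l'] by (auto simp: S_def)
    then show "l = l'"
      using l same by (intro PiE_ext[of l u "\<lambda>_. {..<R}" l']) (auto simp: S_def)
  qed
  moreover have "(\<lambda>l. restrict l (u - {i})) ` S \<subseteq> PiE (u - {i}) (\<lambda>_. {..L})"
  proof clarify
    fix l assume "l \<in> S"
    then have "sum l u = L" by (simp add: S_def)
    then have "l j \<le> L" if "j \<in> u" for j using member_le_sum[OF that, of l] assms(1) by simp
    then show "restrict l (u - {i}) \<in> PiE (u - {i}) (\<lambda>_. {..L})" by auto
  qed
  ultimately have "card S \<le> card (PiE (u - {i}) (\<lambda>_. {..L}))"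
    using assms(1) by (intro card_inj_on_le[of "\<lambda>l. restrict l (u - {i})"]) (auto intro!: finite_PiE)
  also have "\<dots> = (L + 1) ^ (card u - 1)"
    using assms i by (simp add: card_PiE)
  finally show ?thesis by (simp add: S_def)
qed

text \<open>The growth of the number of level vectors at distance k from the digit position, damped
  by the decay 2/3 that remains after Cauchy-Schwarz.\<close>

definition level_weight :: "nat \<Rightarrow> nat \<Rightarrow> real" where
  "level_weight d k = real (k + 1) ^ (d - 1) * (2 / 3) ^ k"

lemma summable_level_weight: "summable (level_weight d)"
proof -
  have "(\<lambda>k. (real (Suc k + 1) / real (k + 1)) ^ (d - 1) * (2 / 3)) \<longlonglongrightarrow> 1 ^ (d - 1) * (2 / 3)"
  proof (intro tendsto_intros)
    have "(\<lambda>k. real (Suc k + 1) / real (k + 1)) = (\<lambda>k. 1 + inverse (real (Suc k)))"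
      by (auto simp: fun_eq_iff field_simps)
    then show "(\<lambda>k. real (Suc k + 1) / real (k + 1)) \<longlonglongrightarrow> 1"
      using LIMSEQ_inverse_real_of_nat_add[of 1] by simp
  qed
  \<comment> \<open>The ratio tends to 2/3; any bound strictly between 2/3 and 1 serves.\<close>
  then have "\<forall>\<^sub>F k in sequentially. (real (Suc k + 1) / real (k + 1)) ^ (d - 1) * (2 / 3) < 5 / 6"
    by (rule order_tendstoD) simp
  then obtain K where K: "(real (Suc k + 1) / real (k + 1)) ^ (d - 1) * (2 / 3) < 5 / 6" if "k \<ge> K" for k
    by (auto simp: eventually_sequentially)
  show ?thesis
  proof (rule summable_ratio_test)
    fix k assume "k \<ge> K"
    have "norm (level_weight d (Suc k)) =
        (real (Suc k + 1) / real (k + 1)) ^ (d - 1) * (2 / 3) * norm (level_weight d k)"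
      by (simp add: level_weight_def power_divide)
    also have "\<dots> \<le> 5 / 6 * norm (level_weight d k)"
      using K[OF \<open>k \<ge> K\<close>] by (intro mult_right_mono) auto
    finally show "norm (level_weight d (Suc k)) \<le> 5 / 6 * norm (level_weight d k)" .
  qed simp
qed

lemma level_weight_nonneg: "level_weight d k \<ge> 0"
  by (simp add: level_weight_def)

text \<open>The inequality L + 1 \<le> (r + 1) (|L - r| + 1) splits the number of level vectors into
  a power of r + 1 and a factor that the geometric decay sums, uniformly in r and R.\<close>

lemma sum_levels_le:
  assumes u: "u \<subseteq> {1..d}" "u \<noteq> {}"
  shows "(\<Sum>l\<in>PiE u (\<lambda>_. {..<R}). (2 / 3 :: real) ^ ((r - (\<Sum>i\<in>u. l i)) + ((\<Sum>i\<in>u. l i) - r))) \<le>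
    2 * real (r + 1) ^ (d - 1) * suminf (level_weight d)"
proof -
  define P where "P = PiE u (\<lambda>_. {..<R})"
  have fu: "finite u" using u finite_subset by auto
  have fP: "finite P" unfolding P_def using fu by (intro finite_PiE) auto
  have card_u: "card u \<le> d" using card_mono[OF _ u(1)] by simp
  define Ls where "Ls = (\<lambda>l. sum l u) ` P"
  have "(\<Sum>l\<in>P. (2 / 3 :: real) ^ ((r - sum l u) + (sum l u - r))) =
     (\<Sum>L\<in>Ls. \<Sum>l\<in>{l\<in>P. sum l u = L}. (2 / 3) ^ ((r - sum l u) + (sum l u - r)))"
    unfolding Ls_def using fP by (rule sum.image_gen)
  also have "\<dots> = (\<Sum>L\<in>Ls. real (card {l\<in>P. sum l u = L}) * (2 / 3) ^ ((r - L) + (L - r)))"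
    by (intro sum.cong) auto
  also have "\<dots> \<le> (\<Sum>L\<in>Ls. real (r + 1) ^ (d - 1) * level_weight d ((L - r) + (r - L)))"
  proof (intro sum_mono)
    fix L
    define t where "t = (L - r) + (r - L)"
    have "card {l\<in>P. sum l u = L} \<le> (L + 1) ^ (card u - 1)"
      unfolding P_def by (rule card_compositions_le[OF fu u(2)])
    also have "\<dots> \<le> (L + 1) ^ (d - 1)" using card_u by (intro power_increasing) auto
    also have "\<dots> \<le> ((r + 1) * (t + 1)) ^ (d - 1)"
    proof (rule power_mono)
      have "L + 1 \<le> r + 1 + t" unfolding t_def by linarith
      also have "\<dots> \<le> (r + 1) * (t + 1)" by simp
      finally show "L + 1 \<le> (r + 1) * (t + 1)" .
    qed simp
    finally have "real (card {l\<in>P. sum l u = L}) \<le> real (((r + 1) * (t + 1)) ^ (d - 1))"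
      by (rule of_nat_mono)
    then have "real (card {l\<in>P. sum l u = L}) \<le> real (r + 1) ^ (d - 1) * real (t + 1) ^ (d - 1)"
      by (simp only: of_nat_power of_nat_mult power_mult_distrib)
    then have "real (card {l\<in>P. sum l u = L}) * (2 / 3) ^ t \<le>
        real (r + 1) ^ (d - 1) * real (t + 1) ^ (d - 1) * (2 / 3) ^ t"
      by (rule mult_right_mono) simp
    then show "real (card {l\<in>P. sum l u = L}) * (2 / 3) ^ ((r - L) + (L - r)) \<le>
        real (r + 1) ^ (d - 1) * level_weight d ((L - r) + (r - L))"
      by (simp add: t_def level_weight_def add.commute mult.assoc)
  qed
  also have "\<dots> = real (r + 1) ^ (d - 1) * (\<Sum>L\<in>Ls. level_weight d ((L - r) + (r - L)))"
    by (simp add: sum_distrib_left)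
  also have "\<dots> \<le> real (r + 1) ^ (d - 1) * (2 * suminf (level_weight d))"
    using fP by (intro mult_left_mono sum_distance_le summable_level_weight level_weight_nonneg)
      (auto simp: Ls_def)
  finally show ?thesis by (simp add: P_def mult.commute mult.left_commute)
qed

context digital_net_blocks
begin

text \<open>Cauchy-Schwarz with weights (3/4)^|r - L|, whose sum is at most 8 however many binary
  digits N has; equal weights would cost a factor S(N). Dividing the block decay 1/2 by 3/4 leaves
  2/3.\<close>

lemma faber_energy_le:
  assumes u: "u \<subseteq> {1..d}" "u \<noteq> {}" and l: "\<And>i. i \<in> u \<Longrightarrow> l i < R"
  shows "faber_energy u l {..<N} \<le> 2 ^ (6 * d + 4 * c + 4) *
    (\<Sum>r\<in>{r. bit N r}. (2 / 3) ^ ((r - (\<Sum>i\<in>u. l i)) + ((\<Sum>i\<in>u. l i) - r)))"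
proof -
  define L where "L = (\<Sum>i\<in>u. l i)"
  define t where "t = (\<lambda>r. (r - L) + (L - r))"
  define B where "B = (\<lambda>r. {2 * (N div 2 ^ Suc r) * 2 ^ r..<Suc (2 * (N div 2 ^ Suc r)) * 2 ^ r})"
  define V where "V = (\<lambda>a r. \<Sum>n\<in>B r. \<Prod>i\<in>u. faber0 R (l i) (a i) (D n i))"
  define A where "A = PiE u (\<lambda>i. Pow {..<l i})"
  define Bits where "Bits = {r. bit N r}"
  have fin: "finite Bits" unfolding Bits_def by (rule finite_bits_nat)
  have w8: "(\<Sum>r\<in>Bits. (3 / 4 :: real) ^ t r) \<le> 8"
  proof -
    have "(\<Sum>r\<in>Bits. (3 / 4 :: real) ^ t r) \<le> 2 * (\<Sum>k. (3 / 4) ^ k)"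
      unfolding t_def using fin by (intro sum_distance_le summable_geometric) auto
    then show ?thesis by (simp add: suminf_geometric)
  qed
  have "faber_energy u l {..<N} = 2 ^ L * (\<Sum>a\<in>A. (\<Sum>r\<in>Bits. V a r)\<^sup>2)"
    unfolding faber_energy_def L_def A_def V_def B_def Bits_def sum_binary_blocks[of _ N] ..
  also have "\<dots> \<le> 2 ^ L * (\<Sum>a\<in>A. 8 * (\<Sum>r\<in>Bits. (V a r)\<^sup>2 / (3 / 4) ^ t r))"
  proof (intro mult_left_mono sum_mono)
    fix a
    have "(\<Sum>r\<in>Bits. V a r)\<^sup>2 \<le> (\<Sum>r\<in>Bits. (3 / 4) ^ t r) * (\<Sum>r\<in>Bits. (V a r)\<^sup>2 / (3 / 4) ^ t r)"
      by (rule weighted_Cauchy_Schwarz) simp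
    also have "\<dots> \<le> 8 * (\<Sum>r\<in>Bits. (V a r)\<^sup>2 / (3 / 4) ^ t r)"
      using w8 by (intro mult_right_mono sum_nonneg) auto
    finally show "(\<Sum>r\<in>Bits. V a r)\<^sup>2 \<le> 8 * (\<Sum>r\<in>Bits. (V a r)\<^sup>2 / (3 / 4) ^ t r)" .
  qed simp
  also have "\<dots> = 8 * (\<Sum>r\<in>Bits. faber_energy u l (B r) / (3 / 4) ^ t r)"
  proof -
    have "(\<Sum>a\<in>A. \<Sum>r\<in>Bits. (V a r)\<^sup>2 / (3 / 4) ^ t r) = (\<Sum>r\<in>Bits. (\<Sum>a\<in>A. (V a r)\<^sup>2) / (3 / 4) ^ t r)"
      by (subst sum.swap) (simp only: sum_divide_distrib)
    then show ?thesis
      by (simp add: faber_energy_def V_def A_def L_def sum_distrib_left[symmetric])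
         (simp add: sum_distrib_left)
  qed
  also have "\<dots> \<le> 8 * (\<Sum>r\<in>Bits. 2 ^ (6 * d + 4 * c + 1) * (2 / 3) ^ t r)"
  proof (intro mult_left_mono sum_mono)
    fix r assume "r \<in> Bits"
    then have "faber_energy u l (B r) \<le> 2 ^ (6 * d + 4 * c + 1) * (1 / 2) ^ t r"
      unfolding B_def t_def L_def
      by (intro faber_energy_block u l binary_block_le) (simp_all add: Bits_def)
    then have "faber_energy u l (B r) / (3 / 4) ^ t r \<le> 2 ^ (6 * d + 4 * c + 1) * (1 / 2) ^ t r / (3 / 4) ^ t r"
      by (rule divide_right_mono) simp
    also have "\<dots> = 2 ^ (6 * d + 4 * c + 1) * ((1 / 2) / (3 / 4)) ^ t r"
      unfolding power_divide by simp
    finally show "faber_energy u l (B r) / (3 / 4) ^ t r \<le> 2 ^ (6 * d + 4 * c + 1) * (2 / 3) ^ t r" by simp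
  qed simp
  also have "\<dots> = 2 ^ (6 * d + 4 * c + 4) * (\<Sum>r\<in>Bits. (2 / 3) ^ t r)"
    by (simp add: sum_distrib_left power_add ac_simps)
  finally show ?thesis by (simp add: t_def L_def Bits_def)
qed

lemma sum_faber_energy_le:
  assumes u: "u \<subseteq> {1..d}" "u \<noteq> {}"
  shows "(\<Sum>l\<in>PiE u (\<lambda>_. {..<R}). faber_energy u l {..<N}) \<le>
    2 ^ (6 * d + 4 * c + 5) * suminf (level_weight d) * (\<Sum>r\<in>{r. bit N r}. real (r + 1) ^ (d - 1))"
proof -
  have "(\<Sum>l\<in>PiE u (\<lambda>_. {..<R}). faber_energy u l {..<N}) \<le>
     (\<Sum>l\<in>PiE u (\<lambda>_. {..<R}). 2 ^ (6 * d + 4 * c + 4) *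
      (\<Sum>r\<in>{r. bit N r}. (2 / 3) ^ ((r - (\<Sum>i\<in>u. l i)) + ((\<Sum>i\<in>u. l i) - r))))"
    by (intro sum_mono faber_energy_le u) (auto simp: PiE_iff)
  also have "\<dots> = 2 ^ (6 * d + 4 * c + 4) * (\<Sum>r\<in>{r. bit N r}.
      \<Sum>l\<in>PiE u (\<lambda>_. {..<R}). (2 / 3) ^ ((r - (\<Sum>i\<in>u. l i)) + ((\<Sum>i\<in>u. l i) - r)))"
    unfolding sum_distrib_left[symmetric] by (subst sum.swap) (rule refl)
  also have "\<dots> \<le> 2 ^ (6 * d + 4 * c + 4) *
      (\<Sum>r\<in>{r. bit N r}. 2 * real (r + 1) ^ (d - 1) * suminf (level_weight d))"
    by (intro mult_left_mono sum_mono sum_levels_le u) auto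
  also have "\<dots> = 2 ^ (6 * d + 4 * c + 5) * suminf (level_weight d) * (\<Sum>r\<in>{r. bit N r}. real (r + 1) ^ (d - 1))"
    by (simp add: sum_distrib_left sum_distrib_right power_add algebra_simps)
  finally show ?thesis .
qed

text \<open>Here u is the set of coordinates in which the level sum is picked rather than the
  constant. Each remaining term is a product of a function of n and the same function of m, so the
  double sum over points becomes a square.\<close>

lemma sum_kernel_products:
  "(\<Sum>n<N. \<Sum>m<N. \<Prod>j=1..d. periodic_kernel (dyadic_val R (D n j)) (dyadic_val R (D m j))) =
    (\<Sum>u\<in>Pow {1..d}. (1 / 3 + 1 / (6 * 4 ^ R)) ^ (d - card u) *
      (2 ^ card u * (\<Sum>l\<in>PiE u (\<lambda>_. {..<R}). faber_energy u l {..<N})))"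
proof -
  define A :: real where "A = 1 / 3 + 1 / (6 * 4 ^ R)"
  define \<phi> where "\<phi> = (\<lambda>u l a n. \<Prod>j\<in>u. faber0 R (l j) (a j) (D n j))"
  have prod: "(\<Prod>j=1..d. periodic_kernel (dyadic_val R (D n j)) (dyadic_val R (D m j))) =
     (\<Sum>u\<in>Pow {1..d}. A ^ (d - card u) * (2 ^ card u * (\<Sum>l\<in>PiE u (\<lambda>_. {..<R}).
       2 ^ (\<Sum>j\<in>u. l j) * (\<Sum>a\<in>PiE u (\<lambda>j. Pow {..<l j}). \<phi> u l a n * \<phi> u l a m))))" for n m
  proof -
    define \<kappa> where "\<kappa> = (\<lambda>j l. 2 * 2 ^ l * (\<Sum>a\<in>Pow {..<l}. faber0 R l a (D n j) * faber0 R l a (D m j)))"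
    have "(\<Prod>j=1..d. periodic_kernel (dyadic_val R (D n j)) (dyadic_val R (D m j))) =
        (\<Prod>j=1..d. (\<Sum>l<R. \<kappa> j l) + A)"
      unfolding periodic_kernel_expansion by (simp add: A_def \<kappa>_def algebra_simps)
    also have "\<dots> = (\<Sum>u\<in>Pow {1..d}. (\<Prod>j\<in>u. \<Sum>l<R. \<kappa> j l) * (\<Prod>j\<in>{1..d} - u. A))"
      by (rule prod_add) simp
    also have "\<dots> = (\<Sum>u\<in>Pow {1..d}. A ^ (d - card u) * (2 ^ card u * (\<Sum>l\<in>PiE u (\<lambda>_. {..<R}).
       2 ^ (\<Sum>j\<in>u. l j) * (\<Sum>a\<in>PiE u (\<lambda>j. Pow {..<l j}). \<phi> u l a n * \<phi> u l a m))))"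
    proof (rule sum.cong[OF refl])
      fix u assume "u \<in> Pow {1..d}"
      then have u: "u \<subseteq> {1..d}" by simp
      then have fu: "finite u" using finite_subset by auto
      have "(\<Prod>j\<in>u. \<Sum>l<R. \<kappa> j l) = (\<Sum>l\<in>PiE u (\<lambda>_. {..<R}). \<Prod>j\<in>u. \<kappa> j (l j))"
        using fu by (intro prod_sum_PiE) auto
      also have "\<dots> = (\<Sum>l\<in>PiE u (\<lambda>_. {..<R}). 2 ^ card u * (2 ^ (\<Sum>j\<in>u. l j) *
          (\<Sum>a\<in>PiE u (\<lambda>j. Pow {..<l j}). \<phi> u l a n * \<phi> u l a m)))"
      proof (rule sum.cong[OF refl])
        fix l
        have "(\<Prod>j\<in>u. \<Sum>a\<in>Pow {..<l j}. faber0 R (l j) a (D n j) * faber0 R (l j) a (D m j)) =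
            (\<Sum>a\<in>PiE u (\<lambda>j. Pow {..<l j}). \<Prod>j\<in>u. faber0 R (l j) (a j) (D n j) * faber0 R (l j) (a j) (D m j))"
          using fu by (intro prod_sum_PiE) auto
        then show "(\<Prod>j\<in>u. \<kappa> j (l j)) = 2 ^ card u * (2 ^ (\<Sum>j\<in>u. l j) *
          (\<Sum>a\<in>PiE u (\<lambda>j. Pow {..<l j}). \<phi> u l a n * \<phi> u l a m))"
          by (simp add: \<kappa>_def \<phi>_def prod.distrib power_sum)
      qed
      also have "\<dots> = 2 ^ card u * (\<Sum>l\<in>PiE u (\<lambda>_. {..<R}). 2 ^ (\<Sum>j\<in>u. l j) *
          (\<Sum>a\<in>PiE u (\<lambda>j. Pow {..<l j}). \<phi> u l a n * \<phi> u l a m))"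
        by (simp only: sum_distrib_left)
      finally show "(\<Prod>j\<in>u. \<Sum>l<R. \<kappa> j l) * (\<Prod>j\<in>{1..d} - u. A) =
          A ^ (d - card u) * (2 ^ card u * (\<Sum>l\<in>PiE u (\<lambda>_. {..<R}).
       2 ^ (\<Sum>j\<in>u. l j) * (\<Sum>a\<in>PiE u (\<lambda>j. Pow {..<l j}). \<phi> u l a n * \<phi> u l a m)))"
        using u fu by (simp add: card_Diff_subset)
    qed
    finally show ?thesis .
  qed
  have swap: "(\<Sum>n<N. \<Sum>m<N. \<Sum>x\<in>Q. f x * g x n m) = (\<Sum>x\<in>Q. f x * (\<Sum>n<N. \<Sum>m<N. g x n m))"
    for Q :: "'b set" and f :: "'b \<Rightarrow> real" and g
    by (simp only: sum_distrib_left sum.swap[of _ Q])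
  have swap1: "(\<Sum>n<N. \<Sum>m<N. \<Sum>x\<in>Q. g x n m) = (\<Sum>x\<in>Q. \<Sum>n<N. \<Sum>m<N. g x n m)"
    for Q :: "'b set" and g :: "'b \<Rightarrow> nat \<Rightarrow> nat \<Rightarrow> real"
    by (simp only: sum.swap[of _ Q])
  show ?thesis
    unfolding prod faber_energy_def A_def[symmetric] \<phi>_def[symmetric] swap swap1
    unfolding sum_distrib_left[symmetric] swap swap1
    unfolding \<phi>_def power2_eq_square sum_product
    by (simp only: sum_distrib_left)
qed

text \<open>The empty coordinate set contributes nearly the subtracted N^2 / 3^d. The excess is at
  most d / (6 * 4^R) * N^2, and N \<le> 2^R keeps it below d.\<close>

lemma kernel_sum_bound:
  assumes "N \<ge> 1" "N \<le> 2 ^ R"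
  shows "(\<Sum>n<N. \<Sum>m<N. \<Prod>j=1..d. periodic_kernel (dyadic_val R (D n j)) (dyadic_val R (D m j))) -
      (real N)\<^sup>2 / 3 ^ d \<le>
    real d + 4 ^ d * 2 ^ (6 * d + 4 * c + 5) * suminf (level_weight d) * (\<Sum>r\<in>{r. bit N r}. real (r + 1) ^ (d - 1))"
proof -
  define A :: real where "A = 1 / 3 + 1 / (6 * 4 ^ R)"
  define E where "E = (\<lambda>u. \<Sum>l\<in>PiE u (\<lambda>_. {..<R}). faber_energy u l {..<N})"
  define M where "M = 2 ^ (6 * d + 4 * c + 5) * suminf (level_weight d) * (\<Sum>r\<in>{r. bit N r}. real (r + 1) ^ (d - 1))"
  have M: "M \<ge> 0"
    unfolding M_def by (intro mult_nonneg_nonneg sum_nonneg suminf_nonneg summable_level_weight level_weight_nonneg) auto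
  have "1 / (6 * 4 ^ R) \<le> (1 / 6 :: real)" by (simp add: field_simps)
  then have "A \<le> 1 / 3 + 1 / 6" unfolding A_def by (rule add_left_mono)
  then have A: "0 \<le> A" "A \<le> 1" by (simp_all add: A_def)
  have E0: "E {} = (real N)\<^sup>2"
    by (simp add: E_def faber_energy_def)
  have "(\<Sum>n<N. \<Sum>m<N. \<Prod>j=1..d. periodic_kernel (dyadic_val R (D n j)) (dyadic_val R (D m j))) =
      (\<Sum>u\<in>Pow {1..d}. A ^ (d - card u) * (2 ^ card u * E u))"
    unfolding sum_kernel_products A_def E_def ..
  also have "\<dots> = A ^ d * (real N)\<^sup>2 + (\<Sum>u\<in>Pow {1..d} - {{}}. A ^ (d - card u) * (2 ^ card u * E u))"
    by (subst sum.remove[of _ "{}"]) (simp_all add: E0)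
  also have "(\<Sum>u\<in>Pow {1..d} - {{}}. A ^ (d - card u) * (2 ^ card u * E u)) \<le> (\<Sum>u\<in>Pow {1..d} - {{}}. 2 ^ d * M)"
  proof (intro sum_mono)
    fix u assume "u \<in> Pow {1..d} - {{}}"
    then have u: "u \<subseteq> {1..d}" "u \<noteq> {}" by auto
    have "E u \<le> M" unfolding E_def M_def by (rule sum_faber_energy_le[OF u])
    then have "2 ^ card u * E u \<le> 2 ^ card u * M" by (rule mult_left_mono) simp
    also have "\<dots> \<le> 2 ^ d * M"
      using card_mono[OF _ u(1)] M by (intro mult_right_mono power_increasing) auto
    finally have "2 ^ card u * E u \<le> 2 ^ d * M" .
    then have "A ^ (d - card u) * (2 ^ card u * E u) \<le> A ^ (d - card u) * (2 ^ d * M)"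
      using A by (intro mult_left_mono) auto
    also have "\<dots> \<le> 1 * (2 ^ d * M)"
      using A M by (intro mult_right_mono power_le_one) auto
    finally show "A ^ (d - card u) * (2 ^ card u * E u) \<le> 2 ^ d * M" by simp
  qed
  also have "(\<Sum>u\<in>Pow {1..d} - {{}}. 2 ^ d * M) \<le> 2 ^ d * (2 ^ d * M)"
  proof -
    have "card (Pow {1..d} - {{}}) \<le> card (Pow {1..d})" by (intro card_mono) auto
    then have "real (card (Pow {1..d} - {{}})) \<le> 2 ^ d" by (simp add: card_Pow)
    then show ?thesis
      unfolding sum_constant using M by (intro mult_right_mono) auto
  qed
  finally have "(\<Sum>n<N. \<Sum>m<N. \<Prod>j=1..d. periodic_kernel (dyadic_val R (D n j)) (dyadic_val R (D m j))) \<le>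
      A ^ d * (real N)\<^sup>2 + 2 ^ d * (2 ^ d * M)" by simp
  moreover have "A ^ d * (real N)\<^sup>2 - (real N)\<^sup>2 / 3 ^ d \<le> real d"
  proof -
    have "A ^ d - (1 / 3) ^ d \<le> norm (A ^ d - (1 / 3) ^ d)" by simp
    also have "\<dots> \<le> real d * norm (A - 1 / 3)"
      using A by (intro norm_power_diff) auto
    also have "\<dots> = real d * (1 / (6 * 4 ^ R))"
      by (simp add: A_def)
    finally have "(A ^ d - (1 / 3) ^ d) * (real N)\<^sup>2 \<le> real d * (1 / (6 * 4 ^ R)) * 4 ^ R"
    proof (rule mult_mono)
      have "real N \<le> 2 ^ R" using assms(2) by (metis of_nat_le_iff of_nat_numeral of_nat_power)
      then have "(real N)\<^sup>2 \<le> (2 ^ R)\<^sup>2" by (intro power_mono) auto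
      then show "(real N)\<^sup>2 \<le> 4 ^ R" by (simp add: power2_eq_square flip: power_mult_distrib)
    qed auto
    also have "\<dots> \<le> real d" by simp
    finally show ?thesis by (simp add: power_one_over algebra_simps)
  qed
  moreover have "2 ^ d * (2 ^ d * M) = 4 ^ d * M"
    by (simp flip: mult.assoc power_mult_distrib)
  ultimately have "(\<Sum>n<N. \<Sum>m<N. \<Prod>j=1..d. periodic_kernel (dyadic_val R (D n j)) (dyadic_val R (D m j))) -
      (real N)\<^sup>2 / 3 ^ d \<le> real d + 4 ^ d * M" by linarith
  then show ?thesis by (simp only: M_def mult.assoc)
qed

end

section \<open>The final bound for the interlaced sequence\<close>

lemma sum_bits_powers_le:
  assumes "N \<ge> 2"
  shows "(\<Sum>r\<in>{r. bit N r}. real (r + 1) ^ k) \<le> real (sum_of_binary_digits N) * (4 * ln (real N)) ^ k"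
proof -
  have "(\<Sum>r\<in>{r. bit N r}. real (r + 1) ^ k) \<le> (\<Sum>r\<in>{r. bit N r}. (4 * ln (real N)) ^ k)"
  \<comment> \<open>Since ln 2 \<ge> 2/3 and N \<ge> 2, both r \<le> 2 ln N and 1 \<le> (3/2) ln N
    hold, so 4 ln N dominates r + 1.\<close>
  proof (intro sum_mono power_mono)
    fix r assume "r \<in> {r. bit N r}"
    then have "2 ^ r \<le> N" by (simp add: bit_nat_imp_power_le)
    then have "(2 :: real) ^ r \<le> real N" by (metis of_nat_le_iff of_nat_numeral of_nat_power)
    then have "ln (2 ^ r) \<le> ln (real N)" using assms by (subst ln_le_cancel_iff) auto
    then have "real r * ln 2 \<le> ln (real N)" by (simp add: ln_realpow)
    moreover have "real r * (1 / 2) \<le> real r * ln 2"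
      using ln2_ge_two_thirds by (intro mult_left_mono) auto
    moreover have "ln 2 \<le> ln (real N)" using assms by (subst ln_le_cancel_iff) auto
    ultimately show "real (r + 1) \<le> 4 * ln (real N)"
      using ln2_ge_two_thirds by simp
  qed simp
  then show ?thesis by (simp add: sum_of_binary_digits_def)
qed

text \<open>The number of digits does not enter the final estimate, so the crude bound n < 2^N
  suffices to choose it.\<close>

lemma digital_net_blocks_interlaced_sobol:
  assumes q: "sorted_primitive_list q" and \<alpha>: "\<alpha> \<ge> 5"
  shows "digital_net_blocks d ((\<Sum>j=1..\<alpha> * d. degree (sobol_poly q j)) + d * (\<alpha> + 1)) (N * \<alpha>) N
    (interlaced_digit \<alpha> q)"
proof
  fix m b E v and l \<beta> :: "nat \<Rightarrow> nat"
  assume "finite E" "E \<noteq> {}" "v \<subseteq> {1..d}" "\<And>i p. (i, p) \<in> E \<Longrightarrow> i \<in> v \<and> (p \<le> l i \<or> p = l i + \<beta> i)"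
    "5 * (\<Sum>i\<in>v. l i) + (\<Sum>i\<in>v. \<beta> i) + 5 * ((\<Sum>j=1..\<alpha> * d. degree (sobol_poly q j)) + d * (\<alpha> + 1)) \<le> 5 * m"
  then show "(\<Sum>n\<in>{b * 2 ^ m..<Suc b * 2 ^ m}. \<Prod>(i, p)\<in>E. digit_sign (interlaced_digit \<alpha> q n i) p) = 0"
    by (rule interlaced_character_sum_eq_0[OF q \<alpha>])
next
  fix n i assume "n < N"
  then have "n < 2 ^ N" using less_exp[of N] by linarith
  then show "\<not> interlaced_digit \<alpha> q n i (N * \<alpha>)"
    using q \<alpha> by (intro interlaced_digit_eq_False[where M = N]) auto
qed

lemma interlaced_sobol_discrepancy_le:
  assumes q: "sorted_primitive_list q" and \<alpha>: "\<alpha> \<ge> 5" and d: "d \<ge> 1" and N: "N \<ge> 2"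
    and c: "c = (\<Sum>j=1..\<alpha> * d. degree (sobol_poly q j)) + d * (\<alpha> + 1)"
  shows "periodic_L2_discrepancy d N (interlaced_sobol_sequence \<alpha> d q) \<le>
    sqrt (real d + 4 ^ d * 2 ^ (6 * d + 4 * c + 5) * suminf (level_weight d)) * 2 ^ (d - 1) *
    (ln (real N) powr ((real d - 1) / 2) / real N) * sqrt (real (sum_of_binary_digits N))"
proof -
  define X where "X = interlaced_sobol_sequence \<alpha> d q"
  define R where "R = N * \<alpha>"
  define K where "K = 4 ^ d * 2 ^ (6 * d + 4 * c + 5) * suminf (level_weight d)"
  define S where "S = real (sum_of_binary_digits N)"
  define F where "F = (\<Sum>r\<in>{r. bit N r}. real (r + 1) ^ (d - 1))"
  interpret digital_net_blocks d c R N "interlaced_digit \<alpha> q"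
    unfolding c R_def by (rule digital_net_blocks_interlaced_sobol[OF q \<alpha>])
  have K: "K \<ge> 0"
    unfolding K_def by (intro mult_nonneg_nonneg suminf_nonneg summable_level_weight level_weight_nonneg) auto
  have ln_pos: "ln (real N) > 0" using N by simp
  have X: "X n j = dyadic_val R (interlaced_digit \<alpha> q n j)" if "n < N" "j \<in> {1..d}" for n j
  proof -
    have "n < 2 ^ N" using that(1) less_exp[of N] by linarith
    then show ?thesis
      unfolding X_def R_def using q \<alpha> that(2) by (intro interlaced_sobol_sequence_eq_dyadic_val) auto
  qed
  have "periodic_L2_discrepancy d N X =
      sqrt ((\<Sum>n<N. \<Sum>m<N. \<Prod>j=1..d. periodic_kernel (X n j) (X m j)) - (real N)\<^sup>2 / 3 ^ d) / real N"
    using N by (intro periodic_L2_discrepancy_eq)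
      (auto simp: X dyadic_val_nonneg dyadic_val_less_1, simp add: X_def interlaced_sobol_sequence_def interlace_d_def)
  also have "(\<Sum>n<N. \<Sum>m<N. \<Prod>j=1..d. periodic_kernel (X n j) (X m j)) =
      (\<Sum>n<N. \<Sum>m<N. \<Prod>j=1..d. periodic_kernel (dyadic_val R (interlaced_digit \<alpha> q n j))
        (dyadic_val R (interlaced_digit \<alpha> q m j)))"
    by (intro sum.cong prod.cong refl) (auto simp: X)
  also have "sqrt (\<dots> - (real N)\<^sup>2 / 3 ^ d) / real N \<le> sqrt ((real d + K) * (S * (4 * ln (real N)) ^ (d - 1))) / real N"
  proof (intro divide_right_mono real_sqrt_le_mono)
    have "N \<le> R" using \<alpha> by (simp add: R_def)
    then have "N \<le> 2 ^ R" using less_exp[of R] by linarith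
    then have "(\<Sum>n<N. \<Sum>m<N. \<Prod>j=1..d. periodic_kernel (dyadic_val R (interlaced_digit \<alpha> q n j))
        (dyadic_val R (interlaced_digit \<alpha> q m j))) - (real N)\<^sup>2 / 3 ^ d \<le> real d + K * F"
      unfolding K_def F_def using N by (intro kernel_sum_bound) auto
    \<comment> \<open>The additive d is absorbed because N has a nonzero binary digit, whence F
      \<ge> 1.\<close>
    also have "\<dots> \<le> real d * F + K * F"
    proof -
      have "{r. bit N r} \<noteq> {}"
        using N by (metis Collect_empty_eq bit_eqI bit_0_eq bot_apply bot_bool_def not_numeral_le_zero)
      then obtain r where "r \<in> {r. bit N r}" by auto
      then have "real (r + 1) ^ (d - 1) \<le> F"
        unfolding F_def by (intro member_le_sum finite_bits_nat) auto
      moreover have "1 \<le> real (r + 1) ^ (d - 1)" by (intro one_le_power) simp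
      ultimately have "1 \<le> F" by linarith
      then show ?thesis using mult_left_mono[of 1 F "real d"] by simp
    qed
    also have "\<dots> = (real d + K) * F" by (simp add: algebra_simps)
    also have "\<dots> \<le> (real d + K) * (S * (4 * ln (real N)) ^ (d - 1))"
      unfolding F_def S_def using K by (intro mult_left_mono sum_bits_powers_le N) auto
    finally show "(\<Sum>n<N. \<Sum>m<N. \<Prod>j=1..d. periodic_kernel (dyadic_val R (interlaced_digit \<alpha> q n j))
        (dyadic_val R (interlaced_digit \<alpha> q m j))) - (real N)\<^sup>2 / 3 ^ d \<le> (real d + K) * (S * (4 * ln (real N)) ^ (d - 1))" .
  qed simp
  \<comment> \<open>Written as a square so that the root turns it into the real power (d - 1)/2,
    which need not be an integer.\<close>
  also have "(4 * ln (real N)) ^ (d - 1) = (2 ^ (d - 1) * ln (real N) powr ((real d - 1) / 2))\<^sup>2"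
  proof -
    have "(ln (real N) powr ((real d - 1) / 2))\<^sup>2 = ln (real N) powr (real d - 1)"
      by (simp add: power2_eq_square flip: powr_add)
    also have "\<dots> = ln (real N) ^ (d - 1)"
      using powr_realpow[OF ln_pos, of "d - 1"] d by simp
    finally have "(ln (real N) powr ((real d - 1) / 2))\<^sup>2 = ln (real N) ^ (d - 1)" .
    moreover have "((2 :: real) ^ (d - 1))\<^sup>2 = 4 ^ (d - 1)"
      by (simp add: power2_eq_square flip: power_mult_distrib)
    ultimately show ?thesis by (simp add: power_mult_distrib)
  qed
  also have "sqrt ((real d + K) * (S * (2 ^ (d - 1) * ln (real N) powr ((real d - 1) / 2))\<^sup>2)) =
      sqrt (real d + K) * (sqrt S * (2 ^ (d - 1) * ln (real N) powr ((real d - 1) / 2)))"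
    unfolding real_sqrt_mult real_sqrt_abs by simp
  finally show ?thesis
    by (simp add: X_def K_def S_def mult.commute mult.left_commute)
qed

theorem theorem2:
  fixes d \<alpha> :: nat
  assumes "d \<ge> 2" and "\<alpha> \<ge> 5"
  shows "\<exists>C>0. \<forall>q. sorted_primitive_list q \<longrightarrow> (\<forall>N\<ge>2.
    periodic_L2_discrepancy d N (interlaced_sobol_sequence \<alpha> d q)
      \<le> C * (ln (real N) powr ((real d - 1) / 2) / real N) * sqrt (real (sum_of_binary_digits N)))"
proof (cases "\<exists>q. sorted_primitive_list q")
  case False
  then show ?thesis by (intro exI[of _ 1]) auto
next
  case True
  then obtain q0 where q0: "sorted_primitive_list q0" by auto
  \<comment> \<open>The constant must be chosen before q. It is read off from a reference list q0;
    all lists have the same degrees and hence the same defect.\<close>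
  define c where "c = (\<Sum>j=1..\<alpha> * d. degree (sobol_poly q0 j)) + d * (\<alpha> + 1)"
  define K where "K = real d + 4 ^ d * 2 ^ (6 * d + 4 * c + 5) * suminf (level_weight d)"
  have "4 ^ d * 2 ^ (6 * d + 4 * c + 5) * suminf (level_weight d) \<ge> 0"
    by (intro mult_nonneg_nonneg suminf_nonneg summable_level_weight level_weight_nonneg) auto
  then have "K > 0" using assms(1) by (simp add: K_def)
  show ?thesis
  proof (intro exI[of _ "sqrt K * 2 ^ (d - 1)"] conjI allI impI)
    show "0 < sqrt K * 2 ^ (d - 1)" using \<open>K > 0\<close> by simp
    fix q and N :: nat assume q: "sorted_primitive_list q" and N: "N \<ge> 2"
    have "c = (\<Sum>j=1..\<alpha> * d. degree (sobol_poly q j)) + d * (\<alpha> + 1)"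
      unfolding c_def using degree_sobol_poly_cong[OF q0 q] by simp
    then show "periodic_L2_discrepancy d N (interlaced_sobol_sequence \<alpha> d q)
      \<le> sqrt K * 2 ^ (d - 1) * (ln (real N) powr ((real d - 1) / 2) / real N) *
        sqrt (real (sum_of_binary_digits N))"
      unfolding K_def using q assms N by (intro interlaced_sobol_discrepancy_le) auto
  qed
qed

end
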